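(* Let $\mathcal H$ be an infinite-dimensional complex Hilbert space, let $E\subset c_0$ be a fully symmetric sequence space, and let $\mathcal C_E\subset\mathcal K(\mathcal H)$ be the Banach ideal of compact operators associated with $E$. For a Dunford-Schwartz operator $T$ put $A_n(T)(x)=\frac1{n+1}\sum_{k=0}^n T^k(x)$. (i) For every Dunford-Schwartz operator $T$ (acting on $\mathcal C_E$) and every $x\in\mathcal C_E$ there exists $\widehat x\in\mathcal C_E$ such that $\|A_n(T)(x)-\widehat x\|_\infty\to 0$ as $n\to\infty$. (ii) If $x\in\mathcal B(\mathcal H)\setminus\mathcal K(\mathcal H)$, then there exists a Dunford-Schwartz operator $T:\mathcal B(\mathcal H)\to\mathcal B(\mathcal H)$ such that the sequence $\{A_n(T)(x)\}$ does not converge in the uniform norm $\|\cdot\|_\infty$.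
   Context: $\mathcal B(\mathcal H)$ and $\mathcal K(\mathcal H)$ are the algebras of bounded, respectively compact, linear operators on $\mathcal H$, and $\|\cdot\|_\infty$ is the operator norm (also called the uniform norm). $\mathcal H$ is not assumed separable. $\mathcal C^1$ is the trace class with norm $\|x\|_1=\tau(|x|)$, $\tau$ the canonical trace. A linear operator $T:\mathcal B(\mathcal H)\to\mathcal B(\mathcal H)$ is a Dunford-Schwartz operator if $\|T(x)\|_1\le\|x\|_1$ for all $x\in\mathcal C^1$ and $\|T(x)\|_\infty\le\|x\|_\infty$ for all $x\in\mathcal B(\mathcal H)$. Such a $T$ maps $\mathcal C_E$ into $\mathcal C_E$ whenever $E\subset c_0$ is fully symmetric. $l^\infty$ and $c_0$ are the spaces of complex sequences (indexed by $n\ge 1$) that are bounded, respectively converge to $0$. For $\xi=\{\xi_n\}\in l^\infty$ the non-increasing rearrangement is $\xi^*=\{\xi^*_n\}$, $\xi_n^*=\inf\{\sup_{m\notin F}|\xi_m| : F\subset\mathbb N,\ |F|<n\}$. Write $\xi\prec\prec\eta$ if $\sum_{n=1}^m\xi_n^*\le\sum_{n=1}^m\eta_n^*$ for all $m\in\mathbb N$. A fully symmetric sequence space is a non-zero linear subspace $E\subset l^\infty$ with a complete norm $\|\cdot\|_E$ such that $\eta\in E$, $\xi\in l^\infty$, $\xi\prec\prec\eta$ imply $\xi\in E$ and $\|\xi\|_E\le\|\eta\|_E$. For $x\in\mathcal K(\mathcal H)$, $\{s_n(x)\}_{n=1}^\infty$ are the singular values of $x$ (eigenvalues of $|x|$ in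 decreasing order, counted with multiplicity, completed by zeros if there are finitely many). $\mathcal C_E=\{x\in\mathcal K(\mathcal H):\{s_n(x)\}\in E\}$ with norm $\|x\|_{\mathcal C_E}=\|\{s_n(x)\}\|_E$. *)

theory Defs
  imports "HOL-Analysis.Analysis"
begin

section \<open>Complex Hilbert spaces\<close>

text \<open>The real structure (\<open>scaleR\<close>, \<open>inner\<close>, norm, topology) of the superclass is the one
  induced by the complex structure. In particular the norm is \<open>sqrt (Re (cinner x x))\<close>, and
  positive definiteness of \<open>cinner\<close> follows from that of \<open>inner\<close>.\<close>

class complex_inner = real_inner +
  fixes scaleC :: "complex \<Rightarrow> 'a \<Rightarrow> 'a"  (infixr "*\<^sub>C" 75)
    and cinner :: "'a \<Rightarrow> 'a \<Rightarrow> complex"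
  assumes scaleC_add_right: "c *\<^sub>C (x + y) = c *\<^sub>C x + c *\<^sub>C y"
    and scaleC_add_left: "(c + d) *\<^sub>C x = c *\<^sub>C x + d *\<^sub>C x"
    and scaleC_scaleC: "c *\<^sub>C (d *\<^sub>C x) = (c * d) *\<^sub>C x"
    and scaleC_one: "1 *\<^sub>C x = x"
    and scaleR_scaleC: "r *\<^sub>R x = complex_of_real r *\<^sub>C x"
    and cinner_commute: "cinner x y = cnj (cinner y x)"
    and cinner_add_left: "cinner (x + y) z = cinner x z + cinner y z"
    and cinner_scaleC_left: "cinner (c *\<^sub>C x) y = c * cinner x y"
    and inner_eq_Re_cinner: "inner x y = Re (cinner x y)"

class complex_hilbert_space = complex_inner + complete_space

global_interpretation complex_vector: vector_space "scaleC :: complex \<Rightarrow> 'a \<Rightarrow> 'a::complex_inner"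
  defines cspan = complex_vector.span
    and cdim = complex_vector.dim
  by unfold_locales (simp_all add: scaleC_add_right scaleC_add_left scaleC_scaleC scaleC_one)

lemma norm_scaleC: "norm (c *\<^sub>C x) = cmod c * norm (x :: 'a::complex_inner)"
proof -
  have r: "cinner a (d *\<^sub>C b) = cnj d * cinner a b" for a b :: 'a and d
    by (metis cinner_commute cinner_scaleC_left complex_cnj_mult)
  have "cinner (c *\<^sub>C x) (c *\<^sub>C x) = complex_of_real ((cmod c)\<^sup>2) * cinner x x"
    by (simp add: r cinner_scaleC_left complex_norm_square del: of_real_power)
  then have "inner (c *\<^sub>C x) (c *\<^sub>C x) = (cmod c)\<^sup>2 * inner x x"
    by (simp add: inner_eq_Re_cinner del: of_real_power)
  then show ?thesis
    by (simp add: norm_eq_sqrt_inner real_sqrt_mult)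
qed

definition infinite_dimensional :: "'a::complex_inner itself \<Rightarrow> bool" where
  "infinite_dimensional _ \<longleftrightarrow> \<not> (\<exists>B :: 'a set. finite B \<and> cspan B = UNIV)"


section \<open>Bounded and compact operators\<close>

text \<open>The library type \<open>'a \<Rightarrow>\<^sub>L 'a\<close> consists of the real-linear bounded operators, with the
  operator norm as its \<open>norm\<close>; \<open>bounded_ops\<close> singles out the complex-linear ones.\<close>

definition bounded_ops :: "('a::complex_inner \<Rightarrow>\<^sub>L 'a) set" where
  "bounded_ops = {A. \<forall>c v. blinfun_apply A (c *\<^sub>C v) = c *\<^sub>C blinfun_apply A v}"

definition compact_ops :: "('a::complex_inner \<Rightarrow>\<^sub>L 'a) set" where
  "compact_ops = {A \<in> bounded_ops. compact (closure (blinfun_apply A ` cball 0 1))}"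

lift_definition scaleC_op :: "complex \<Rightarrow> ('a::complex_inner \<Rightarrow>\<^sub>L 'a) \<Rightarrow> ('a \<Rightarrow>\<^sub>L 'a)"
  is "\<lambda>c A v. c *\<^sub>C A v"
proof -
  fix c :: complex and A :: "'a \<Rightarrow> 'a"
  assume "bounded_linear A"
  moreover have "bounded_linear (\<lambda>v :: 'a. c *\<^sub>C v)"
    by (rule bounded_linear_intro[where K = "cmod c"])
      (simp_all add: scaleC_add_right scaleR_scaleC scaleC_scaleC norm_scaleC mult.commute)
  ultimately show "bounded_linear (\<lambda>v. c *\<^sub>C A v)"
    using bounded_linear_compose by blast
qed

definition adjoint_op :: "('a::complex_inner \<Rightarrow>\<^sub>L 'a) \<Rightarrow> ('a \<Rightarrow>\<^sub>L 'a)" where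
  "adjoint_op A = (THE B. B \<in> bounded_ops \<and> (\<forall>u v. cinner (A u) v = cinner u (B v)))"

definition positive_ops :: "('a::complex_inner \<Rightarrow>\<^sub>L 'a) set" where
  "positive_ops = {A \<in> bounded_ops. \<forall>v. cinner (A v) v \<in> \<real>\<^sub>\<ge>\<^sub>0}"

definition abs_op :: "('a::complex_inner \<Rightarrow>\<^sub>L 'a) \<Rightarrow> ('a \<Rightarrow>\<^sub>L 'a)" where
  "abs_op A = (THE P. P \<in> positive_ops \<and> P o\<^sub>L P = adjoint_op A o\<^sub>L A)"


section \<open>Trace class and singular values\<close>

definition orthonormal_basis :: "'a::complex_inner set \<Rightarrow> bool" where
  "orthonormal_basis B \<longleftrightarrow>
     (\<forall>e\<in>B. \<forall>f\<in>B. cinner e f = (if e = f then 1 else 0)) \<and> closure (cspan B) = UNIV"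

text \<open>The canonical trace on positive operators. Its value, possibly infinite, does not depend on
  the orthonormal basis that is chosen.\<close>

definition op_trace :: "('a::complex_hilbert_space \<Rightarrow>\<^sub>L 'a) \<Rightarrow> ennreal" where
  "op_trace P = (\<Sum>\<^sub>\<infinity>e\<in>(SOME B. orthonormal_basis B). ennreal (Re (cinner (P e) e)))"

definition trace_norm :: "('a::complex_hilbert_space \<Rightarrow>\<^sub>L 'a) \<Rightarrow> ennreal" where
  "trace_norm A = op_trace (abs_op A)"

definition trace_class :: "('a::complex_hilbert_space \<Rightarrow>\<^sub>L 'a) set" where
  "trace_class = {A \<in> bounded_ops. trace_norm A < \<infinity>}"

text \<open>For compact \<open>A\<close> there is exactly one non-increasing sequence of non-negative numbers in which
  every \<open>\<lambda> > 0\<close> occurs as often as the dimension of the corresponding eigenspace of \<open>\<bar>A\<bar>\<close> says;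
  if there are only finitely many non-zero eigenvalues, its remaining terms must be zero.
  All sequences are indexed from 0, so that \<open>singular_values A n\<close> is $s_{n+1}(A)$.\<close>

definition singular_values :: "('a::complex_inner \<Rightarrow>\<^sub>L 'a) \<Rightarrow> nat \<Rightarrow> real" where
  "singular_values A = (THE s. antimono s \<and> (\<forall>n. 0 \<le> s n) \<and>
     (\<forall>l>0. finite {n. s n = l} \<and> card {n. s n = l} = cdim {v. abs_op A v = l *\<^sub>R v}))"


section \<open>Fully symmetric sequence spaces\<close>

definition l_infinity :: "(nat \<Rightarrow> complex) set" where
  "l_infinity = {\<xi>. bounded (range \<xi>)}"

definition c_zero :: "(nat \<Rightarrow> complex) set" where
  "c_zero = {\<xi>. \<xi> \<longlonglongrightarrow> 0}"

text \<open>\<open>rearrangement \<xi> n\<close> is $\xi^*_{n+1}$, hence the condition \<open>card F < Suc n\<close>.\<close>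

definition rearrangement :: "(nat \<Rightarrow> complex) \<Rightarrow> nat \<Rightarrow> real" where
  "rearrangement \<xi> n = (INF F\<in>{F. finite F \<and> card F < Suc n}. SUP m\<in>-F. cmod (\<xi> m))"

definition submajorized :: "(nat \<Rightarrow> complex) \<Rightarrow> (nat \<Rightarrow> complex) \<Rightarrow> bool"  (infix "\<prec>\<prec>" 50) where
  "\<xi> \<prec>\<prec> \<eta> \<longleftrightarrow> (\<forall>m. (\<Sum>n<m. rearrangement \<xi> n) \<le> (\<Sum>n<m. rearrangement \<eta> n))"

text \<open>The norm \<open>N\<close> is only meaningful on \<open>E\<close>.\<close>

definition fully_symmetric_space :: "(nat \<Rightarrow> complex) set \<Rightarrow> ((nat \<Rightarrow> complex) \<Rightarrow> real) \<Rightarrow> bool" where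
  "fully_symmetric_space E N \<longleftrightarrow>
     E \<subseteq> l_infinity \<and> E \<noteq> {\<lambda>_. 0} \<and>
     (\<lambda>_. 0) \<in> E \<and>
     (\<forall>\<xi>\<in>E. \<forall>\<eta>\<in>E. (\<lambda>n. \<xi> n + \<eta> n) \<in> E) \<and>
     (\<forall>c. \<forall>\<xi>\<in>E. (\<lambda>n. c * \<xi> n) \<in> E) \<and>
     (\<forall>\<xi>\<in>E. 0 \<le> N \<xi> \<and> (N \<xi> = 0 \<longleftrightarrow> \<xi> = (\<lambda>_. 0))) \<and>
     (\<forall>\<xi>\<in>E. \<forall>\<eta>\<in>E. N (\<lambda>n. \<xi> n + \<eta> n) \<le> N \<xi> + N \<eta>) \<and>
     (\<forall>c. \<forall>\<xi>\<in>E. N (\<lambda>n. c * \<xi> n) = cmod c * N \<xi>) \<and>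
     Metric_space.mcomplete E (\<lambda>\<xi> \<eta>. N (\<lambda>n. \<xi> n - \<eta> n)) \<and>
     (\<forall>\<eta>\<in>E. \<forall>\<xi>\<in>l_infinity. \<xi> \<prec>\<prec> \<eta> \<longrightarrow> \<xi> \<in> E \<and> N \<xi> \<le> N \<eta>)"

definition symmetric_ideal :: "(nat \<Rightarrow> complex) set \<Rightarrow> ('a::complex_inner \<Rightarrow>\<^sub>L 'a) set" where
  "symmetric_ideal E = {A \<in> compact_ops. (\<lambda>n. complex_of_real (singular_values A n)) \<in> E}"


section \<open>Dunford-Schwartz operators and their averages\<close>

text \<open>The values of \<open>T\<close> outside \<open>bounded_ops\<close> are irrelevant.\<close>

definition dunford_schwartz ::
    "(('a::complex_hilbert_space \<Rightarrow>\<^sub>L 'a) \<Rightarrow> ('a \<Rightarrow>\<^sub>L 'a)) \<Rightarrow> bool" where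
  "dunford_schwartz T \<longleftrightarrow>
     (\<forall>A\<in>bounded_ops. T A \<in> bounded_ops) \<and>
     (\<forall>A\<in>bounded_ops. \<forall>B\<in>bounded_ops. T (A + B) = T A + T B) \<and>
     (\<forall>c. \<forall>A\<in>bounded_ops. T (scaleC_op c A) = scaleC_op c (T A)) \<and>
     (\<forall>A\<in>trace_class. trace_norm (T A) \<le> trace_norm A) \<and>
     (\<forall>A\<in>bounded_ops. norm (T A) \<le> norm A)"

definition ergodic_average ::
    "nat \<Rightarrow> (('a::complex_inner \<Rightarrow>\<^sub>L 'a) \<Rightarrow> ('a \<Rightarrow>\<^sub>L 'a)) \<Rightarrow> ('a \<Rightarrow>\<^sub>L 'a) \<Rightarrow> ('a \<Rightarrow>\<^sub>L 'a)" where
  "ergodic_average n T A = (1 / (real n + 1)) *\<^sub>R (\<Sum>k=0..n. (T ^^ k) A)"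

end

theory Submission imports Defs begin

text \<open>
  Part (i) is proved first where a Hilbert space argument is available and is then carried over to
  all compact operators by density.

  The numbers \<open>\<Sum>n<m. s\<^sub>n(A)\<close> control everything. By the Schmidt expansion
  \<open>A = \<Sum> s\<^sub>n \<langle>\<cdot>, e\<^sub>n\<rangle> f\<^sub>n\<close>, such a sum is the largest value of
  \<open>|\<Sum>i<m. \<langle>A u\<^sub>i, v\<^sub>i\<rangle>|\<close> over orthonormal \<open>u\<close> and \<open>v\<close> (Ky Fan), and cutting the expansion at the level
  \<open>s\<^sub>m\<close> splits \<open>A\<close> into \<open>Y + Z\<close> with \<open>\<parallel>Y\<parallel>\<^sub>1 = \<Sum>n<m. (s\<^sub>n - s\<^sub>m)\<close> and \<open>\<parallel>Z\<parallel>\<^sub>\<infinity> \<le> s\<^sub>m\<close>. A Dunford-Schwartz operator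
  \<open>T\<close> contracts both pieces, so \<open>\<Sum>n<m. s\<^sub>n(T A) \<le> \<Sum>n<m. s\<^sub>n(A)\<close>: this is
  \<open>DS_singular_values_submajorized\<close>, an explicit interpolation between trace class and bounded
  operators. It has two consequences. First, \<open>T\<close> does not increase \<open>\<Sum> s\<^sub>n\<^sup>2\<close>, hence it is a contraction for the
  Hilbert-Schmidt norm. That norm obeys the parallelogram law, so F. Riesz' proof of the mean ergodic theorem
  (\<open>mean_ergodic_Cauchy\<close>) shows that the averages of a Hilbert-Schmidt operator are Cauchy for
  it, and all the more for the operator norm. Since \<open>Z\<close> above is as small as desired and \<open>Y\<close> is of finite
  rank, the averages of every compact operator converge. Second, the inequality between partial sums passes to
  the averages and to their limit, so the limit is submajorized by the initial operator and stays in the ideal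
  because \<open>E\<close> is fully symmetric.

  For part (ii), a bounded operator \<open>A\<close> that is not compact satisfies \<open>\<parallel>A u\<^sub>n\<parallel> \<ge> \<delta> > 0\<close> along some orthonormal
  sequence \<open>u\<close>. Let \<open>U\<close> be the unitary operator with \<open>U u\<^sub>n = w\<^sub>n u\<^sub>n\<close> that is the identity on the orthogonal
  complement, where \<open>|w\<^sub>n| = 1\<close>, \<open>w\<^sub>n \<noteq> 1\<close> and \<open>w\<^sub>n \<rightarrow> 1\<close>, and let \<open>T B = B U\<close>. On \<open>u\<^sub>n\<close> the averages of \<open>A\<close> are \<open>A u\<^sub>n\<close>
  multiplied by the averages of the powers of \<open>w\<^sub>n\<close>. These tend to \<open>0\<close> for each \<open>n\<close>, which forces a limit of the averages
  to vanish on every \<open>u\<^sub>n\<close>; but for a fixed length of the averages they tend to \<open>1\<close> as \<open>n\<close> grows, so the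
  distance to such a limit never drops below \<open>\<delta>\<close>.
\<close>

section \<open>The complex inner product\<close>

text \<open>Makes the operator space \<open>'a \<Rightarrow>\<^sub>L 'a\<close> complete, on which all limits of operators below rest.\<close>

subclass (in complex_hilbert_space) banach ..

lemma cinner_add_right: "cinner x (y + z) = cinner x y + cinner x (z :: 'a::complex_inner)"
  by (metis cinner_add_left cinner_commute complex_cnj_add)

lemma cinner_scaleC_right: "cinner x (c *\<^sub>C y) = cnj c * cinner x (y :: 'a::complex_inner)"
  by (metis cinner_commute cinner_scaleC_left complex_cnj_mult)

lemma cinner_scaleR_left: "cinner (r *\<^sub>R x) y = of_real r * cinner x (y :: 'a::complex_inner)"
  by (simp add: scaleR_scaleC cinner_scaleC_left)

lemma cinner_scaleR_right: "cinner x (r *\<^sub>R y) = of_real r * cinner x (y :: 'a::complex_inner)"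
  by (simp add: scaleR_scaleC cinner_scaleC_right)

lemma cinner_self: "cinner x x = complex_of_real ((norm x)\<^sup>2)" for x :: "'a::complex_inner"
proof (rule complex_eqI)
  show "Re (cinner x x) = Re (complex_of_real ((norm x)\<^sup>2))"
    by (simp only: inner_eq_Re_cinner [symmetric] power2_norm_eq_inner Re_complex_of_real)
  have "cinner x x = cnj (cinner x x)" by (rule cinner_commute)
  then show "Im (cinner x x) = Im (complex_of_real ((norm x)\<^sup>2))"
    by (metis Im_complex_of_real Reals_cases Reals_cnj_iff)
qed

lemma cmod_cinner_le: "cmod (cinner x y) \<le> norm x * norm y" for x :: "'a::complex_inner"
proof (cases "cinner x y = 0")
  case False
  \<comment> \<open>A unimodular factor turns the complex inner product into a real one.\<close>
  define u where "u = cnj (cinner x y) / cmod (cinner x y)"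
  have u: "cmod u = 1" using False by (simp add: u_def norm_divide)
  have "cmod (cinner x y) = Re (u * cinner x y)"
    using False by (simp add: u_def mult.commute complex_norm_square [symmetric] power2_eq_square)
  also have "\<dots> = inner (u *\<^sub>C x) y" by (simp add: inner_eq_Re_cinner cinner_scaleC_left)
  also have "\<dots> \<le> norm (u *\<^sub>C x) * norm y" by (rule norm_cauchy_schwarz)
  finally show ?thesis by (simp add: norm_scaleC u)
qed simp

lemma bounded_bilinear_cinner: "bounded_bilinear (cinner :: 'a::complex_inner \<Rightarrow> 'a \<Rightarrow> complex)"
  by standard
    (auto simp: cinner_add_left cinner_add_right cinner_scaleR_left cinner_scaleR_right
      scaleR_conv_of_real intro!: exI[of _ 1] cmod_cinner_le)

interpretation cinner: bounded_bilinear "cinner :: 'a::complex_inner \<Rightarrow> 'a \<Rightarrow> complex"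
  by (rule bounded_bilinear_cinner)

declare cinner.zero_left [simp] cinner.zero_right [simp]

lemmas cinner_simps = cinner_add_left cinner_add_right cinner.diff_left cinner.diff_right
  cinner_scaleC_left cinner_scaleC_right cinner_scaleR_left cinner_scaleR_right
  cinner.minus_left cinner.minus_right

lemma cinner_eq_0_commute: "cinner x y = 0 \<longleftrightarrow> cinner y (x :: 'a::complex_inner) = 0"
  by (metis cinner_commute complex_cnj_zero)

lemma cinner_ext: "x = y" if "\<And>z. cinner x z = cinner y z" for x y :: "'a::complex_inner"
proof -
  have "cinner (x - y) (x - y) = 0" using that by (simp add: cinner.diff_left)
  then show ?thesis by (simp add: cinner_self)
qed

lemma norm_add_Pythagoras:
  "cinner x y = 0 \<Longrightarrow> (norm (x + y))\<^sup>2 = (norm x)\<^sup>2 + (norm (y :: 'a::complex_inner))\<^sup>2"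
  by (simp add: power2_norm_eq_inner inner_add_left inner_add_right inner_commute[of y x])
    (simp add: inner_eq_Re_cinner)

section \<open>Orthonormal families\<close>

lemma parallelogram:
  "(norm (x + y))\<^sup>2 + (norm (x - y))\<^sup>2 = 2 * (norm x)\<^sup>2 + 2 * (norm (y :: 'a::real_inner))\<^sup>2"
  by (simp add: power2_norm_eq_inner inner_add_left inner_add_right inner_diff_left inner_diff_right)

definition orthonormal :: "'i set \<Rightarrow> ('i \<Rightarrow> 'a::complex_inner) \<Rightarrow> bool" where
  "orthonormal I u \<longleftrightarrow> (\<forall>i\<in>I. \<forall>j\<in>I. cinner (u i) (u j) = (if i = j then 1 else 0))"

text \<open>Pairwise orthogonal families in the unit ball. Admitting short and zero vectors makes it possible to use the
  vectors \<open>A e\<^sub>n / s\<^sub>n\<close> of a Schmidt expansion without a case distinction on \<open>s\<^sub>n = 0\<close>; Bessel's inequality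
  and hence the Ky Fan bound survive.\<close>

definition suborthonormal :: "'i set \<Rightarrow> ('i \<Rightarrow> 'a::complex_inner) \<Rightarrow> bool" where
  "suborthonormal I u \<longleftrightarrow>
     (\<forall>i\<in>I. norm (u i) \<le> 1) \<and> (\<forall>i\<in>I. \<forall>j\<in>I. i \<noteq> j \<longrightarrow> cinner (u i) (u j) = 0)"

lemma orthonormal_norm: "orthonormal I u \<Longrightarrow> i \<in> I \<Longrightarrow> norm (u i) = 1"
  by (metis cinner_self orthonormal_def of_real_eq_1_iff power2_eq_1_iff norm_ge_zero
      zero_neq_neg_one not_one_le_zero le_minus_one_simps(3))

lemma orthonormal_imp_suborthonormal: "orthonormal I u \<Longrightarrow> suborthonormal I u"
  by (auto simp: suborthonormal_def orthonormal_norm) (simp add: orthonormal_def)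

lemma orthonormal_subset: "orthonormal I u \<Longrightarrow> J \<subseteq> I \<Longrightarrow> orthonormal J u"
  by (simp add: orthonormal_def subset_iff)

lemma norm_sum_orthogonal:
  fixes u :: "'i \<Rightarrow> 'a::complex_inner"
  assumes "finite I" and "\<And>i j. i \<in> I \<Longrightarrow> j \<in> I \<Longrightarrow> i \<noteq> j \<Longrightarrow> cinner (u i) (u j) = 0"
  shows "(norm (\<Sum>i\<in>I. u i))\<^sup>2 = (\<Sum>i\<in>I. (norm (u i))\<^sup>2)"
  using assms
proof (induction I rule: finite_induct)
  case (insert k I)
  have "cinner (u k) (\<Sum>i\<in>I. u i) = 0"
    using insert by (auto simp: cinner.sum_right intro!: sum.neutral)
  then show ?case using insert by (simp add: norm_add_Pythagoras)
qed simp

lemma norm_suborthonormal_expansion: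
  assumes "finite I" "suborthonormal I f"
  shows "(norm (\<Sum>i\<in>I. c i *\<^sub>C f i))\<^sup>2 \<le> (\<Sum>i\<in>I. (cmod (c i))\<^sup>2)"
proof -
  have "(norm (\<Sum>i\<in>I. c i *\<^sub>C f i))\<^sup>2 = (\<Sum>i\<in>I. (norm (c i *\<^sub>C f i))\<^sup>2)"
    using assms by (intro norm_sum_orthogonal) (auto simp: suborthonormal_def cinner_simps)
  also have "\<dots> \<le> (\<Sum>i\<in>I. (cmod (c i))\<^sup>2)"
    using assms by (intro sum_mono)
      (auto simp: norm_scaleC power_mult_distrib suborthonormal_def intro!: mult_left_le power_le_one)
  finally show ?thesis .
qed

text \<open>With \<open>p = \<Sum> \<langle>v, u\<^sub>i\<rangle> u\<^sub>i\<close> and \<open>S\<close> the left-hand side, \<open>\<langle>v, p\<rangle> = S\<close> and \<open>\<parallel>p\<parallel>\<^sup>2 \<le> S\<close>, so that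
  \<open>0 \<le> \<parallel>v - p\<parallel>\<^sup>2 \<le> \<parallel>v\<parallel>\<^sup>2 - S\<close>.\<close>

lemma Bessel_inequality:
  fixes v :: "'a::complex_inner"
  assumes "finite I" "suborthonormal I u"
  shows "(\<Sum>i\<in>I. (cmod (cinner v (u i)))\<^sup>2) \<le> (norm v)\<^sup>2"
proof -
  define c where "c i = cinner v (u i)" for i
  define p where "p = (\<Sum>i\<in>I. c i *\<^sub>C u i)"
  define S where "S = (\<Sum>i\<in>I. (cmod (c i))\<^sup>2)"
  have p: "(norm p)\<^sup>2 \<le> S" unfolding p_def S_def by (rule norm_suborthonormal_expansion[OF assms])
  have "cinner v p = complex_of_real S"
    by (simp add: p_def S_def cinner.sum_right cinner_scaleC_right c_def
        complex_norm_square mult.commute del: of_real_power)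
  then have "inner v p = S" by (simp add: inner_eq_Re_cinner)
  then have "(norm (v - p))\<^sup>2 = (norm v)\<^sup>2 - 2 * S + (norm p)\<^sup>2"
    by (simp add: power2_norm_eq_inner inner_diff_left inner_diff_right inner_commute[of p v])
  moreover have "0 \<le> (norm (v - p))\<^sup>2" by simp
  ultimately show ?thesis using p unfolding S_def c_def by linarith
qed

lemma cinner_orthonormal_expansion:
  assumes "finite I" "orthonormal I u"
  shows "i \<in> I \<Longrightarrow> cinner (\<Sum>j\<in>I. c j *\<^sub>C u j) (u i) = c i"
proof -
  assume "i \<in> I"
  then have "cinner (\<Sum>j\<in>I. c j *\<^sub>C u j) (u i) = (\<Sum>j\<in>I. if j = i then c i else 0)"
    using assms unfolding cinner.sum_left
    by (intro sum.cong) (auto simp: cinner_scaleC_left orthonormal_def)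
  then show ?thesis using assms \<open>i \<in> I\<close> by simp
qed

lemma residual_orthogonal:
  assumes "finite I" "orthonormal I u" "i \<in> I"
  shows "cinner (v - (\<Sum>j\<in>I. cinner v (u j) *\<^sub>C u j)) (u i) = 0"
  using cinner_orthonormal_expansion[OF assms, of "\<lambda>j. cinner v (u j)"]
  by (simp add: cinner.diff_left)

lemma norm_orthonormal_expansion:
  assumes "finite I" "orthonormal I u"
  shows "(norm (\<Sum>i\<in>I. c i *\<^sub>C u i))\<^sup>2 = (\<Sum>i\<in>I. (cmod (c i))\<^sup>2)"
proof -
  have "(norm (\<Sum>i\<in>I. c i *\<^sub>C u i))\<^sup>2 = (\<Sum>i\<in>I. (norm (c i *\<^sub>C u i))\<^sup>2)"
    using assms by (intro norm_sum_orthogonal) (auto simp: orthonormal_def cinner_simps)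
  also have "\<dots> = (\<Sum>i\<in>I. (cmod (c i))\<^sup>2)"
    using assms by (intro sum.cong) (auto simp: norm_scaleC orthonormal_norm)
  finally show ?thesis .
qed

section \<open>Orthogonal projections and adjoints\<close>

text \<open>The parallelogram law makes every sequence in \<open>M\<close> whose distance to \<open>v\<close> approaches the infimum a Cauchy
  sequence. Its limit \<open>p\<close> attains the infimum; if \<open>v - p\<close> were not orthogonal to some \<open>m \<in> M\<close>, moving \<open>p\<close>
  along \<open>m\<close> would bring it closer to \<open>v\<close>.\<close>

lemma orthogonal_projection_exists:
  fixes M :: "'a::complex_hilbert_space set"
  assumes "closed M" and M: "complex_vector.subspace M"
  shows "\<exists>p\<in>M. \<forall>m\<in>M. cinner (v - p) m = 0"
proof -
  have Madd: "x + y \<in> M" if "x \<in> M" "y \<in> M" for x y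
    using M that unfolding complex_vector.subspace_def by auto
  have Msc: "c *\<^sub>C x \<in> M" if "x \<in> M" for x c
    using M that unfolding complex_vector.subspace_def by auto
  define d where "d = (INF m\<in>M. (norm (v - m))\<^sup>2)"
  have bdd: "bdd_below ((\<lambda>m. (norm (v - m))\<^sup>2) ` M)" by (auto intro!: bdd_belowI[of _ 0])
  have d_le: "d \<le> (norm (v - m))\<^sup>2" if "m \<in> M" for m
    unfolding d_def using bdd that by (rule cINF_lower)
  have "M \<noteq> {}" using M complex_vector.subspace_0 by blast
  have "\<exists>m\<in>M. (norm (v - m))\<^sup>2 < d + 1 / real (Suc n)" for n
    using cINF_less_iff[OF \<open>M \<noteq> {}\<close> bdd, of "d + 1 / real (Suc n)"] by (auto simp: d_def)
  then obtain p where pM: "\<And>n. p n \<in> M" and p: "\<And>n. (norm (v - p n))\<^sup>2 < d + 1 / real (Suc n)"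
    by metis
  have close: "(norm (p n - p k))\<^sup>2 \<le> 2 / real (Suc n) + 2 / real (Suc k)" for n k
  proof -
    have "(1/2) *\<^sub>R (p n + p k) \<in> M" unfolding scaleR_scaleC by (intro Madd Msc pM)
    then have "d \<le> (norm (v - (1/2) *\<^sub>R (p n + p k)))\<^sup>2" by (rule d_le)
    also have "v - (1/2) *\<^sub>R (p n + p k) = (1/2) *\<^sub>R ((v - p n) + (v - p k))"
      by (simp add: algebra_simps flip: scaleR_add_left)
    finally have "4 * d \<le> (norm ((v - p n) + (v - p k)))\<^sup>2" by (simp add: power_divide)
    moreover have "(norm ((v - p n) + (v - p k)))\<^sup>2 + (norm (p n - p k))\<^sup>2
        = 2 * (norm (v - p n))\<^sup>2 + 2 * (norm (v - p k))\<^sup>2"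
      using parallelogram[of "v - p n" "v - p k"] by (simp add: norm_minus_commute)
    moreover have "2 / real (Suc n) = 2 * (1 / real (Suc n))" "2 / real (Suc k) = 2 * (1 / real (Suc k))"
      by simp_all
    ultimately show ?thesis using p[of n] p[of k] by linarith
  qed
  have "Cauchy p"
  proof (rule metric_CauchyI)
    fix e :: real assume "0 < e"
    obtain N where N: "2 / real (Suc N) + 2 / real (Suc N) < e\<^sup>2"
    proof -
      obtain N where "inverse (real (Suc N)) < e\<^sup>2 / 4"
        using reals_Archimedean[of "e\<^sup>2/4"] \<open>0 < e\<close> by auto
      moreover have "2 / real (Suc N) = 2 * inverse (real (Suc N))" by (rule divide_inverse)
      ultimately show thesis by (intro that[of N]) linarith
    qed
    have "dist (p m) (p n) < e" if "m \<ge> N" "n \<ge> N" for m n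
    proof -
      have le: "2 / real (Suc k) \<le> 2 / real (Suc N)" if "k \<ge> N" for k
        using that by (intro divide_left_mono) auto
      have "(norm (p m - p n))\<^sup>2 < e\<^sup>2"
        using close[of m n] N le[OF that(1)] le[OF that(2)] by linarith
      then show ?thesis using \<open>0 < e\<close> by (simp add: dist_norm power2_less_imp_less)
    qed
    then show "\<exists>N. \<forall>m\<ge>N. \<forall>n\<ge>N. dist (p m) (p n) < e" by blast
  qed
  then obtain q where q: "p \<longlonglongrightarrow> q" using Cauchy_convergent_iff convergent_def by blast
  have qM: "q \<in> M" using closed_sequentially[OF \<open>closed M\<close>] pM q by blast
  have "(\<lambda>n. (norm (v - p n))\<^sup>2) \<longlonglongrightarrow> (norm (v - q))\<^sup>2" by (intro tendsto_intros q)
  moreover have "(\<lambda>n. d + 1 / real (Suc n)) \<longlonglongrightarrow> d + 0"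
    by (intro tendsto_add tendsto_const LIMSEQ_Suc[OF lim_1_over_n])
  ultimately have "(norm (v - q))\<^sup>2 \<le> d + 0"
    by (rule LIMSEQ_le) (use p less_imp_le in blast)
  then have min: "(norm (v - q))\<^sup>2 \<le> (norm (v - m))\<^sup>2" if "m \<in> M" for m
    using d_le[OF that] by linarith
  have "cinner (v - q) m = 0" if m: "m \<in> M" for m
  proof (cases "m = 0")
    case False
    define w where "w = v - q"
    define c where "c = cinner w m / of_real ((norm m)\<^sup>2)"
    have "cinner (w - c *\<^sub>C m) m = 0"
      using False by (simp add: cinner_simps c_def cinner_self)
    then have "cinner (w - c *\<^sub>C m) (c *\<^sub>C m) = 0" by (simp add: cinner_simps)
    from norm_add_Pythagoras[OF this]
    have "(norm w)\<^sup>2 = (norm (w - c *\<^sub>C m))\<^sup>2 + (norm (c *\<^sub>C m))\<^sup>2" by simp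
    moreover have "q + c *\<^sub>C m \<in> M" using Madd Msc qM m by blast
    then have "(norm w)\<^sup>2 \<le> (norm (w - c *\<^sub>C m))\<^sup>2" using min[of "q + c *\<^sub>C m"]
      by (simp add: w_def diff_diff_eq)
    ultimately have "norm (c *\<^sub>C m) = 0" by simp
    then show ?thesis using False by (simp add: norm_scaleC c_def w_def)
  qed simp
  with qM show ?thesis by blast
qed

text \<open>A vector \<open>w\<close> orthogonal to the kernel of \<open>f\<close> represents \<open>f\<close> up to a scalar, because
  \<open>u - (f u / f w) w\<close> lies in the kernel for every \<open>u\<close>.\<close>

lemma Riesz_representation:
  fixes f :: "'a::complex_hilbert_space \<Rightarrow> complex"
  assumes f: "bounded_linear f" and fc: "\<And>c v. f (c *\<^sub>C v) = c * f v"
  shows "\<exists>z. \<forall>v. f v = cinner v z"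
proof (cases "\<forall>v. f v = 0")
  case True then show ?thesis by (intro exI[of _ 0]) simp
next
  case False
  then obtain v where v: "f v \<noteq> 0" by blast
  interpret f: bounded_linear f by (rule f)
  have "closed (f -` {0})" by (intro closed_vimage f.continuous_on) auto
  moreover have "complex_vector.subspace (f -` {0})"
    by (auto simp: complex_vector.subspace_def f.add f.zero fc)
  ultimately obtain p where p: "f p = 0" and orth: "\<And>m. f m = 0 \<Longrightarrow> cinner (v - p) m = 0"
    using orthogonal_projection_exists[of "f -` {0}" v] by auto
  define w where "w = v - p"
  have fw: "f w = f v" by (simp add: w_def f.diff p)
  then have "w \<noteq> 0" using v f.zero by auto
  have "f u = cinner u ((cnj (f w) / of_real ((norm w)\<^sup>2)) *\<^sub>C w)" for u
  proof -
    have "f (u - (f u / f w) *\<^sub>C w) = 0" using v fw by (simp add: f.diff fc)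
    then have "cinner (u - (f u / f w) *\<^sub>C w) w = 0"
      using orth by (metis cinner_eq_0_commute w_def)
    then have "cinner u w = (f u / f w) * of_real ((norm w)\<^sup>2)"
      by (simp add: cinner_simps cinner_self)
    then show ?thesis using v fw \<open>w \<noteq> 0\<close> by (simp add: cinner_scaleC_right)
  qed
  then show ?thesis by blast
qed

lemma bounded_ops_scaleC: "A \<in> bounded_ops \<Longrightarrow> A (c *\<^sub>C v) = c *\<^sub>C A v"
  by (simp add: bounded_ops_def)

lemma bounded_ops_id: "id_blinfun \<in> bounded_ops"
  by (simp add: bounded_ops_def)

lemma bounded_ops_add: "A \<in> bounded_ops \<Longrightarrow> B \<in> bounded_ops \<Longrightarrow> A + B \<in> bounded_ops"
  by (simp add: bounded_ops_def blinfun.add_left scaleC_add_right)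

lemma bounded_ops_scaleR: "A \<in> bounded_ops \<Longrightarrow> r *\<^sub>R A \<in> bounded_ops"
  by (simp add: bounded_ops_def blinfun.scaleR_left scaleR_scaleC scaleC_scaleC mult.commute)

lemma bounded_ops_diff: "A \<in> bounded_ops \<Longrightarrow> B \<in> bounded_ops \<Longrightarrow> A - B \<in> bounded_ops"
  using bounded_ops_add[of A "(-1) *\<^sub>R B"] bounded_ops_scaleR[of B "-1"] by simp

lemma bounded_ops_0: "0 \<in> bounded_ops"
  by (simp add: bounded_ops_def complex_vector.scale_zero_right)

lemma bounded_ops_compose: "A \<in> bounded_ops \<Longrightarrow> B \<in> bounded_ops \<Longrightarrow> A o\<^sub>L B \<in> bounded_ops"
  by (simp add: bounded_ops_def)

lemma bounded_ops_sum: "(\<And>i. i \<in> I \<Longrightarrow> A i \<in> bounded_ops) \<Longrightarrow> sum A I \<in> bounded_ops"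
  by (induction I rule: infinite_finite_induct) (auto intro: bounded_ops_add bounded_ops_0)

lemma tendsto_blinfun_apply: "A \<longlonglongrightarrow> B \<Longrightarrow> (\<lambda>n. blinfun_apply (A n) v) \<longlonglongrightarrow> B v"
  by (intro tendsto_intros)

lemma bounded_linear_scaleC: "bounded_linear (\<lambda>v :: 'a::complex_inner. c *\<^sub>C v)"
  by (rule bounded_linear_intro[where K = "cmod c"])
    (simp_all add: scaleC_add_right scaleR_scaleC scaleC_scaleC norm_scaleC mult.commute)

lemma bounded_ops_limit:
  assumes "\<And>n. A n \<in> bounded_ops" "A \<longlonglongrightarrow> B" shows "B \<in> bounded_ops"
proof -
  have "B (c *\<^sub>C v) = c *\<^sub>C B v" for c v
  proof (rule LIMSEQ_unique)
    show "(\<lambda>n. A n (c *\<^sub>C v)) \<longlonglongrightarrow> B (c *\<^sub>C v)" using assms(2) by (rule tendsto_blinfun_apply)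
    show "(\<lambda>n. A n (c *\<^sub>C v)) \<longlonglongrightarrow> c *\<^sub>C B v"
      using bounded_linear.tendsto[OF bounded_linear_scaleC tendsto_blinfun_apply[OF assms(2)], of c v]
      by (simp add: bounded_ops_scaleC[OF assms(1)])
  qed
  then show ?thesis by (simp add: bounded_ops_def)
qed

lemma adjoint_unique:
  assumes "\<And>u v. cinner (A u) v = cinner u (blinfun_apply B v)"
    and "\<And>u v. cinner (A u) v = cinner u (blinfun_apply C v)"
  shows "B = C"
proof (rule blinfun_eqI)
  fix v show "B v = C v" by (rule cinner_ext) (metis assms cinner_commute)
qed

lemma adjoint_exists:
  fixes A :: "'a::complex_hilbert_space \<Rightarrow>\<^sub>L 'a"
  assumes A: "A \<in> bounded_ops"
  shows "\<exists>B\<in>bounded_ops. \<forall>u v. cinner (A u) v = cinner u (blinfun_apply B v)"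
proof -
  have "\<exists>z. \<forall>u. cinner (A u) v = cinner u z" for v
    by (rule Riesz_representation)
      (auto intro: bounded_linear_compose[OF cinner.bounded_linear_left blinfun.bounded_linear_right]
        simp: bounded_ops_scaleC[OF A] cinner_scaleC_left)
  then obtain B where B: "\<And>u v. cinner (A u) v = cinner u (B v)" by metis
  have B': "cinner (B v) u = cinner v (A u)" for u v by (metis B cinner_commute)
  have add: "B (v + w) = B v + B w" for v w
    by (rule cinner_ext) (simp add: B' cinner_simps)
  have sc: "B (c *\<^sub>C v) = c *\<^sub>C B v" for c v
    by (rule cinner_ext) (simp add: B' cinner_simps)
  have bd: "norm (B v) \<le> norm v * norm A" for v
  proof -
    have "(norm (B v))\<^sup>2 = cmod (cinner (A (B v)) v)"
      by (simp add: B cinner_self del: of_real_power)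
    also have "\<dots> \<le> norm (A (B v)) * norm v" by (rule cmod_cinner_le)
    also have "\<dots> \<le> norm A * norm (B v) * norm v" by (intro mult_right_mono norm_blinfun) simp
    finally have "norm (B v) * norm (B v) \<le> norm (B v) * (norm v * norm A)"
      by (simp add: power2_eq_square mult_ac)
    then show ?thesis by (cases "B v = 0") (auto simp: mult_le_cancel_left)
  qed
  have "bounded_linear B"
    by (rule bounded_linear_intro[where K = "norm A"]) (simp_all add: add sc scaleR_scaleC bd)
  then have app: "blinfun_apply (Blinfun B) = B" by (rule bounded_linear_Blinfun_apply)
  have "Blinfun B \<in> bounded_ops" by (simp add: bounded_ops_def app sc)
  moreover have "\<forall>u v. cinner (A u) v = cinner u (blinfun_apply (Blinfun B) v)"
    unfolding app using B by blast
  ultimately show ?thesis by blast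
qed

lemma
  fixes A :: "'a::complex_hilbert_space \<Rightarrow>\<^sub>L 'a"
  assumes A: "A \<in> bounded_ops"
  shows adjoint_bounded_ops: "adjoint_op A \<in> bounded_ops"
    and cinner_adjoint_right: "cinner u (adjoint_op A v) = cinner (A u) v"
proof -
  have "\<exists>!B. B \<in> bounded_ops \<and> (\<forall>u v. cinner (A u) v = cinner u (blinfun_apply B v))"
    using adjoint_exists[OF A] adjoint_unique[of A] by (metis (full_types))
  from theI'[OF this, folded adjoint_op_def]
  show "adjoint_op A \<in> bounded_ops" "cinner u (adjoint_op A v) = cinner (A u) v"
    by metis+
qed

lemma cinner_adjoint_left:
  "A \<in> bounded_ops \<Longrightarrow> cinner (adjoint_op A v) u = cinner v (A u)" for A :: "'a::complex_hilbert_space \<Rightarrow>\<^sub>L 'a"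
  by (metis cinner_adjoint_right cinner_commute)

section \<open>Positive operators, square roots and absolute values\<close>

lemma positive_bounded_ops: "P \<in> positive_ops \<Longrightarrow> P \<in> bounded_ops"
  by (simp add: positive_ops_def)

lemma positive_cinner_ge0: "P \<in> positive_ops \<Longrightarrow> 0 \<le> Re (cinner (P v) v)"
  and positive_cinner_real: "P \<in> positive_ops \<Longrightarrow> Im (cinner (P v) v) = 0"
  by (auto simp: positive_ops_def complex_nonneg_Reals_iff)

text \<open>Polarization: the values of the quadratic form at \<open>v + w\<close> and at \<open>v + \<i> w\<close> are real.\<close>

lemma positive_hermitian:
  assumes P: "P \<in> positive_ops" shows "cinner (P v) w = cinner v (P w)"
proof -
  note b = bounded_ops_scaleC[OF positive_bounded_ops[OF P]]
  have "Im (cinner (P (v + w)) (v + w)) = 0" "Im (cinner (P (v + \<i> *\<^sub>C w)) (v + \<i> *\<^sub>C w)) = 0"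
    "Im (cinner (P v) v) = 0" "Im (cinner (P w) w) = 0"
    by (rule positive_cinner_real[OF P])+
  then have "Im (cinner (P v) w) + Im (cinner (P w) v) = 0" "Re (cinner (P w) v) = Re (cinner (P v) w)"
    by (simp_all add: b blinfun.add_right cinner_simps)
  then have "cinner (P v) w = cnj (cinner (P w) v)" by (simp add: complex_eq_iff)
  then show ?thesis by (metis cinner_commute)
qed

lemma positiveI:
  assumes "P \<in> bounded_ops" "\<And>v w. cinner (P v) w = cinner v (P w)" "\<And>v. 0 \<le> Re (cinner (P v) v)"
  shows "P \<in> positive_ops"
proof -
  have "cinner (P v) v = cnj (cinner (P v) v)" for v using assms(2) cinner_commute by metis
  then have "Im (cinner (P v) v) = 0" for v by (metis complex_cnj complex_eq_iff complex.sel(2) equal_neg_zero cnj.sel(2))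
  then show ?thesis using assms by (simp add: positive_ops_def complex_nonneg_Reals_iff)
qed

text \<open>The quadratic form of \<open>P\<close> is nonnegative at \<open>v - t \<langle>P v, w\<rangle> w\<close> for all real \<open>t\<close>; the best \<open>t\<close> gives
  the inequality.\<close>

lemma positive_Cauchy_Schwarz:
  assumes P: "P \<in> positive_ops"
  shows "(cmod (cinner (P v) w))\<^sup>2 \<le> Re (cinner (P v) v) * Re (cinner (P w) w)"
proof -
  define a b c where "a = Re (cinner (P v) v)" and "b = cinner (P v) w" and "c = Re (cinner (P w) w)"
  note sc = bounded_ops_scaleC[OF positive_bounded_ops[OF P]]
  have c0: "0 \<le> c" and a0: "0 \<le> a" unfolding a_def c_def by (rule positive_cinner_ge0[OF P])+
  have wv: "cinner (P w) v = cnj b" unfolding b_def by (metis P cinner_commute positive_hermitian)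
  have bb: "b * cnj b = of_real ((cmod b)\<^sup>2)" by (rule complex_norm_square [symmetric])
  have key: "0 \<le> a - 2 * t * (cmod b)\<^sup>2 + t\<^sup>2 * (cmod b)\<^sup>2 * c" for t :: real
  proof -
    have "cinner (P (v - (of_real t * b) *\<^sub>C w)) (v - (of_real t * b) *\<^sub>C w) =
       cinner (P v) v - of_real t * (b * cnj b) - of_real t * (b * cnj b)
       + of_real t * of_real t * (b * cnj b) * cinner (P w) w"
      by (simp add: cinner_simps blinfun.diff_right sc wv flip: b_def) (simp add: algebra_simps)
    then have "Re (cinner (P (v - (of_real t * b) *\<^sub>C w)) (v - (of_real t * b) *\<^sub>C w)) =
       a - 2 * t * (cmod b)\<^sup>2 + t\<^sup>2 * (cmod b)\<^sup>2 * c"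
      unfolding bb by (simp add: a_def c_def power2_eq_square)
    then show ?thesis using positive_cinner_ge0[OF P] by metis
  qed
  have "(cmod b)\<^sup>2 \<le> a * c"
  proof (cases "c = 0")
    case True
    have "(cmod b)\<^sup>2 = 0"
    proof (rule ccontr)
      assume "(cmod b)\<^sup>2 \<noteq> 0"
      then show False using key[of "(a + 1) / (2 * (cmod b)\<^sup>2)"] a0 True by (simp add: field_simps)
    qed
    then show ?thesis using True by simp
  next
    case False
    then have "(1 / c)\<^sup>2 * (cmod b)\<^sup>2 * c = (cmod b)\<^sup>2 / c"
      by (simp add: power2_eq_square)
    then have "(cmod b)\<^sup>2 / c \<le> a" using key[of "1 / c"] by simp
    then show ?thesis using False c0 by (simp add: pos_divide_le_eq)
  qed
  then show ?thesis by (simp add: a_def b_def c_def)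
qed

text \<open>The Cauchy-Schwarz inequality for the form of \<open>P\<close>, applied to \<open>v\<close> and \<open>P v\<close>. Only the value of the form at \<open>P v\<close>
  has to be bounded by \<open>\<mu>\<close>, so that the lemma can also be used on a subspace that is invariant
  under \<open>P\<close>.\<close>

lemma positive_norm_sq_le:
  assumes P: "P \<in> positive_ops" and "0 \<le> \<mu>" and le: "Re (cinner (P (P v)) (P v)) \<le> \<mu> * (norm (P v))\<^sup>2"
  shows "(norm (P v))\<^sup>2 \<le> \<mu> * Re (cinner (P v) v)"
proof (cases "P v = 0")
  case False
  have "((norm (P v))\<^sup>2)\<^sup>2 = (cmod (cinner (P v) (P v)))\<^sup>2"
    by (simp add: cinner_self norm_power del: of_real_power)
  also have "\<dots> \<le> Re (cinner (P v) v) * Re (cinner (P (P v)) (P v))"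
    by (rule positive_Cauchy_Schwarz[OF P])
  also have "\<dots> \<le> Re (cinner (P v) v) * (\<mu> * (norm (P v))\<^sup>2)"
    by (intro mult_left_mono le positive_cinner_ge0 P)
  finally have "(norm (P v))\<^sup>2 * (norm (P v))\<^sup>2 \<le> (norm (P v))\<^sup>2 * (\<mu> * Re (cinner (P v) v))"
    by (simp add: power2_eq_square mult_ac)
  moreover have "0 < (norm (P v))\<^sup>2" using False by simp
  ultimately show ?thesis by (simp only: mult_le_cancel_left_pos)
qed (use assms positive_cinner_ge0[OF P] in simp)

lemma Re_cinner_blinfun_le: "Re (cinner (A v) v) \<le> norm A * (norm v)\<^sup>2"
  for A :: "'a::complex_inner \<Rightarrow>\<^sub>L 'a"
proof -
  have "Re (cinner (A v) v) \<le> norm (A v) * norm v"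
    using complex_Re_le_cmod cmod_cinner_le order_trans by blast
  also have "\<dots> \<le> norm A * norm v * norm v" by (intro mult_right_mono norm_blinfun) simp
  finally show ?thesis by (simp add: power2_eq_square mult_ac)
qed

lemma positive_norm_sq_le_norm:
  "P \<in> positive_ops \<Longrightarrow> (norm (P v))\<^sup>2 \<le> norm P * Re (cinner (P v) v)"
  by (rule positive_norm_sq_le) (auto intro: Re_cinner_blinfun_le)

lemma positive_apply_eq_0: "P \<in> positive_ops \<Longrightarrow> Re (cinner (P v) v) = 0 \<Longrightarrow> P v = 0"
  using positive_norm_sq_le_norm[of P v] by simp

lemma positive_norm_le_1:
  assumes P: "P \<in> positive_ops" and le: "\<And>v. Re (cinner (P v) v) \<le> (norm v)\<^sup>2"
  shows "norm P \<le> 1"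
proof (rule norm_blinfun_bound)
  fix v
  have "(norm (P v))\<^sup>2 \<le> 1 * Re (cinner (P v) v)" by (rule positive_norm_sq_le[OF P]) (use le in auto)
  also have "\<dots> \<le> (norm v)\<^sup>2" using le by simp
  finally show "norm (P v) \<le> 1 * norm v" by (simp add: power2_le_iff_abs_le)
qed simp

interpretation comp: bounded_bilinear "blinfun_compose :: ('a::complex_inner \<Rightarrow>\<^sub>L 'a) \<Rightarrow> _"
  by (rule bounded_bilinear_blinfun_compose)

lemma comp_assoc: "(A o\<^sub>L B) o\<^sub>L C = A o\<^sub>L (B o\<^sub>L C)"
  by (rule blinfun_eqI) simp

text \<open>With \<open>X = 1 - P\<close>, the square root is \<open>1 - L\<close> for a solution \<open>L\<close> of \<open>L = (X + L\<^sup>2) / 2\<close>. The iterates of this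
  equation are polynomials in \<open>X\<close>, so they commute with each other and with everything that commutes with \<open>P\<close>.
  Because \<open>\<parallel>X\<parallel> \<le> 1\<close>, their consecutive differences are dominated by those of the scalar iteration
  \<open>t \<mapsto> (1 + t\<^sup>2) / 2\<close>, which increases and is bounded by \<open>1\<close>; so they converge in norm.\<close>

lemma sqrt_contraction_exists:
  fixes P :: "'a::complex_hilbert_space \<Rightarrow>\<^sub>L 'a"
  assumes P: "P \<in> positive_ops" and le: "\<And>v. Re (cinner (P v) v) \<le> (norm v)\<^sup>2"
  shows "\<exists>R\<in>positive_ops. R o\<^sub>L R = P \<and> (\<forall>Q. Q o\<^sub>L P = P o\<^sub>L Q \<longrightarrow> Q o\<^sub>L R = R o\<^sub>L Q)"
proof -
  define X where "X = id_blinfun - P"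
  have Xb: "X \<in> bounded_ops"
    unfolding X_def by (intro bounded_ops_diff bounded_ops_id positive_bounded_ops P)
  have Xh: "cinner (X v) w = cinner v (X w)" for v w
    by (simp add: X_def blinfun.diff_left cinner_simps positive_hermitian[OF P])
  have Xq: "Re (cinner (X v) v) = (norm v)\<^sup>2 - Re (cinner (P v) v)" for v
    by (simp add: X_def blinfun.diff_left cinner_simps cinner_self del: of_real_power)
  have Xpos: "X \<in> positive_ops" by (rule positiveI) (use Xb Xh Xq le in auto)
  have X1: "norm X \<le> 1"
    by (rule positive_norm_le_1[OF Xpos]) (simp add: Xq positive_cinner_ge0[OF P])
  define Y where "Y n = ((\<lambda>Z. (1/2) *\<^sub>R (X + (Z o\<^sub>L Z))) ^^ n) 0" for n
  define y :: "nat \<Rightarrow> real" where "y n = ((\<lambda>t. (1 + t * t) / 2) ^^ n) 0" for n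
  have Y0: "Y 0 = 0" and YS: "Y (Suc n) = (1/2) *\<^sub>R (X + (Y n o\<^sub>L Y n))" for n by (simp_all add: Y_def)
  have y0: "y 0 = 0" and yS: "y (Suc n) = (1 + y n * y n) / 2" for n by (simp_all add: y_def)
  have ypos: "0 \<le> y n \<and> y n \<le> 1" for n
    by (induction n) (auto simp: y0 yS intro!: add_nonneg_nonneg mult_le_one)
  have Yb: "Y n \<in> bounded_ops" for n
    by (induction n) (auto simp: Y0 YS intro!: bounded_ops_0 bounded_ops_scaleR bounded_ops_add Xb
        bounded_ops_compose)
  have Yh: "cinner (Y n v) w = cinner v (Y n w)" for n v w
    by (induction n arbitrary: v w)
      (auto simp: Y0 YS blinfun.scaleR_left blinfun.add_left cinner_simps Xh)
  have Yc: "Q o\<^sub>L Y n = Y n o\<^sub>L Q" if "Q o\<^sub>L P = P o\<^sub>L Q" for Q n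
  proof (induction n)
    case (Suc n)
    have "Q o\<^sub>L id_blinfun = id_blinfun o\<^sub>L Q" by (rule blinfun_eqI) simp
    then have "Q o\<^sub>L X = X o\<^sub>L Q" using that by (simp add: X_def comp.diff_left comp.diff_right)
    moreover have "Q o\<^sub>L (Y n o\<^sub>L Y n) = (Y n o\<^sub>L Y n) o\<^sub>L Q" using Suc by (metis comp_assoc)
    ultimately show ?case
      by (simp add: YS comp.add_left comp.add_right comp.scaleR_left comp.scaleR_right)
  qed (simp add: Y0)
  have YY: "Y m o\<^sub>L Y n = Y n o\<^sub>L Y m" for m n by (metis Yc)
  have Yn: "norm (Y n) \<le> y n" for n
  proof (induction n)
    case (Suc n)
    have "norm (Y n o\<^sub>L Y n) \<le> y n * y n"
      by (rule order_trans[OF norm_blinfun_compose]) (intro mult_mono Suc, use ypos in auto)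
    then have "norm (X + (Y n o\<^sub>L Y n)) \<le> 1 + y n * y n" using X1 norm_triangle_mono by blast
    then show ?case by (simp add: YS yS)
  qed (simp add: Y0 y0)
  have Yd: "norm (Y (Suc n) - Y n) \<le> y (Suc n) - y n" for n
  proof (induction n)
    case 0 then show ?case using Yn[of "Suc 0"] by (simp add: Y0 y0)
  next
    case (Suc n)
    have "Y (Suc (Suc n)) - Y (Suc n) = (1/2) *\<^sub>R ((Y (Suc n) o\<^sub>L Y (Suc n)) - (Y n o\<^sub>L Y n))"
      by (simp only: YS[of "Suc n"] YS[of n] flip: scaleR_right_diff_distrib) simp
    also have "(Y (Suc n) o\<^sub>L Y (Suc n)) - (Y n o\<^sub>L Y n) = (Y (Suc n) + Y n) o\<^sub>L (Y (Suc n) - Y n)"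
      using YY[of n "Suc n"] by (simp add: comp.add_left comp.diff_right)
    finally have "norm (Y (Suc (Suc n)) - Y (Suc n))
        = (1/2) * norm ((Y (Suc n) + Y n) o\<^sub>L (Y (Suc n) - Y n))" by simp
    also have "\<dots> \<le> (1/2) * (norm (Y (Suc n) + Y n) * norm (Y (Suc n) - Y n))"
      by (intro mult_left_mono norm_blinfun_compose) simp
    also have "\<dots> \<le> (1/2) * ((y (Suc n) + y n) * (y (Suc n) - y n))"
      by (intro mult_left_mono mult_mono Suc norm_triangle_mono Yn) (use ypos in \<open>auto intro: add_nonneg_nonneg\<close>)
    also have "\<dots> = y (Suc (Suc n)) - y (Suc n)" by (simp add: yS[of "Suc n"] yS[of n] algebra_simps)
    finally show ?case .
  qed
  have tele: "norm (Y (n + k) - Y n) \<le> y (n + k) - y n" for n k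
  proof (induction k)
    case (Suc k)
    have "norm (Y (n + Suc k) - Y n) \<le> norm (Y (Suc (n + k)) - Y (n + k)) + norm (Y (n + k) - Y n)"
      using norm_triangle_ineq[of "Y (Suc (n + k)) - Y (n + k)" "Y (n + k) - Y n"] by simp
    then show ?case using Suc Yd[of "n + k"] by simp
  qed simp
  have "incseq y"
  proof (rule incseq_SucI)
    fix n show "y n \<le> y (Suc n)"
      using order_trans[OF norm_ge_zero Yd[of n]] by simp
  qed
  moreover have "Bseq y" using ypos by (intro BseqI'[of _ 1]) auto
  ultimately have "Cauchy y"
    using Bseq_monoseq_convergent incseq_imp_monoseq convergent_Cauchy by blast
  have "Cauchy Y"
  proof (rule CauchyI')
    fix e :: real assume "e > 0"
    then obtain N where N: "\<And>m n. m \<ge> N \<Longrightarrow> n \<ge> N \<Longrightarrow> norm (y m - y n) < e"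
      using CauchyD[OF \<open>Cauchy y\<close>] by blast
    have "norm (Y m - Y n) < e" if "N \<le> m" "m < n" for m n
    proof -
      have "norm (Y m - Y n) \<le> y n - y m"
        using tele[of m "n - m"] that by (simp add: norm_minus_commute)
      then show ?thesis using N[of n m] that by simp
    qed
    then show "\<exists>M. \<forall>m\<ge>M. \<forall>n>m. dist (Y m) (Y n) < e" unfolding dist_norm by blast
  qed
  then obtain L where L: "Y \<longlonglongrightarrow> L" using Cauchy_convergent_iff convergent_def by blast
  have "(\<lambda>n. (1/2) *\<^sub>R (X + (Y n o\<^sub>L Y n))) \<longlonglongrightarrow> (1/2) *\<^sub>R (X + (L o\<^sub>L L))"
    by (intro tendsto_intros comp.tendsto L)
  then have L_fixed: "L = (1/2) *\<^sub>R (X + (L o\<^sub>L L))"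
    using LIMSEQ_Suc[OF L] LIMSEQ_unique unfolding YS by blast
  have Lb: "L \<in> bounded_ops" by (rule bounded_ops_limit[OF Yb L])
  have Lh: "cinner (L v) w = cinner v (L w)" for v w
  proof (rule LIMSEQ_unique)
    show "(\<lambda>n. cinner (Y n v) w) \<longlonglongrightarrow> cinner (L v) w"
      by (intro cinner.tendsto tendsto_const tendsto_blinfun_apply L)
    show "(\<lambda>n. cinner (Y n v) w) \<longlonglongrightarrow> cinner v (L w)"
      unfolding Yh by (intro cinner.tendsto tendsto_const tendsto_blinfun_apply L)
  qed
  have Ln: "norm L \<le> 1"
    using Lim_bounded[OF tendsto_norm[OF L], of 0 1] Yn ypos order_trans by blast
  have Lc: "Q o\<^sub>L L = L o\<^sub>L Q" if "Q o\<^sub>L P = P o\<^sub>L Q" for Q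
  proof (rule LIMSEQ_unique)
    show "(\<lambda>n. Q o\<^sub>L Y n) \<longlonglongrightarrow> (Q o\<^sub>L L)" by (intro comp.tendsto tendsto_const L)
    show "(\<lambda>n. Q o\<^sub>L Y n) \<longlonglongrightarrow> (L o\<^sub>L Q)" unfolding Yc[OF that] by (intro comp.tendsto tendsto_const L)
  qed
  define R where "R = id_blinfun - L"
  have "R \<in> positive_ops"
  proof (rule positiveI)
    show "R \<in> bounded_ops" unfolding R_def by (intro bounded_ops_diff bounded_ops_id Lb)
    show "cinner (R v) w = cinner v (R w)" for v w
      by (simp add: R_def blinfun.diff_left cinner_simps Lh)
    show "0 \<le> Re (cinner (R v) v)" for v
    proof -
      have "Re (cinner (L v) v) \<le> 1 * (norm v)\<^sup>2"
        by (rule order_trans[OF Re_cinner_blinfun_le]) (intro mult_right_mono Ln, simp)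
      then show ?thesis by (simp add: R_def blinfun.diff_left cinner_simps cinner_self del: of_real_power)
    qed
  qed
  moreover have "R o\<^sub>L R = P"
  proof (rule blinfun_eqI)
    fix v
    have "2 *\<^sub>R L v = X v + L (L v)"
      by (subst L_fixed) (simp add: blinfun.scaleR_left blinfun.add_left)
    then have "L (L v) = 2 *\<^sub>R L v - v + P v" by (simp add: X_def blinfun.diff_left)
    then show "(R o\<^sub>L R) v = P v"
      by (simp add: R_def blinfun.diff_left blinfun.diff_right scaleR_2)
  qed
  moreover have "Q o\<^sub>L R = R o\<^sub>L Q" if "Q o\<^sub>L P = P o\<^sub>L Q" for Q
  proof (rule blinfun_eqI)
    fix v show "(Q o\<^sub>L R) v = (R o\<^sub>L Q) v"
      using arg_cong[OF Lc[OF that], of "\<lambda>S. blinfun_apply S v"]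
      by (simp add: R_def blinfun.diff_left blinfun.diff_right)
  qed
  ultimately show ?thesis by blast
qed

lemma positive_scaleR: "P \<in> positive_ops \<Longrightarrow> 0 \<le> r \<Longrightarrow> r *\<^sub>R P \<in> positive_ops"
  by (simp add: positive_ops_def bounded_ops_scaleR blinfun.scaleR_left cinner_scaleR_left
      complex_nonneg_Reals_iff)

lemma positive_sqrt_exists:
  fixes P :: "'a::complex_hilbert_space \<Rightarrow>\<^sub>L 'a"
  assumes P: "P \<in> positive_ops"
  shows "\<exists>R\<in>positive_ops. R o\<^sub>L R = P \<and> (\<forall>Q. Q o\<^sub>L P = P o\<^sub>L Q \<longrightarrow> Q o\<^sub>L R = R o\<^sub>L Q)"
proof -
  define c where "c = norm P + 1"
  have c: "c > 0" by (simp add: c_def add_nonneg_pos)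
  have "(1 / c) *\<^sub>R P \<in> positive_ops" using P c by (intro positive_scaleR) auto
  moreover have "Re (cinner (((1 / c) *\<^sub>R P) v) v) \<le> (norm v)\<^sup>2" for v
  proof -
    have "Re (cinner (P v) v) \<le> c * (norm v)\<^sup>2"
      using Re_cinner_blinfun_le[of P v] by (simp add: c_def distrib_right add_increasing2)
    then show ?thesis using c by (simp add: blinfun.scaleR_left cinner_simps field_simps)
  qed
  ultimately obtain R where R: "R \<in> positive_ops" "R o\<^sub>L R = (1 / c) *\<^sub>R P"
    "\<And>Q. Q o\<^sub>L ((1 / c) *\<^sub>R P) = ((1 / c) *\<^sub>R P) o\<^sub>L Q \<Longrightarrow> Q o\<^sub>L R = R o\<^sub>L Q"
    using sqrt_contraction_exists by blast
  show ?thesis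
  proof (intro bexI[of _ "sqrt c *\<^sub>R R"] conjI allI impI)
    show "(sqrt c *\<^sub>R R) o\<^sub>L (sqrt c *\<^sub>R R) = P"
      using c by (simp add: comp.scaleR_left comp.scaleR_right R(2))
    show "sqrt c *\<^sub>R R \<in> positive_ops" using R(1) c by (intro positive_scaleR) auto
    fix Q assume "Q o\<^sub>L P = P o\<^sub>L Q"
    then show "Q o\<^sub>L (sqrt c *\<^sub>R R) = (sqrt c *\<^sub>R R) o\<^sub>L Q"
      using R(3)[of Q] by (simp add: comp.scaleR_left comp.scaleR_right)
  qed
qed

text \<open>If \<open>S\<close> is a positive square root of \<open>P\<^sup>2\<close> and \<open>R\<close> is the one that commutes with everything \<open>P\<^sup>2\<close> commutes with, then
  \<open>(S + R) (S - R) = 0\<close>. Hence the nonnegative forms of \<open>S\<close> and \<open>R\<close> both vanish at \<open>w = (S - R) v\<close>, so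
  \<open>S w = R w = 0\<close> and \<open>\<parallel>w\<parallel>\<^sup>2 = \<langle>v, (S - R) w\<rangle> = 0\<close>.\<close>

lemma positive_sqrt_unique:
  fixes P :: "'a::complex_hilbert_space \<Rightarrow>\<^sub>L 'a"
  assumes P: "P \<in> positive_ops" and Q: "Q \<in> positive_ops" and eq: "P o\<^sub>L P = Q o\<^sub>L Q"
  shows "P = Q"
proof -
  \<comment> \<open>Both are compared with a square root that commutes with everything its square commutes with.\<close>
  have "P o\<^sub>L P \<in> positive_ops"
  proof (rule positiveI)
    show "P o\<^sub>L P \<in> bounded_ops" by (intro bounded_ops_compose positive_bounded_ops P)
    show "0 \<le> Re (cinner ((P o\<^sub>L P) v) v)" for v
      by (simp add: positive_hermitian[OF P, of "P v"] cinner_self del: of_real_power)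
  qed (simp add: positive_hermitian[OF P])
  then obtain R where R: "R \<in> positive_ops" "R o\<^sub>L R = P o\<^sub>L P"
    and Rc: "\<And>S. S o\<^sub>L (P o\<^sub>L P) = (P o\<^sub>L P) o\<^sub>L S \<Longrightarrow> S o\<^sub>L R = R o\<^sub>L S"
    using positive_sqrt_exists by metis
  have "S = R" if S: "S \<in> positive_ops" and SS: "S o\<^sub>L S = P o\<^sub>L P" for S
  proof (rule blinfun_eqI)
    fix v
    have SR: "S (R u) = R (S u)" for u
      using Rc[of S] by (metis SS blinfun_apply_blinfun_compose comp_assoc)
    have sq: "S (S u) = R (R u)" for u using SS R(2) by (metis blinfun_apply_blinfun_compose)
    define w where "w = S v - R v"
    have 0: "S w + R w = 0" by (simp add: w_def blinfun.diff_right SR sq)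
    then have "cinner (S w) w + cinner (R w) w = 0" by (metis cinner_add_left cinner.zero_left)
    then have "Re (cinner (S w) w) + Re (cinner (R w) w) = 0" by (metis plus_complex.sel(1) zero_complex.sel(1))
    then have "Re (cinner (S w) w) = 0" "Re (cinner (R w) w) = 0"
      using positive_cinner_ge0[OF S, of w] positive_cinner_ge0[OF R(1), of w] by linarith+
    then have "S w = 0" "R w = 0" using positive_apply_eq_0 S R(1) by blast+
    moreover have "cinner w w = cinner v (S w - R w)"
      by (subst (1) w_def) (simp add: cinner_simps positive_hermitian[OF S] positive_hermitian[OF R(1)])
    ultimately have "cinner w w = 0" by simp
    then show "S v = R v" by (simp add: w_def cinner_self)
  qed
  then show ?thesis using P Q eq by metis
qed

context
  fixes A :: "'a::complex_hilbert_space \<Rightarrow>\<^sub>L 'a"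
  assumes A: "A \<in> bounded_ops"
begin

lemma adjoint_compose_positive: "adjoint_op A o\<^sub>L A \<in> positive_ops"
proof (rule positiveI)
  show "adjoint_op A o\<^sub>L A \<in> bounded_ops" by (intro bounded_ops_compose A adjoint_bounded_ops)
  show "0 \<le> Re (cinner ((adjoint_op A o\<^sub>L A) v) v)" for v
    by (simp add: cinner_adjoint_left[OF A] cinner_self del: of_real_power)
qed (simp add: cinner_adjoint_left[OF A] cinner_adjoint_right[OF A])

lemma abs_op_props: "abs_op A \<in> positive_ops \<and> abs_op A o\<^sub>L abs_op A = adjoint_op A o\<^sub>L A"
  unfolding abs_op_def
  by (rule theI') (use positive_sqrt_exists[OF adjoint_compose_positive] positive_sqrt_unique in metis)

lemma abs_op_positive: "abs_op A \<in> positive_ops"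
  using abs_op_props by blast

lemma cinner_abs_op: "cinner (abs_op A v) (abs_op A w) = cinner (A v) (A w)"
proof -
  have "cinner (abs_op A v) (abs_op A w) = cinner ((abs_op A o\<^sub>L abs_op A) v) w"
    by (simp add: positive_hermitian[OF abs_op_positive])
  also have "\<dots> = cinner (A v) (A w)" using abs_op_props by (simp add: cinner_adjoint_left[OF A])
  finally show ?thesis .
qed

lemma norm_abs_op: "norm (abs_op A v) = norm (A v)"
  using cinner_abs_op[of v v]
  by (simp add: cinner_self del: of_real_power)

text \<open>Identifies an absolute value without mentioning the adjoint.\<close>

lemma abs_op_eqI:
  assumes P: "P \<in> positive_ops" and "\<And>v w. cinner (P v) (P w) = cinner (A v) (A w)"
  shows "abs_op A = P"
proof (rule positive_sqrt_unique[OF abs_op_positive P], rule blinfun_eqI, rule cinner_ext)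
  fix v w show "cinner ((abs_op A o\<^sub>L abs_op A) v) w = cinner ((P o\<^sub>L P) v) w"
    using assms(2)[of v w] cinner_abs_op[of v w]
    by (simp add: positive_hermitian[OF P] positive_hermitian[OF abs_op_positive])
qed

end

section \<open>Orthonormal bases and the trace\<close>

lemma subspace_closure_cspan: "complex_vector.subspace (closure (cspan (S :: 'a::complex_inner set)))"
  unfolding complex_vector.subspace_def
proof (intro conjI ballI allI)
  have sub: "complex_vector.subspace (cspan S)" by (rule complex_vector.subspace_span)
  show "0 \<in> closure (cspan S)"
    using closure_subset complex_vector.subspace_0[OF sub] by blast
  fix x y c assume x: "x \<in> closure (cspan S)"
  then obtain f where f: "\<And>n. f n \<in> cspan S" "f \<longlonglongrightarrow> x" unfolding closure_sequential by blast
  show "c *\<^sub>C x \<in> closure (cspan S)"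
    unfolding closure_sequential
    by (rule exI[of _ "\<lambda>n. c *\<^sub>C f n"])
      (simp add: f complex_vector.subspace_scale[OF sub] bounded_linear.tendsto[OF bounded_linear_scaleC])
  assume "y \<in> closure (cspan S)"
  then obtain g where g: "\<And>n. g n \<in> cspan S" "g \<longlonglongrightarrow> y" unfolding closure_sequential by blast
  show "x + y \<in> closure (cspan S)"
    unfolding closure_sequential
    by (rule exI[of _ "\<lambda>n. f n + g n"]) (simp add: f g complex_vector.subspace_add[OF sub] tendsto_add)
qed

lemma orthonormal_insert:
  assumes "orthonormal B id" "norm w = 1" "\<And>e. e \<in> B \<Longrightarrow> cinner w e = 0"
  shows "orthonormal (insert w B) id"
proof -
  have "cinner e w = 0" if "e \<in> B" for e using assms(3)[OF that] by (simp add: cinner_eq_0_commute)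
  moreover have "w \<notin> B" using assms(2,3) by (metis cinner_self norm_zero of_real_eq_0_iff
      power_eq_0_iff zero_neq_one)
  moreover have "cinner w w = 1" by (simp add: cinner_self assms(2))
  ultimately show ?thesis
    using assms(1,3) unfolding orthonormal_def id_apply by (metis insert_iff)
qed

text \<open>A maximal orthonormal set spans a dense subspace, for otherwise the component of some vector orthogonal to the closed
  span could be normalized and added to the set.\<close>

lemma orthonormal_basis_exists: "\<exists>B :: 'a::complex_hilbert_space set. orthonormal_basis B"
proof -
  have "\<exists>M\<in>{B :: 'a set. orthonormal B id}. \<forall>X\<in>{B. orthonormal B id}. M \<subseteq> X \<longrightarrow> X = M"
  proof (rule subset_Zorn')
    fix C assume C: "subset.chain {B :: 'a set. orthonormal B id} C"
    have "\<exists>X\<in>C. e \<in> X \<and> f \<in> X" if "e \<in> \<Union>C" "f \<in> \<Union>C" for e f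
      using that C unfolding subset_chain_def by (meson Union_iff subsetD)
    then show "\<Union>C \<in> {B. orthonormal B id}"
      using C unfolding subset_chain_def orthonormal_def id_apply by blast
  qed
  then obtain M where M: "orthonormal M id"
    and max: "\<And>X. orthonormal X id \<Longrightarrow> M \<subseteq> X \<Longrightarrow> X = (M :: 'a set)" by blast
  have "v \<in> closure (cspan M)" for v
  proof (rule ccontr)
    assume v: "v \<notin> closure (cspan M)"
    obtain p where p: "p \<in> closure (cspan M)" and o: "\<And>m. m \<in> closure (cspan M) \<Longrightarrow> cinner (v - p) m = 0"
      using orthogonal_projection_exists[OF closed_closure subspace_closure_cspan] by blast
    define w where "w = (1 / norm (v - p)) *\<^sub>R (v - p)"
    have "v - p \<noteq> 0" using v p by auto
    then have w1: "norm w = 1" by (simp add: w_def)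
    have inM: "e \<in> closure (cspan M)" if "e \<in> M" for e
      using that complex_vector.span_base closure_subset by blast
    have w0: "cinner w e = 0" if "e \<in> M" for e
      using o[OF inM[OF that]] by (simp add: w_def cinner_scaleR_left)
    have "insert w M = M" by (rule max) (auto intro: orthonormal_insert M w1 w0)
    then have "cinner w w = 0" using w0 by blast
    then show False using w1 by (simp add: cinner_self)
  qed
  then have "closure (cspan M) = UNIV" by blast
  then have "orthonormal_basis M" using M by (simp add: orthonormal_basis_def orthonormal_def)
  then show ?thesis by blast
qed

lemma orthonormal_basis_orthonormal: "orthonormal_basis B \<Longrightarrow> F \<subseteq> B \<Longrightarrow> orthonormal F id"
  by (auto simp: orthonormal_basis_def orthonormal_def subset_iff)

lemma norm_residual:
  assumes "finite F" "orthonormal F u"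
  shows "(norm (v - (\<Sum>e\<in>F. cinner v (u e) *\<^sub>C u e)))\<^sup>2 = (norm v)\<^sup>2 - (\<Sum>e\<in>F. (cmod (cinner v (u e)))\<^sup>2)"
proof -
  define p where "p = (\<Sum>e\<in>F. cinner v (u e) *\<^sub>C u e)"
  have "cinner (v - p) p = 0"
    unfolding p_def cinner.sum_right cinner_scaleC_right
    using residual_orthogonal[OF assms] by (intro sum.neutral) simp
  from norm_add_Pythagoras[OF this] have "(norm v)\<^sup>2 = (norm (v - p))\<^sup>2 + (norm p)\<^sup>2" by simp
  then show ?thesis using norm_orthonormal_expansion[OF assms, of "\<lambda>e. cinner v (u e)"] by (simp add: p_def)
qed

text \<open>If \<open>w\<close> is a combination of finitely many basis vectors that is close to \<open>v\<close>, then the projection of \<open>v\<close>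
  onto any finite set containing these basis vectors is at least as close.\<close>

lemma Parseval:
  fixes v :: "'a::complex_hilbert_space"
  assumes B: "orthonormal_basis B"
  shows "((\<lambda>e. (cmod (cinner v e))\<^sup>2) has_sum (norm v)\<^sup>2) B"
  unfolding has_sum_def tendsto_iff eventually_finite_subsets_at_top
proof (intro allI impI)
  fix \<epsilon> :: real assume "\<epsilon> > 0"
  have "v \<in> closure (cspan B)" using B by (simp add: orthonormal_basis_def)
  then obtain w where w: "w \<in> cspan B" "dist w v < sqrt \<epsilon>"
    using \<open>\<epsilon> > 0\<close> closure_approachable[of v "cspan B"] by (metis real_sqrt_gt_zero)
  then obtain F0 r where F0: "finite F0" "F0 \<subseteq> B" and wr: "w = (\<Sum>e\<in>F0. r e *\<^sub>C e)"
    unfolding complex_vector.span_explicit by blast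
  have "(norm (v - w))\<^sup>2 < (sqrt \<epsilon>)\<^sup>2"
    using w(2) by (intro power_strict_mono) (auto simp: dist_norm norm_minus_commute)
  then have small: "(norm (v - w))\<^sup>2 < \<epsilon>" using \<open>\<epsilon> > 0\<close> by simp
  have "dist (\<Sum>e\<in>F. (cmod (cinner v e))\<^sup>2) ((norm v)\<^sup>2) < \<epsilon>" if F: "finite F" "F0 \<subseteq> F" "F \<subseteq> B" for F
  proof -
    have on: "orthonormal F id" using B F(3) by (rule orthonormal_basis_orthonormal)
    define p where "p = (\<Sum>e\<in>F. cinner v e *\<^sub>C e)"
    have o: "cinner (v - p) e = 0" if "e \<in> F" for e
      using residual_orthogonal[OF F(1) on that] by (simp add: p_def)
    have "cinner (v - p) w = 0"
      using o F(2) by (simp add: wr cinner.sum_right cinner_scaleC_right subset_iff sum.neutral)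
    moreover have "cinner (v - p) (\<Sum>e\<in>F. cinner v e *\<^sub>C e) = 0"
      using o by (simp add: cinner.sum_right cinner_scaleC_right sum.neutral)
    ultimately have "cinner (v - p) (p - w) = 0"
      by (simp add: cinner.diff_right flip: p_def)
    from norm_add_Pythagoras[OF this] have "(norm (v - p))\<^sup>2 \<le> (norm (v - w))\<^sup>2" by simp
    moreover have "(norm (v - p))\<^sup>2 = (norm v)\<^sup>2 - (\<Sum>e\<in>F. (cmod (cinner v e))\<^sup>2)"
      using norm_residual[OF F(1) on, of v] by (simp add: p_def)
    moreover have "0 \<le> (norm (v - p))\<^sup>2" by simp
    ultimately show ?thesis using small by (simp add: dist_real_def)
  qed
  then show "\<exists>X. finite X \<and> X \<subseteq> B \<and>
      (\<forall>Y. finite Y \<and> X \<subseteq> Y \<and> Y \<subseteq> B \<longrightarrow> dist (\<Sum>e\<in>Y. (cmod (cinner v e))\<^sup>2) ((norm v)\<^sup>2) < \<epsilon>)"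
    using F0 by blast
qed

definition std_basis :: "'a::complex_hilbert_space set" where
  "std_basis = (SOME B. orthonormal_basis B)"

lemma std_basis: "orthonormal_basis std_basis"
  unfolding std_basis_def by (rule someI_ex[OF orthonormal_basis_exists])

lemma op_trace_SUP:
  "op_trace P = (SUP F\<in>{F. finite F \<and> F \<subseteq> std_basis}. \<Sum>e\<in>F. ennreal (Re (cinner (P e) e)))"
  unfolding op_trace_def std_basis_def[symmetric] by (rule nonneg_infsum_complete) simp

lemma op_trace_le:
  assumes "P \<in> positive_ops"
    and "\<And>F. finite F \<Longrightarrow> F \<subseteq> std_basis \<Longrightarrow> (\<Sum>e\<in>F. Re (cinner (P e) e)) \<le> c"
  shows "op_trace P \<le> ennreal c"
  unfolding op_trace_SUP
  using assms by (intro SUP_least) (auto simp: sum_ennreal positive_cinner_ge0 intro!: ennreal_leI)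

lemma finite_sum_le_op_trace:
  assumes "P \<in> positive_ops" "finite F" "F \<subseteq> std_basis"
  shows "ennreal (\<Sum>e\<in>F. Re (cinner (P e) e)) \<le> op_trace P"
proof -
  have "(\<Sum>e\<in>F. ennreal (Re (cinner (P e) e))) \<le> op_trace P"
    unfolding op_trace_SUP by (rule SUP_upper) (use assms in auto)
  then show ?thesis using assms by (simp add: sum_ennreal positive_cinner_ge0)
qed

text \<open>The square of the Hilbert-Schmidt norm of \<open>A\<close> is at most \<open>c\<close>. Only finite partial sums are mentioned, so
  that no summability has to be known in advance.\<close>

definition HS_bound :: "('a::complex_hilbert_space \<Rightarrow>\<^sub>L 'a) \<Rightarrow> real \<Rightarrow> bool" where
  "HS_bound A c \<longleftrightarrow> (\<forall>F. finite F \<longrightarrow> F \<subseteq> std_basis \<longrightarrow> (\<Sum>e\<in>F. (norm (A e))\<^sup>2) \<le> c)"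

text \<open>Parseval's identity turns the left-hand side into a double sum of the terms \<open>|\<langle>u\<^sub>i, A e\<rangle>|\<^sup>2\<close>; summing
  over \<open>i\<close> first, Bessel's inequality leaves the terms \<open>\<parallel>A e\<parallel>\<^sup>2\<close>.\<close>

lemma HS_bound_adjoint_family:
  assumes A: "A \<in> bounded_ops" and "HS_bound A c" and I: "finite I" "suborthonormal I u"
  shows "(\<Sum>i\<in>I. (norm (adjoint_op A (u i)))\<^sup>2) \<le> c"
proof (rule has_sum_le_finite_sums)
  show "((\<lambda>e. \<Sum>i\<in>I. (cmod (cinner (adjoint_op A (u i)) e))\<^sup>2) has_sum
      (\<Sum>i\<in>I. (norm (adjoint_op A (u i)))\<^sup>2)) std_basis"
    using I(1)
    by (induction I rule: finite_induct) (auto intro: has_sum_add Parseval[OF std_basis])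
  fix F :: "'a set" assume F: "finite F" "F \<subseteq> std_basis"
  have "(\<Sum>e\<in>F. \<Sum>i\<in>I. (cmod (cinner (adjoint_op A (u i)) e))\<^sup>2)
      = (\<Sum>e\<in>F. \<Sum>i\<in>I. (cmod (cinner (A e) (u i)))\<^sup>2)"
    by (intro sum.cong refl) (metis A cinner_adjoint_left cinner_commute complex_mod_cnj)
  also have "\<dots> \<le> (\<Sum>e\<in>F. (norm (A e))\<^sup>2)" by (intro sum_mono Bessel_inequality I)
  also have "\<dots> \<le> c" using assms F by (simp add: HS_bound_def)
  finally show "(\<Sum>e\<in>F. \<Sum>i\<in>I. (cmod (cinner (adjoint_op A (u i)) e))\<^sup>2) \<le> c" .
qed

lemma adjoint_adjoint: "A \<in> bounded_ops \<Longrightarrow> adjoint_op (adjoint_op A) = A"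
  for A :: "'a::complex_hilbert_space \<Rightarrow>\<^sub>L 'a"
  by (rule adjoint_unique[of "adjoint_op A"])
    (simp_all add: cinner_adjoint_right adjoint_bounded_ops cinner_adjoint_left)

text \<open>Applying the previous lemma twice, to \<open>A\<close> and to its adjoint, replaces the fixed basis by an arbitrary
  family.\<close>

lemma HS_bound_family:
  assumes A: "A \<in> bounded_ops" and c: "HS_bound A c" and I: "finite I" "suborthonormal I u"
  shows "(\<Sum>i\<in>I. (norm (A (u i)))\<^sup>2) \<le> c"
proof -
  have "HS_bound (adjoint_op A) c"
    unfolding HS_bound_def
  proof (intro allI impI)
    fix F :: "'a set" assume "finite F" "F \<subseteq> std_basis"
    moreover from this have "suborthonormal F id"
      by (intro orthonormal_imp_suborthonormal orthonormal_basis_orthonormal[OF std_basis])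
    ultimately show "(\<Sum>e\<in>F. (norm (adjoint_op A e))\<^sup>2) \<le> c"
      using HS_bound_adjoint_family[OF A c, of F id] by simp
  qed
  from HS_bound_adjoint_family[OF adjoint_bounded_ops[OF A] this I]
  show ?thesis by (simp add: adjoint_adjoint A)
qed

lemma HS_bound_norm_apply:
  assumes "A \<in> bounded_ops" "HS_bound A c"
  shows "(norm (A v))\<^sup>2 \<le> c * (norm v)\<^sup>2"
proof (cases "v = 0")
  case False
  have "suborthonormal {()} (\<lambda>_. (1 / norm v) *\<^sub>R v)" using False by (simp add: suborthonormal_def)
  from HS_bound_family[OF assms _ this] show ?thesis using False
    by (simp add: blinfun.scaleR_right power_mult_distrib power_divide field_simps)
qed simp

text \<open>The trace does not depend on the basis: with \<open>R\<close> the square root of \<open>P\<close>, \<open>\<langle>P v, v\<rangle> = \<parallel>R v\<parallel>\<^sup>2\<close>, and the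
  Hilbert-Schmidt norm of \<open>R\<close> can be computed with any orthonormal family.\<close>

lemma sum_le_op_trace:
  assumes P: "P \<in> positive_ops" and I: "finite I" "suborthonormal I u"
  shows "ennreal (\<Sum>i\<in>I. Re (cinner (P (u i)) (u i))) \<le> op_trace P"
proof (cases "op_trace P")
  case (real c)
  obtain R where R: "R \<in> positive_ops" and RR: "R o\<^sub>L R = P" using positive_sqrt_exists[OF P] by blast
  have sq: "Re (cinner (P v) v) = (norm (R v))\<^sup>2" for v
    unfolding RR[symmetric] by (simp add: positive_hermitian[OF R, of "R v"] cinner_self del: of_real_power)
  have "HS_bound R c"
    unfolding HS_bound_def sq[symmetric]
    using finite_sum_le_op_trace[OF P] real by (simp add: ennreal_le_iff)
  from HS_bound_family[OF positive_bounded_ops[OF R] this I] show ?thesis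
    by (simp add: real sq ennreal_leI)
qed simp

section \<open>Compact operators\<close>

lemma cinner_cspan_eq_0:
  assumes "w \<in> cspan S" "\<And>x. x \<in> S \<Longrightarrow> cinner v x = 0" shows "cinner v w = 0"
  using assms(1)
  by (rule complex_vector.span_induct)
    (use assms(2) in \<open>auto simp: complex_vector.subspace_def cinner_simps\<close>)

text \<open>Allows vectors orthogonal to an arbitrary finite set to be handled through an orthonormal one.\<close>

lemma Gram_Schmidt:
  assumes "finite (F :: 'a::complex_inner set)"
  shows "\<exists>G. finite G \<and> orthonormal G id \<and> F \<subseteq> cspan G"
  using assms
proof (induction F rule: finite_induct)
  case empty
  show ?case by (intro exI[of _ "{}"]) (simp add: orthonormal_def)
next
  case (insert x F)
  then obtain G where G: "finite G" "orthonormal G id" "F \<subseteq> cspan G" by blast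
  define p where "p = (\<Sum>g\<in>G. cinner x g *\<^sub>C g)"
  have p: "p \<in> cspan G"
    unfolding p_def
    by (intro complex_vector.span_sum complex_vector.span_scale complex_vector.span_base)
  show ?case
  proof (cases "x = p")
    case True then show ?thesis using G p by blast
  next
    case False
    define w where "w = (1 / norm (x - p)) *\<^sub>R (x - p)"
    have "cinner (x - p) g = 0" if "g \<in> G" for g
      using residual_orthogonal[OF G(1,2) that] by (simp add: p_def)
    then have w0: "cinner w g = 0" if "g \<in> G" for g
      using that by (simp add: w_def cinner_scaleR_left)
    have w1: "norm w = 1" using False by (simp add: w_def)
    have sub: "cspan G \<subseteq> cspan (insert w G)" by (rule complex_vector.span_mono) blast
    have "x = of_real (norm (x - p)) *\<^sub>C w + p"
      using False by (simp add: w_def flip: scaleR_scaleC)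
    also have "\<dots> \<in> cspan (insert w G)"
      using p sub by (intro complex_vector.span_add complex_vector.span_scale)
        (auto intro: complex_vector.span_base)
    finally have "insert x F \<subseteq> cspan (insert w G)" using G(3) sub by blast
    moreover have "orthonormal (insert w G) id" by (rule orthonormal_insert[OF G(2) w1 w0])
    ultimately show ?thesis using G(1) by blast
  qed
qed

lemma compact_coefficient_sums:
  assumes "finite G"
  shows "compact {\<Sum>g\<in>G. c g *\<^sub>C a g | c. \<forall>g\<in>G. cmod (c g) \<le> 1}" (is "compact (?S G)")
  using assms
proof (induction G rule: finite_induct)
  case (insert h G)
  have "continuous_on (cball 0 1) (\<lambda>c. c *\<^sub>C a h)"
    by (rule bounded_linear.continuous_on[OF _ continuous_on_id])
      (rule bounded_linear_intro[where K = "norm (a h)"],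
        simp_all add: scaleC_add_left scaleR_scaleC scaleC_scaleC norm_scaleC scaleR_conv_of_real)
  then have "compact ((\<lambda>c. c *\<^sub>C a h) ` cball 0 1)"
    by (rule compact_continuous_image) simp
  from compact_sums[OF this insert.IH]
  have "compact {x + y |x y. x \<in> (\<lambda>c. c *\<^sub>C a h) ` cball 0 1 \<and> y \<in> ?S G}" .
  also have "{x + y |x y. x \<in> (\<lambda>c. c *\<^sub>C a h) ` cball 0 1 \<and> y \<in> ?S G} = ?S (insert h G)" (is "?L = ?R")
  proof
    show "?L \<subseteq> ?R"
    proof clarify
      fix c0 c assume c: "\<forall>g\<in>G. cmod (c g) \<le> 1" "c0 \<in> cball (0::complex) 1"
      have "(\<Sum>g\<in>insert h G. (c(h := c0)) g *\<^sub>C a g) = c0 *\<^sub>C a h + (\<Sum>g\<in>G. c g *\<^sub>C a g)"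
        using insert.hyps by (auto intro!: sum.cong)
      then show "\<exists>d. c0 *\<^sub>C a h + (\<Sum>g\<in>G. c g *\<^sub>C a g) = (\<Sum>g\<in>insert h G. d g *\<^sub>C a g) \<and>
          (\<forall>g\<in>insert h G. cmod (d g) \<le> 1)"
        using c by (intro exI[of _ "c(h := c0)"]) auto
    qed
    show "?R \<subseteq> ?L"
    proof
      fix z assume "z \<in> ?R"
      then obtain c where z: "z = (\<Sum>g\<in>insert h G. c g *\<^sub>C a g)" and c: "\<forall>g\<in>insert h G. cmod (c g) \<le> 1"
        by blast
      have "z = c h *\<^sub>C a h + (\<Sum>g\<in>G. c g *\<^sub>C a g)" using z insert.hyps by simp
      moreover have "c h *\<^sub>C a h \<in> (\<lambda>c. c *\<^sub>C a h) ` cball 0 1" using c by auto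
      moreover have "(\<Sum>g\<in>G. c g *\<^sub>C a g) \<in> ?S G" using c by blast
      ultimately show "z \<in> ?L" by blast
    qed
  qed
  finally show ?case .
qed simp

text \<open>Cover the image of the unit ball by finitely many \<open>\<epsilon>\<close>-balls. If a unit vector \<open>v\<close> is orthogonal to
  \<open>A\<^sup>* c\<close> for every center \<open>c\<close>, then \<open>A v\<close> is orthogonal to the centers, and its distance to the nearest one is at least
  \<open>\<parallel>A v\<parallel>\<close>. Together with its converse below this characterizes compactness in terms of the
  norms \<open>\<parallel>A v\<parallel>\<close> alone, which is why \<open>A\<close> and \<open>|A|\<close> are compact simultaneously.\<close>

lemma compact_ops_imp_small_off_finite:
  fixes A :: "'a::complex_hilbert_space \<Rightarrow>\<^sub>L 'a"
  assumes A: "A \<in> compact_ops" and "\<epsilon> > 0"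
  shows "\<exists>F. finite F \<and> (\<forall>v. (\<forall>f\<in>F. cinner v f = 0) \<longrightarrow> norm (A v) \<le> \<epsilon> * norm v)"
proof -
  have Ab: "A \<in> bounded_ops" using A by (simp add: compact_ops_def)
  obtain k where k: "finite k" "closure (A ` cball 0 1) \<subseteq> (\<Union>c\<in>k. ball c \<epsilon>)"
    using A \<open>\<epsilon> > 0\<close> unfolding compact_ops_def compact_eq_totally_bounded by blast
  have "norm (A v) \<le> \<epsilon> * norm v" if v: "\<forall>f\<in>adjoint_op A ` k. cinner v f = 0" for v
  proof (cases "v = 0")
    case False
    define w where "w = (1 / norm v) *\<^sub>R v"
    have "w \<in> cball 0 1" using False by (simp add: w_def)
    then have "A w \<in> closure (A ` cball 0 1)" by (intro subsetD[OF closure_subset] imageI)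
    then obtain c where c: "c \<in> k" "dist c (A w) < \<epsilon>" using k by auto
    have "cinner (A w) (- c) = 0"
      using v c(1)
      by (simp add: w_def blinfun.scaleR_right cinner_scaleR_left cinner.minus_right
          cinner_adjoint_right[OF Ab, symmetric])
    from norm_add_Pythagoras[OF this] have "(norm (A w))\<^sup>2 \<le> (dist c (A w))\<^sup>2"
      by (simp add: dist_norm norm_minus_commute)
    then have "norm (A w) \<le> dist c (A w)" by (rule power2_le_imp_le) simp
    then have "norm (A w) \<le> \<epsilon>" using c(2) by simp
    then show ?thesis using False by (simp add: w_def blinfun.scaleR_right field_simps)
  qed simp
  then show ?thesis using k(1) by blast
qed

text \<open>Up to \<open>\<epsilon>\<close>, the image of the unit ball is the image of the unit ball of a finite-dimensional space.\<close>

lemma compact_opsI: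
  fixes A :: "'a::complex_hilbert_space \<Rightarrow>\<^sub>L 'a"
  assumes A: "A \<in> bounded_ops"
    and small: "\<And>\<epsilon>. \<epsilon> > 0 \<Longrightarrow> \<exists>F. finite F \<and> (\<forall>v. (\<forall>f\<in>F. cinner v f = 0) \<longrightarrow> norm (A v) \<le> \<epsilon> * norm v)"
  shows "A \<in> compact_ops"
proof -
  have "\<exists>k. finite k \<and> closure (A ` cball 0 1) \<subseteq> (\<Union>x\<in>k. ball x e)" if "e > 0" for e
  proof -
    obtain F where F: "finite F" "\<And>v. (\<forall>f\<in>F. cinner v f = 0) \<Longrightarrow> norm (A v) \<le> (e/3) * norm v"
      using small[of "e/3"] \<open>e > 0\<close> by auto
    obtain G where G: "finite G" "orthonormal G id" "F \<subseteq> cspan G" using Gram_Schmidt[OF F(1)] by blast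
    define S where "S = {\<Sum>g\<in>G. c g *\<^sub>C A g | c. \<forall>g\<in>G. cmod (c g) \<le> 1}"
    have "compact S" unfolding S_def by (rule compact_coefficient_sums[OF G(1)])
    then obtain k where k: "finite k" "S \<subseteq> (\<Union>x\<in>k. ball x (e/3))"
      unfolding compact_eq_totally_bounded using \<open>e > 0\<close> by (meson divide_pos_pos zero_less_numeral)
    have "A v \<in> (\<Union>x\<in>k. cball x (2*e/3))" if v: "v \<in> cball 0 1" for v
    proof -
      define p where "p = (\<Sum>g\<in>G. cinner v g *\<^sub>C g)"
      have "cmod (cinner v g) \<le> 1" if "g \<in> G" for g
        using cmod_cinner_le[of v g] orthonormal_norm[OF G(2) that] v by simp
      moreover have "A p = (\<Sum>g\<in>G. cinner v g *\<^sub>C A g)"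
        unfolding p_def by (simp add: blinfun.sum_right bounded_ops_scaleC[OF A])
      ultimately have "A p \<in> S" unfolding S_def by blast
      then obtain x where x: "x \<in> k" "dist x (A p) < e/3" using k by auto
      have o: "cinner (v - p) g = 0" if "g \<in> G" for g
        using residual_orthogonal[OF G(1,2) that] by (simp add: p_def)
      have "\<forall>f\<in>F. cinner (v - p) f = 0" using G(3) o cinner_cspan_eq_0 by blast
      then have "norm (A (v - p)) \<le> (e/3) * norm (v - p)" by (rule F(2))
      moreover have "(norm (v - p))\<^sup>2 \<le> (norm v)\<^sup>2"
        using norm_residual[OF G(1,2), of v] by (simp add: p_def sum_nonneg)
      then have "norm (v - p) \<le> 1" using v by (simp add: power2_le_iff_abs_le)
      then have "(e/3) * norm (v - p) \<le> e/3" using \<open>e > 0\<close> by (simp add: mult_left_le)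
      ultimately have "dist (A p) (A v) \<le> e/3"
        by (simp add: dist_norm blinfun.diff_right norm_minus_commute)
      then have "dist x (A v) \<le> 2*e/3"
        using x(2) dist_triangle[of x "A v" "A p"] by simp
      then show ?thesis using x(1) by auto
    qed
    then have "A ` cball 0 1 \<subseteq> (\<Union>x\<in>k. cball x (2*e/3))" by blast
    moreover have "closed (\<Union>x\<in>k. cball x (2*e/3))" using k(1) by (intro closed_UN) auto
    ultimately have "closure (A ` cball 0 1) \<subseteq> (\<Union>x\<in>k. cball x (2*e/3))" by (rule closure_minimal)
    also have "\<dots> \<subseteq> (\<Union>x\<in>k. ball x e)" using \<open>e > 0\<close> by (intro UN_mono) auto
    finally show ?thesis using k(1) by blast
  qed
  then have "compact (closure (A ` cball 0 1))"
    unfolding compact_eq_totally_bounded by (simp add: complete_eq_closed)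
  then show ?thesis using A by (simp add: compact_ops_def)
qed

lemma compact_bounded_ops: "A \<in> compact_ops \<Longrightarrow> A \<in> bounded_ops"
  by (simp add: compact_ops_def)

text \<open>The common source of the closure properties of the compact operators, as compactness is a condition on norms.\<close>

lemma compact_ops_dominated:
  fixes A :: "'a::complex_hilbert_space \<Rightarrow>\<^sub>L 'a"
  assumes A: "A \<in> bounded_ops" and B: "B \<in> compact_ops" and C: "C \<in> compact_ops"
    and le: "\<And>v. norm (A v) \<le> c * (norm (B v) + norm (C v))" and "0 < c"
  shows "A \<in> compact_ops"
proof (rule compact_opsI[OF A])
  fix \<epsilon> :: real assume "\<epsilon> > 0"
  then have pos: "\<epsilon> / (2 * c) > 0" using \<open>0 < c\<close> by simp
  obtain F G where F: "finite F" "\<And>v. (\<forall>f\<in>F. cinner v f = 0) \<Longrightarrow> norm (B v) \<le> \<epsilon> / (2 * c) * norm v"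
    and G: "finite G" "\<And>v. (\<forall>f\<in>G. cinner v f = 0) \<Longrightarrow> norm (C v) \<le> \<epsilon> / (2 * c) * norm v"
    using compact_ops_imp_small_off_finite[OF B pos] compact_ops_imp_small_off_finite[OF C pos] by auto
  have "norm (A v) \<le> \<epsilon> * norm v" if "\<forall>f\<in>F \<union> G. cinner v f = 0" for v
  proof -
    have "norm (A v) \<le> c * (\<epsilon> / (2 * c) * norm v + \<epsilon> / (2 * c) * norm v)"
      using that \<open>0 < c\<close> by (intro order_trans[OF le] mult_left_mono add_mono F(2) G(2)) auto
    also have "\<dots> = \<epsilon> * norm v" using \<open>0 < c\<close> by (simp add: field_simps)
    finally show ?thesis .
  qed
  then show "\<exists>F. finite F \<and> (\<forall>v. (\<forall>f\<in>F. cinner v f = 0) \<longrightarrow> norm (A v) \<le> \<epsilon> * norm v)"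
    using F(1) G(1) by (intro exI[of _ "F \<union> G"]) simp
qed

lemma abs_op_compact:
  fixes A :: "'a::complex_hilbert_space \<Rightarrow>\<^sub>L 'a"
  shows "A \<in> compact_ops \<Longrightarrow> abs_op A \<in> compact_ops"
  by (rule compact_ops_dominated[of _ A A 1])
    (simp_all add: compact_bounded_ops abs_op_positive positive_bounded_ops norm_abs_op)

lemma compact_ops_approximable:
  fixes A :: "'a::complex_hilbert_space \<Rightarrow>\<^sub>L 'a"
  assumes A: "A \<in> bounded_ops" and approx: "\<And>\<epsilon>. \<epsilon> > 0 \<Longrightarrow> \<exists>C\<in>compact_ops. norm (A - C) \<le> \<epsilon>"
  shows "A \<in> compact_ops"
proof (rule compact_opsI[OF A])
  fix \<epsilon> :: real assume "\<epsilon> > 0"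
  obtain C where C: "C \<in> compact_ops" "norm (A - C) \<le> \<epsilon>/2" using approx[of "\<epsilon>/2"] \<open>\<epsilon> > 0\<close> by auto
  obtain F where F: "finite F" "\<And>v. (\<forall>f\<in>F. cinner v f = 0) \<Longrightarrow> norm (C v) \<le> \<epsilon>/2 * norm v"
    using compact_ops_imp_small_off_finite[OF C(1), of "\<epsilon>/2"] \<open>\<epsilon> > 0\<close> by auto
  have "norm (A v) \<le> \<epsilon> * norm v" if "\<forall>f\<in>F. cinner v f = 0" for v
  proof -
    have "norm (A v) \<le> norm ((A - C) v) + norm (C v)"
      using norm_triangle_ineq[of "(A - C) v" "C v"] by (simp add: blinfun.diff_left)
    also have "norm ((A - C) v) \<le> \<epsilon>/2 * norm v"
      by (rule order_trans[OF norm_blinfun]) (intro mult_right_mono C, simp)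
    also have "norm (C v) \<le> \<epsilon>/2 * norm v" by (rule F(2)[OF that])
    finally show ?thesis by (simp add: algebra_simps)
  qed
  then show "\<exists>F. finite F \<and> (\<forall>v. (\<forall>f\<in>F. cinner v f = 0) \<longrightarrow> norm (A v) \<le> \<epsilon> * norm v)"
    using F(1) by blast
qed

lemma compact_ops_add:
  fixes A :: "'a::complex_hilbert_space \<Rightarrow>\<^sub>L 'a"
  shows "A \<in> compact_ops \<Longrightarrow> B \<in> compact_ops \<Longrightarrow> A + B \<in> compact_ops"
  by (rule compact_ops_dominated[of _ A B 1])
    (simp_all add: bounded_ops_add compact_bounded_ops blinfun.add_left norm_triangle_ineq)

lemma compact_ops_0: "(0 :: 'a::complex_hilbert_space \<Rightarrow>\<^sub>L 'a) \<in> compact_ops"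
  by (rule compact_opsI[OF bounded_ops_0]) auto

lemma compact_ops_scaleR:
  fixes A :: "'a::complex_hilbert_space \<Rightarrow>\<^sub>L 'a"
  shows "A \<in> compact_ops \<Longrightarrow> r *\<^sub>R A \<in> compact_ops"
  by (rule compact_ops_dominated[of _ A A "\<bar>r\<bar> + 1"])
    (simp_all add: bounded_ops_scaleR compact_bounded_ops blinfun.scaleR_left algebra_simps)

lemma compact_ops_sum:
  fixes A :: "'i \<Rightarrow> 'a::complex_hilbert_space \<Rightarrow>\<^sub>L 'a"
  shows "(\<And>i. i \<in> I \<Longrightarrow> A i \<in> compact_ops) \<Longrightarrow> sum A I \<in> compact_ops"
  by (induction I rule: infinite_finite_induct) (auto intro: compact_ops_add compact_ops_0)

section \<open>Eigenvectors of compact positive operators\<close>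

text \<open>The use made of infinite dimension: greedy constructions never come to an end, so every compact operator has an infinite
  sequence of eigenvectors of its absolute value, padded with eigenvalues \<open>0\<close> if necessary.\<close>

lemma unit_vector_off_finite:
  assumes "infinite_dimensional TYPE('a::complex_inner)" and "finite (F :: 'a set)"
  shows "\<exists>v. norm v = 1 \<and> (\<forall>f\<in>F. cinner v f = 0)"
proof -
  obtain G where G: "finite G" "orthonormal G id" "F \<subseteq> cspan G" using Gram_Schmidt[OF assms(2)] by blast
  have "cspan G \<noteq> UNIV" using assms(1) G(1) unfolding infinite_dimensional_def by blast
  then obtain x where x: "x \<notin> cspan G" by blast
  define w where "w = x - (\<Sum>g\<in>G. cinner x g *\<^sub>C g)"
  have "(\<Sum>g\<in>G. cinner x g *\<^sub>C g) \<in> cspan G"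
    by (intro complex_vector.span_sum complex_vector.span_scale complex_vector.span_base)
  then have "w \<noteq> 0" using x by (auto simp: w_def)
  have "cinner w g = 0" if "g \<in> G" for g
    using residual_orthogonal[OF G(1,2) that] by (simp add: w_def)
  then have "cinner w f = 0" if "f \<in> F" for f using G(3) cinner_cspan_eq_0 that by blast
  then show ?thesis using \<open>w \<noteq> 0\<close>
    by (intro exI[of _ "(1 / norm w) *\<^sub>R w"]) (simp add: cinner_scaleR_left)
qed

text \<open>The orthogonal complement of \<open>F\<close> is invariant under \<open>P\<close>. Let \<open>\<mu>\<close> be the supremum of the quadratic form over its unit
  sphere and \<open>v\<^sub>n\<close> a maximizing sequence. Then \<open>\<parallel>P v\<^sub>n - \<mu> v\<^sub>n\<parallel>\<^sup>2 \<le> \<mu> (\<mu> - \<langle>P v\<^sub>n, v\<^sub>n\<rangle>)\<close> tends to \<open>0\<close>, and since a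
  subsequence of \<open>P v\<^sub>n\<close> converges, so does one of \<open>v\<^sub>n\<close> if \<open>\<mu> \<noteq> 0\<close>. The limit is the eigenvector. If
  \<open>\<mu> = 0\<close>, every vector of the complement will do.\<close>

lemma maximal_eigenvector_exists:
  fixes P :: "'a::complex_hilbert_space \<Rightarrow>\<^sub>L 'a"
  assumes inf: "infinite_dimensional TYPE('a)" and P: "P \<in> positive_ops" and PK: "P \<in> compact_ops"
    and F: "finite F" and eig: "\<forall>f\<in>F. \<exists>t::real. P f = t *\<^sub>R f"
  shows "\<exists>e \<mu>. norm e = 1 \<and> (\<forall>f\<in>F. cinner e f = 0) \<and> P e = \<mu> *\<^sub>R e \<and> 0 \<le> \<mu> \<and>
    (\<forall>v. (\<forall>f\<in>F. cinner v f = 0) \<longrightarrow> Re (cinner (P v) v) \<le> \<mu> * (norm v)\<^sup>2)"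
proof -
  define S where "S = {v. norm v = 1 \<and> (\<forall>f\<in>F. cinner v f = 0)}"
  define q where "q v = Re (cinner (P v) v)" for v
  define \<mu> where "\<mu> = (SUP v\<in>S. q v)"
  obtain v0 where v0: "v0 \<in> S" using unit_vector_off_finite[OF inf F] by (auto simp: S_def)
  have "q v \<le> norm P" if "v \<in> S" for v
    using Re_cinner_blinfun_le[of P v] that by (simp add: S_def q_def)
  then have bdd: "bdd_above (q ` S)" by (intro bdd_aboveI2)
  have q_le: "q v \<le> \<mu>" if "v \<in> S" for v unfolding \<mu>_def by (rule cSUP_upper[OF that bdd])
  have \<mu>0: "0 \<le> \<mu>" using q_le[OF v0] positive_cinner_ge0[OF P, of v0] by (simp add: q_def)
  have q_max: "q v \<le> \<mu> * (norm v)\<^sup>2" if v: "\<forall>f\<in>F. cinner v f = 0" for v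
  proof (cases "v = 0")
    case False
    have "(1 / norm v) *\<^sub>R v \<in> S" using v False by (simp add: S_def cinner_scaleR_left)
    from q_le[OF this] show ?thesis using False
      by (simp add: q_def blinfun.scaleR_right cinner_simps field_simps power2_eq_square)
  qed (simp add: q_def)
  have inv: "\<forall>f\<in>F. cinner (P v) f = 0" if "\<forall>f\<in>F. cinner v f = 0" for v
  proof
    fix f assume f: "f \<in> F"
    then obtain t where "P f = t *\<^sub>R f" using eig by blast
    then show "cinner (P v) f = 0" using that f by (simp add: positive_hermitian[OF P] cinner_scaleR_right)
  qed
  have nsq: "(norm (P v))\<^sup>2 \<le> \<mu> * q v" if "\<forall>f\<in>F. cinner v f = 0" for v
    unfolding q_def using q_max[OF inv[OF that]] by (intro positive_norm_sq_le P \<mu>0) (simp add: q_def)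
  have "\<exists>e\<in>S. P e = \<mu> *\<^sub>R e"
  proof (cases "\<mu> = 0")
    case True
    have "norm (P v0) = 0" using nsq[of v0] v0 True by (simp add: S_def)
    then show ?thesis using v0 True by auto
  next
    case False
    have "\<exists>v\<in>S. \<mu> - 1 / real (Suc n) < q v" for n
      using less_cSUP_iff[OF _ bdd, of "\<mu> - 1 / real (Suc n)"] v0 by (auto simp flip: \<mu>_def)
    then obtain v where vS: "\<And>n. v n \<in> S" and qv: "\<And>n. \<mu> - 1 / real (Suc n) < q (v n)" by metis
    have "P (v n) \<in> closure (P ` cball 0 1)" for n
      using vS[of n] by (intro subsetD[OF closure_subset] imageI) (simp add: S_def)
    moreover have "compact (closure (P ` cball 0 1))" using PK by (simp add: compact_ops_def)
    ultimately obtain w r where r: "strict_mono (r :: nat \<Rightarrow> nat)" and w: "((\<lambda>n. P (v n)) \<circ> r) \<longlonglongrightarrow> w"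
      unfolding compact_def by (elim allE impE; blast)
    have bound: "(norm (P (v n) - \<mu> *\<^sub>R v n))\<^sup>2 \<le> \<mu> * (1 / real (Suc n))" for n
    proof -
      have v: "norm (v n) = 1" "\<forall>f\<in>F. cinner (v n) f = 0" using vS[of n] by (auto simp: S_def)
      have "(norm (P (v n) - \<mu> *\<^sub>R v n))\<^sup>2 = (norm (P (v n)))\<^sup>2 - 2 * \<mu> * q (v n) + \<mu>\<^sup>2"
        using v(1) unfolding q_def inner_eq_Re_cinner[symmetric]
        by (simp add: power2_norm_eq_inner inner_diff_left inner_diff_right inner_commute[of "v n" "P (v n)"])
          (simp add: algebra_simps power2_eq_square norm_eq_1)
      also have "\<dots> \<le> \<mu> * (\<mu> - q (v n))" using nsq[OF v(2)] by (simp add: algebra_simps power2_eq_square)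
      also have "\<dots> \<le> \<mu> * (1 / real (Suc n))" using qv[of n] \<mu>0 by (intro mult_left_mono) auto
      finally show ?thesis .
    qed
    have "(\<lambda>n. \<mu> * (1 / real (Suc n))) \<longlonglongrightarrow> \<mu> * 0"
      by (intro tendsto_mult tendsto_const LIMSEQ_Suc[OF lim_1_over_n])
    then have upper: "(\<lambda>n. \<mu> * (1 / real (Suc n))) \<longlonglongrightarrow> 0" by simp
    have "(\<lambda>n. (norm (P (v n) - \<mu> *\<^sub>R v n))\<^sup>2) \<longlonglongrightarrow> 0"
      by (rule tendsto_sandwich[OF always_eventually always_eventually tendsto_const upper])
        (intro allI zero_le_power2 bound)+
    then have "(\<lambda>n. sqrt ((norm (P (v n) - \<mu> *\<^sub>R v n))\<^sup>2)) \<longlonglongrightarrow> sqrt 0" by (rule tendsto_real_sqrt)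
    then have "(\<lambda>n. P (v n) - \<mu> *\<^sub>R v n) \<longlonglongrightarrow> 0" by (simp add: tendsto_norm_zero_iff)
    then have "(\<lambda>n. P (v (r n)) - \<mu> *\<^sub>R v (r n)) \<longlonglongrightarrow> 0"
      using LIMSEQ_subseq_LIMSEQ[OF _ r] by (fastforce simp: o_def)
    moreover have w': "(\<lambda>n. P (v (r n))) \<longlonglongrightarrow> w" using w by (simp add: o_def)
    ultimately have "(\<lambda>n. (1 / \<mu>) *\<^sub>R (P (v (r n)) - (P (v (r n)) - \<mu> *\<^sub>R v (r n)))) \<longlonglongrightarrow> (1 / \<mu>) *\<^sub>R (w - 0)"
      by (intro tendsto_intros)
    then have lim: "(\<lambda>n. v (r n)) \<longlonglongrightarrow> (1 / \<mu>) *\<^sub>R w" using False by simp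
    define e where "e = (1 / \<mu>) *\<^sub>R w"
    have "(\<lambda>n. norm (v (r n))) \<longlonglongrightarrow> norm e" unfolding e_def by (intro tendsto_norm lim)
    moreover have "norm (v (r n)) = 1" for n using vS by (simp add: S_def)
    ultimately have "norm e = 1" by (simp add: LIMSEQ_const_iff)
    moreover have "cinner e f = 0" if "f \<in> F" for f
    proof -
      have "(\<lambda>n. cinner (v (r n)) f) \<longlonglongrightarrow> cinner e f" unfolding e_def by (intro cinner.tendsto lim tendsto_const)
      moreover have "cinner (v (r n)) f = 0" for n using vS that by (simp add: S_def)
      ultimately show ?thesis by (simp add: LIMSEQ_const_iff)
    qed
    moreover have "P e = \<mu> *\<^sub>R e"
    proof -
      have "(\<lambda>n. P (v (r n))) \<longlonglongrightarrow> P e" unfolding e_def by (intro blinfun.tendsto tendsto_const lim)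
      then have "P e = w" using w' by (rule LIMSEQ_unique)
      also have "w = \<mu> *\<^sub>R e" using False by (simp add: e_def)
      finally show ?thesis .
    qed
    ultimately show ?thesis by (auto simp: S_def)
  qed
  then obtain e where "e \<in> S" "P e = \<mu> *\<^sub>R e" by blast
  then show ?thesis
    using \<mu>0 q_max by (intro exI[of _ e] exI[of _ \<mu>] conjI) (simp_all add: S_def q_def)
qed

text \<open>Used for two constructions: of eigenvectors, each with the largest eigenvalue left over by its predecessors, and of a
  sequence on which an operator that is not compact is bounded below.\<close>

lemma orthonormal_sequence_greedy:
  assumes step: "\<And>F :: 'a::complex_inner set. finite F \<Longrightarrow> (\<And>f. f \<in> F \<Longrightarrow> R f) \<Longrightarrow>
    \<exists>e. norm e = 1 \<and> (\<forall>f\<in>F. cinner e f = 0) \<and> R e \<and> Q F e"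
  shows "\<exists>e. orthonormal (UNIV :: nat set) e \<and> (\<forall>n. R (e n) \<and> Q (e ` {..<n}) (e n))"
proof -
  define good where "good F \<longleftrightarrow> finite F \<and> (\<forall>f\<in>F. R f)" for F
  define extends where "extends F e \<longleftrightarrow> norm e = 1 \<and> (\<forall>f\<in>F. cinner e f = 0) \<and> R e \<and> Q F e" for F e
  have "\<exists>e. extends F e" if "good F" for F
    using step[of F] that unfolding good_def extends_def by blast
  then obtain g where g: "\<And>F. good F \<Longrightarrow> extends F (g F)" by metis
  define Fs where "Fs n = ((\<lambda>F. insert (g F) F) ^^ n) {}" for n
  define e where "e n = g (Fs n)" for n
  have FsS: "Fs (Suc n) = insert (e n) (Fs n)" for n by (simp add: Fs_def e_def)
  have Fs: "Fs n = e ` {..<n}" for n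
  proof (induction n)
    case (Suc n) then show ?case by (simp add: FsS lessThan_Suc)
  qed (simp add: Fs_def)
  have good: "good (Fs n)" for n
  proof (induction n)
    case 0 then show ?case by (simp add: good_def Fs_def)
  next
    case (Suc n)
    then have "R (e n)" using g by (simp add: e_def extends_def)
    then show ?case using Suc by (auto simp: good_def FsS)
  qed
  have "extends (Fs n) (e n)" for n unfolding e_def by (rule g[OF good])
  then have e: "extends (e ` {..<n}) (e n)" for n unfolding Fs .
  have "cinner (e i) (e j) = (if i = j then 1 else 0)" for i j
    using e[of i] e[of j]
    by (cases i j rule: linorder_cases) (auto simp: extends_def cinner_eq_0_commute[of "e i"] cinner_self)
  then have "orthonormal UNIV e" by (simp add: orthonormal_def)
  moreover have "\<forall>n. R (e n) \<and> Q (e ` {..<n}) (e n)" using e by (simp add: extends_def)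
  ultimately show ?thesis by blast
qed

text \<open>The eigenvectors are chosen greedily, which puts the eigenvalues in decreasing order. They tend to \<open>0\<close> because the
  images of the eigenvectors are orthogonal, hence cannot accumulate at a positive distance from \<open>0\<close>. In place of an expansion of
  \<open>P\<close>, the last conjunct bounds \<open>P\<close> off the first \<open>n\<close> eigenvectors.\<close>

theorem compact_positive_spectral:
  fixes P :: "'a::complex_hilbert_space \<Rightarrow>\<^sub>L 'a"
  assumes inf: "infinite_dimensional TYPE('a)" and P: "P \<in> positive_ops" and PK: "P \<in> compact_ops"
  shows "\<exists>e s. orthonormal (UNIV :: nat set) e \<and> antimono s \<and> (\<forall>n. 0 \<le> s n) \<and> s \<longlonglongrightarrow> 0 \<and>
    (\<forall>n. P (e n) = s n *\<^sub>R e n) \<and>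
    (\<forall>n v. (\<forall>i<n. cinner v (e i) = 0) \<longrightarrow> norm (P v) \<le> s n * norm v)"
proof -
  define dominates where
    "dominates F e \<longleftrightarrow> (\<forall>v. (\<forall>f\<in>F. cinner v f = 0) \<longrightarrow> Re (cinner (P v) v) \<le> Re (cinner (P e) e) * (norm v)\<^sup>2)"
    for F e
  have step: "\<exists>e. norm e = 1 \<and> (\<forall>f\<in>F. cinner e f = 0) \<and> (\<exists>t::real. P e = t *\<^sub>R e) \<and> dominates F e"
    if F: "finite F" "\<And>f. f \<in> F \<Longrightarrow> \<exists>t::real. P f = t *\<^sub>R f" for F
  proof -
    have "\<forall>f\<in>F. \<exists>t::real. P f = t *\<^sub>R f" using F(2) by blast
    from maximal_eigenvector_exists[OF inf P PK F(1) this]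
    obtain e \<mu> where e: "norm e = 1" "\<forall>f\<in>F. cinner e f = 0" "P e = \<mu> *\<^sub>R e"
      and max: "\<forall>v. (\<forall>f\<in>F. cinner v f = 0) \<longrightarrow> Re (cinner (P v) v) \<le> \<mu> * (norm v)\<^sup>2"
      by (elim exE conjE)
    have "Re (cinner (P e) e) = \<mu>" by (simp add: e cinner_scaleR_left cinner_self)
    with max have "dominates F e" unfolding dominates_def by simp
    with e show ?thesis by blast
  qed
  obtain e where on: "orthonormal (UNIV :: nat set) e"
    and e: "\<And>n. (\<exists>t::real. P (e n) = t *\<^sub>R e n) \<and> dominates (e ` {..<n}) (e n)"
    using orthonormal_sequence_greedy[of "\<lambda>e. \<exists>t::real. P e = t *\<^sub>R e" dominates, OF step] by blast
  define s where "s n = Re (cinner (P (e n)) (e n))" for n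
  have e1: "norm (e n) = 1" for n using orthonormal_norm[OF on] by simp
  have e0: "cinner (e n) (e i) = 0" if "i < n" for i n using on that by (simp add: orthonormal_def)
  have s0: "0 \<le> s n" for n unfolding s_def by (rule positive_cinner_ge0[OF P])
  have max: "Re (cinner (P v) v) \<le> s n * (norm v)\<^sup>2" if "\<forall>i<n. cinner v (e i) = 0" for n v
    using e[of n] that unfolding dominates_def s_def by auto
  have Pe: "P (e n) = s n *\<^sub>R e n" for n
  proof -
    obtain t :: real where t: "P (e n) = t *\<^sub>R e n" using e by blast
    then have "s n = t" by (simp add: s_def cinner_scaleR_left cinner_self e1)
    then show ?thesis using t by simp
  qed
  have bound: "norm (P v) \<le> s n * norm v" if v: "\<forall>i<n. cinner v (e i) = 0" for n v
  proof -
    have "\<forall>i<n. cinner (P v) (e i) = 0"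
      using v by (simp add: positive_hermitian[OF P] Pe cinner_scaleR_right)
    then have "(norm (P v))\<^sup>2 \<le> s n * Re (cinner (P v) v)"
      by (intro positive_norm_sq_le P s0 max)
    also have "\<dots> \<le> s n * (s n * (norm v)\<^sup>2)" by (intro mult_left_mono max v s0)
    also have "\<dots> = (s n * norm v)\<^sup>2" by (simp add: power2_eq_square)
    finally show ?thesis by (rule power2_le_imp_le) (simp add: s0)
  qed
  have dec: "antimono s"
  proof (rule decseq_SucI)
    fix n
    have "Re (cinner (P (e (Suc n))) (e (Suc n))) \<le> s n * (norm (e (Suc n)))\<^sup>2" by (rule max) (simp add: e0)
    then show "s (Suc n) \<le> s n" by (simp add: Pe cinner_scaleR_left cinner_self e1)
  qed
  have "s \<longlonglongrightarrow> 0"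
  proof -
    obtain L where L: "s \<longlonglongrightarrow> L" "\<And>n. L \<le> s n" using decseq_convergent[OF dec] s0 by metis
    have "L \<ge> 0" using LIMSEQ_le_const[OF L(1)] s0 by blast
    have "L = 0"
    proof (rule ccontr)
      assume "L \<noteq> 0"
      with \<open>L \<ge> 0\<close> have "L > 0" by simp
      have "P (e n) \<in> closure (P ` cball 0 1)" for n
        by (intro subsetD[OF closure_subset] imageI) (simp add: e1)
      moreover have "compact (closure (P ` cball 0 1))" using PK by (simp add: compact_ops_def)
      ultimately obtain w r where r: "strict_mono (r :: nat \<Rightarrow> nat)" and w: "((\<lambda>n. P (e n)) \<circ> r) \<longlonglongrightarrow> w"
        unfolding compact_def by (elim allE impE; blast)
      then have "Cauchy ((\<lambda>n. P (e n)) \<circ> r)" by (simp add: LIMSEQ_imp_Cauchy)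
      then obtain N where "\<forall>i\<ge>N. \<forall>j\<ge>N. norm (((\<lambda>n. P (e n)) \<circ> r) i - ((\<lambda>n. P (e n)) \<circ> r) j) < L"
        using CauchyD[OF _ \<open>L > 0\<close>] by blast
      then have "norm (((\<lambda>n. P (e n)) \<circ> r) N - ((\<lambda>n. P (e n)) \<circ> r) (Suc N)) < L"
        using le_SucI[OF order_refl] order_refl by blast
      then have lt: "norm (P (e (r N)) - P (e (r (Suc N)))) < L" by simp
      have "r N \<noteq> r (Suc N)" using r by (simp add: strict_mono_eq)
      then have "cinner (P (e (r N))) (- P (e (r (Suc N)))) = 0"
        using on by (simp add: Pe cinner_simps orthonormal_def)
      from norm_add_Pythagoras[OF this]
      have "(norm (P (e (r N))))\<^sup>2 \<le> (norm (P (e (r N)) - P (e (r (Suc N)))))\<^sup>2" by simp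
      then have "norm (P (e (r N))) \<le> norm (P (e (r N)) - P (e (r (Suc N))))" by (rule power2_le_imp_le) simp
      then show False using lt L(2)[of "r N"] by (simp add: Pe e1 s0)
    qed
    then show ?thesis using L by simp
  qed
  then show ?thesis using on dec s0 Pe bound by blast
qed

section \<open>Singular values\<close>

text \<open>At the first index \<open>n\<close> where the sequences differ, the larger value occurs in the other sequence only before \<open>n\<close>,
  where both agree; so its multiplicities differ.\<close>

lemma decreasing_multiplicities_unique:
  fixes s t :: "nat \<Rightarrow> real"
  assumes s: "antimono s" "\<And>n. 0 \<le> s n" and t: "antimono t" "\<And>n. 0 \<le> t n"
    and ms: "\<And>l. l > 0 \<Longrightarrow> finite {n. s n = l} \<and> card {n. s n = l} = d l"
    and mt: "\<And>l. l > 0 \<Longrightarrow> finite {n. t n = l} \<and> card {n. t n = l} = d l"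
  shows "s = t"
proof -
  have le: "u n \<le> w n"
    if u: "\<And>n. 0 \<le> u n" and mu: "\<And>l. l > 0 \<Longrightarrow> finite {n. u n = l} \<and> card {n. u n = l} = d l"
      and w: "antimono w" "\<And>n. 0 \<le> w n" and mw: "\<And>l. l > 0 \<Longrightarrow> finite {n. w n = l} \<and> card {n. w n = l} = d l"
      and eq: "\<And>k. k < n \<Longrightarrow> u k = w k" for u w :: "nat \<Rightarrow> real" and n
  proof (rule ccontr)
    assume lt: "\<not> u n \<le> w n"
    then have l: "u n > 0" using w(2)[of n] by linarith
    have "{k. w k = u n} \<subseteq> {k. u k = u n} - {n}"
    proof
      fix k assume k: "k \<in> {k. w k = u n}"
      have "k < n"
      proof (rule ccontr)
        assume "\<not> k < n"
        then have "w k \<le> w n" using w(1) by (simp add: antimonoD)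
        then show False using k lt by simp
      qed
      then show "k \<in> {k. u k = u n} - {n}" using k eq by auto
    qed
    then have "card {k. w k = u n} \<le> card ({k. u k = u n} - {n})"
      using mu[OF l] by (intro card_mono) auto
    also have "\<dots> < card {k. u k = u n}" using mu[OF l] by (intro card_Diff1_less) auto
    finally show False using mu[OF l] mw[OF l] by simp
  qed
  have "s n = t n" for n
  proof (induction n rule: less_induct)
    case (less n)
    show ?case
      by (rule antisym; rule le) (use s t ms mt less in auto)
  qed
  then show ?thesis by blast
qed

lemma cdim_cspan_orthonormal:
  assumes on: "orthonormal S id" shows "cdim (cspan S) = card S"
proof -
  have "complex_vector.independent S"
    unfolding complex_vector.dependent_def
  proof clarify
    fix a assume a: "a \<in> S" "a \<in> cspan (S - {a})"
    have "cinner a a = 0" by (rule cinner_cspan_eq_0[OF a(2)]) (use on a(1) in \<open>auto simp: orthonormal_def\<close>)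
    then show False using on a(1) by (simp add: orthonormal_def)
  qed
  then show ?thesis by (rule complex_vector.dim_span_eq_card_independent)
qed

text \<open>Subtracting from an eigenvector for \<open>l\<close> its components along the \<open>e\<^sub>n\<close> with \<open>s\<^sub>n = l\<close> leaves an eigenvector that is orthogonal to
  every \<open>e\<^sub>n\<close>. There \<open>P\<close> vanishes, since it is bounded by every \<open>s\<^sub>n\<close> and these tend to \<open>0\<close>; so nothing is left.\<close>

lemma eigenvalue_multiplicity:
  fixes P :: "'a::complex_hilbert_space \<Rightarrow>\<^sub>L 'a"
  assumes P: "P \<in> positive_ops" and on: "orthonormal (UNIV :: nat set) e"
    and s: "s \<longlonglongrightarrow> 0" and Pe: "\<And>n. P (e n) = s n *\<^sub>R e n"
    and bound: "\<And>n v. (\<forall>i<n. cinner v (e i) = 0) \<Longrightarrow> norm (P v) \<le> s n * norm v"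
    and l: "l > 0"
  shows "finite {n. s n = l} \<and> card {n. s n = l} = cdim {v. P v = l *\<^sub>R v}"
proof -
  define N where "N = {n. s n = l}"
  obtain k where k: "\<And>n. n \<ge> k \<Longrightarrow> s n < l"
    using order_tendstoD(2)[OF s l] unfolding eventually_sequentially by blast
  have "N \<subseteq> {..<k}" using k unfolding N_def by (metis (mono_tags) lessThan_iff linorder_not_le mem_Collect_eq order_less_irrefl subsetI)
  then have fin: "finite N" using finite_subset by blast
  have onN: "orthonormal N e" by (rule orthonormal_subset[OF on]) simp
  have inj: "inj_on e N"
    by (rule inj_onI) (metis onN orthonormal_def zero_neq_one)
  have onE: "orthonormal (e ` N) id" using onN inj by (auto simp: orthonormal_def inj_on_eq_iff)
  have "{v. P v = l *\<^sub>R v} = cspan (e ` N)"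
  proof
    have "complex_vector.subspace {v. P v = l *\<^sub>R v}"
      unfolding complex_vector.subspace_def
      by (auto simp: blinfun.add_right scaleC_add_right bounded_ops_scaleC[OF positive_bounded_ops[OF P]]
          scaleR_scaleC scaleC_scaleC mult.commute)
    moreover have "e ` N \<subseteq> {v. P v = l *\<^sub>R v}" by (auto simp: N_def Pe)
    ultimately show "cspan (e ` N) \<subseteq> {v. P v = l *\<^sub>R v}" by (rule complex_vector.span_minimal[rotated])
    show "{v. P v = l *\<^sub>R v} \<subseteq> cspan (e ` N)"
    proof
      fix v assume "v \<in> {v. P v = l *\<^sub>R v}"
      then have v: "P v = l *\<^sub>R v" by simp
      define p where "p = (\<Sum>n\<in>N. cinner v (e n) *\<^sub>C e n)"
      have p: "p \<in> cspan (e ` N)"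
        unfolding p_def by (intro complex_vector.span_sum complex_vector.span_scale complex_vector.span_base) simp
      then have "P p = l *\<^sub>R p" using \<open>cspan (e ` N) \<subseteq> _\<close> by blast
      then have w: "P (v - p) = l *\<^sub>R (v - p)" using v by (simp add: blinfun.diff_right scaleR_diff_right)
      have "cinner (v - p) (e n) = 0" for n
      proof (cases "n \<in> N")
        case True then show ?thesis using residual_orthogonal[OF fin onN] by (simp add: p_def)
      next
        case False
        have "of_real l * cinner (v - p) (e n) = cinner (P (v - p)) (e n)" by (simp add: w cinner_scaleR_left)
        also have "\<dots> = of_real (s n) * cinner (v - p) (e n)"
          by (simp add: positive_hermitian[OF P] Pe cinner_scaleR_right)
        finally show ?thesis using False by (simp add: N_def)
      qed
      then have "norm (P (v - p)) \<le> s n * norm (v - p)" for n using bound by blast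
      moreover have "(\<lambda>n. s n * norm (v - p)) \<longlonglongrightarrow> 0 * norm (v - p)" by (intro tendsto_mult s tendsto_const)
      ultimately have "norm (P (v - p)) \<le> 0 * norm (v - p)" by (intro LIMSEQ_le_const) auto
      then have "norm (v - p) = 0" using w l by (simp add: mult_le_0_iff)
      then have "v = p" by simp
      then show "v \<in> cspan (e ` N)" using p by simp
    qed
  qed
  then have "cdim {v. P v = l *\<^sub>R v} = card N" using cdim_cspan_orthonormal[OF onE] card_image[OF inj] by simp
  then show ?thesis using fin by (simp add: N_def)
qed

text \<open>The vectors \<open>e\<^sub>n\<close> of a Schmidt expansion of \<open>A\<close>. The last conjunct says that the part of \<open>A\<close> beyond the first
  \<open>n\<close> terms has norm at most \<open>s\<^sub>n\<close>.\<close>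

definition singular_basis :: "('a::complex_hilbert_space \<Rightarrow>\<^sub>L 'a) \<Rightarrow> (nat \<Rightarrow> 'a) \<Rightarrow> bool" where
  "singular_basis A e \<longleftrightarrow> orthonormal UNIV e \<and> (\<forall>n. abs_op A (e n) = singular_values A n *\<^sub>R e n) \<and>
    (\<forall>n v. (\<forall>i<n. cinner v (e i) = 0) \<longrightarrow> norm (A v) \<le> singular_values A n * norm v)"

lemma singular_values_spectral:
  fixes A :: "'a::complex_hilbert_space \<Rightarrow>\<^sub>L 'a"
  assumes inf: "infinite_dimensional TYPE('a)" and A: "A \<in> compact_ops"
  shows "antimono (singular_values A) \<and> (\<forall>n. 0 \<le> singular_values A n) \<and> singular_values A \<longlonglongrightarrow> 0 \<and>
    (\<exists>e. singular_basis A e)"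
proof -
  note Ab = compact_bounded_ops[OF A]
  obtain e s where es: "orthonormal (UNIV :: nat set) e" "antimono s" "\<And>n. 0 \<le> s n" "s \<longlonglongrightarrow> 0"
    "\<And>n. abs_op A (e n) = s n *\<^sub>R e n"
    "\<And>n v. (\<forall>i<n. cinner v (e i) = 0) \<Longrightarrow> norm (abs_op A v) \<le> s n * norm v"
    using compact_positive_spectral[OF inf abs_op_positive[OF Ab] abs_op_compact[OF A]] by metis
  note mult = eigenvalue_multiplicity[OF abs_op_positive[OF Ab] es(1,4,5,6)]
  have "singular_values A = s"
    unfolding singular_values_def
  proof (rule the_equality)
    show "antimono s \<and> (\<forall>n. 0 \<le> s n) \<and>
        (\<forall>l>0. finite {n. s n = l} \<and> card {n. s n = l} = cdim {v. abs_op A v = l *\<^sub>R v})"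
      using es mult by blast
    fix t :: "nat \<Rightarrow> real"
    assume "antimono t \<and> (\<forall>n. 0 \<le> t n) \<and>
        (\<forall>l>0. finite {n. t n = l} \<and> card {n. t n = l} = cdim {v. abs_op A v = l *\<^sub>R v})"
    then show "t = s"
      by (intro decreasing_multiplicities_unique[of t s "\<lambda>l. cdim {v. abs_op A v = l *\<^sub>R v}"])
        (use es mult in auto)
  qed
  then show ?thesis
    using es by (auto simp: singular_basis_def norm_abs_op[OF Ab])
qed

section \<open>Schmidt expansions and Ky Fan sums\<close>

lift_definition rank_one :: "'a::complex_inner \<Rightarrow> 'a \<Rightarrow> ('a \<Rightarrow>\<^sub>L 'a)" is "\<lambda>f e v. cinner v e *\<^sub>C f"
proof -
  fix f e :: 'a
  show "bounded_linear (\<lambda>v. cinner v e *\<^sub>C f)"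
  proof (rule bounded_linear_intro[where K = "norm e * norm f"])
    fix v :: 'a
    show "norm (cinner v e *\<^sub>C f) \<le> norm v * (norm e * norm f)"
      using mult_right_mono[OF cmod_cinner_le norm_ge_zero[of f]] by (simp add: norm_scaleC mult.assoc)
  qed (simp_all add: cinner_simps scaleC_add_left scaleR_scaleC scaleC_scaleC)
qed

lemma rank_one_apply [simp]: "rank_one f e v = cinner v e *\<^sub>C f"
  by transfer simp

lemma rank_one_bounded_ops: "rank_one f e \<in> bounded_ops"
  by (simp add: bounded_ops_def cinner_scaleC_left scaleC_scaleC)

lemma blinfun_sum_apply: "blinfun_apply (\<Sum>i\<in>I. A i) v = (\<Sum>i\<in>I. A i v)"
  by (rule blinfun.sum_left)

lemma cinner_sum_scaleC:
  "cinner (\<Sum>i\<in>I. a i *\<^sub>C x i) (\<Sum>j\<in>J. b j *\<^sub>C y j)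
    = (\<Sum>i\<in>I. \<Sum>j\<in>J. a i * cnj (b j) * cinner (x i) (y j))"
  unfolding cinner.sum_left by (simp add: cinner.sum_right cinner_simps sum_distrib_left mult_ac)

lemma sum_cmod_product_le:
  assumes "(\<Sum>i\<in>I. (cmod (a i))\<^sup>2) \<le> 1" "(\<Sum>i\<in>I. (cmod (b i))\<^sup>2) \<le> 1"
  shows "(\<Sum>i\<in>I. cmod (a i) * cmod (b i)) \<le> 1"
proof -
  have "(\<Sum>i\<in>I. cmod (a i) * cmod (b i)) \<le> L2_set (\<lambda>i. cmod (a i)) I * L2_set (\<lambda>i. cmod (b i)) I"
    using L2_set_mult_ineq[of "\<lambda>i. cmod (a i)" "\<lambda>i. cmod (b i)" I] by simp
  also have "\<dots> \<le> 1" using assms by (intro mult_le_one) (simp_all add: L2_set_def sum_nonneg)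
  finally show ?thesis .
qed

lemma norm_cinner_blinfun_le:
  assumes "norm B \<le> c" "norm u \<le> 1" "norm v \<le> 1"
  shows "cmod (cinner (blinfun_apply B u) v) \<le> c"
proof -
  have "cmod (cinner (B u) v) \<le> norm (B u) * norm v" by (rule cmod_cinner_le)
  also have "\<dots> \<le> (norm B * norm u) * norm v" by (intro mult_right_mono norm_blinfun) simp
  also have "\<dots> \<le> (c * 1) * 1"
    using assms order_trans[OF norm_ge_zero assms(1)] by (intro mult_mono) auto
  finally show ?thesis by simp
qed

locale compact_operator =
  fixes A :: "'a::complex_hilbert_space \<Rightarrow>\<^sub>L 'a" and e :: "nat \<Rightarrow> 'a"
  assumes inf: "infinite_dimensional TYPE('a)" and A: "A \<in> compact_ops" and e: "singular_basis A e"
begin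

abbreviation s :: "nat \<Rightarrow> real" where "s \<equiv> singular_values A"

text \<open>The other family of the Schmidt expansion; \<open>f n = 0\<close> where \<open>s n = 0\<close>, by the convention for division.\<close>

definition f :: "nat \<Rightarrow> 'a" where "f n = (1 / s n) *\<^sub>R A (e n)"

lemma Ab: "A \<in> bounded_ops"
  using A by (rule compact_bounded_ops)

lemma s_dec: "antimono s" and s_nonneg: "0 \<le> s n" and s_lim: "s \<longlonglongrightarrow> 0"
  using singular_values_spectral[OF inf A] by auto

lemma e_orthonormal: "orthonormal I e"
  using e orthonormal_subset[of UNIV e I] by (simp add: singular_basis_def)

lemma abs_e: "abs_op A (e n) = s n *\<^sub>R e n"
  using e by (simp add: singular_basis_def)

lemma tail: "(\<And>i. i < n \<Longrightarrow> cinner v (e i) = 0) \<Longrightarrow> norm (A v) \<le> s n * norm v"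
  using e by (simp add: singular_basis_def)

lemma norm_e: "norm (e n) = 1"
  using orthonormal_norm[OF e_orthonormal[of UNIV]] by simp

lemma cinner_e: "cinner (e i) (e j) = (if i = j then 1 else 0)"
  using e_orthonormal[of UNIV] by (simp add: orthonormal_def)

lemma cinner_A_e: "cinner (A v) (A (e n)) = of_real ((s n)\<^sup>2) * cinner v (e n)"
proof -
  have "cinner (A v) (A (e n)) = cinner (abs_op A v) (abs_op A (e n))" by (simp add: cinner_abs_op[OF Ab])
  also have "\<dots> = of_real (s n) * cinner v (abs_op A (e n))"
    by (simp add: abs_e cinner_scaleR_right positive_hermitian[OF abs_op_positive[OF Ab]])
  finally show ?thesis by (simp add: abs_e cinner_scaleR_right power2_eq_square)
qed

lemma norm_A_e: "norm (A (e n)) = s n"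
  using norm_abs_op[OF Ab, of "e n"] s_nonneg by (simp add: abs_e norm_e)

lemma A_e: "A (e n) = s n *\<^sub>R f n"
  using norm_A_e[of n] by (cases "s n = 0") (simp_all add: f_def)

lemma cinner_f: "cinner (f i) (f j) = (if i = j \<and> s i \<noteq> 0 then 1 else 0)"
  by (auto simp: f_def cinner_simps cinner_A_e cinner_e power2_eq_square)

lemma f_suborthonormal: "suborthonormal I f"
  by (auto simp: suborthonormal_def cinner_f) (simp add: f_def norm_A_e s_nonneg)

lemma s_zero_mono: "s i = 0 \<Longrightarrow> i \<le> j \<Longrightarrow> s j = 0"
  using s_dec s_nonneg antimonoD[of s i j] by (simp add: order_antisym)

text \<open>The Schmidt expansion of \<open>A v\<close> after \<open>m\<close> terms. The remainder is orthogonal to these terms, as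
  \<open>A\<^sup>* A e\<^sub>n = s\<^sub>n\<^sup>2 e\<^sub>n\<close>.\<close>

lemma A_split:
  defines "r m v \<equiv> v - (\<Sum>n<m. cinner v (e n) *\<^sub>C e n)"
  shows "A v = A (r m v) + (\<Sum>n<m. (of_real (s n) * cinner v (e n)) *\<^sub>C f n)"
    and "n < m \<Longrightarrow> cinner (A (r m v)) (f n) = 0"
    and "norm (A (r m v)) \<le> s m * norm (r m v)"
    and "(norm (r m v))\<^sup>2 = (norm v)\<^sup>2 - (\<Sum>n<m. (cmod (cinner v (e n)))\<^sup>2)"
proof -
  have o: "cinner (r m v) (e n) = 0" if "n < m" for n
    unfolding r_def by (rule residual_orthogonal) (use that in \<open>auto intro: e_orthonormal\<close>)
  show "A v = A (r m v) + (\<Sum>n<m. (of_real (s n) * cinner v (e n)) *\<^sub>C f n)"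
    by (simp add: r_def blinfun.diff_right blinfun.sum_right bounded_ops_scaleC[OF Ab] A_e
        scaleR_scaleC scaleC_scaleC mult.commute)
  show "n < m \<Longrightarrow> cinner (A (r m v)) (f n) = 0"
    by (simp add: f_def cinner_scaleR_right cinner_A_e o)
  show "norm (A (r m v)) \<le> s m * norm (r m v)" by (rule tail) (rule o)
  show "(norm (r m v))\<^sup>2 = (norm v)\<^sup>2 - (\<Sum>n<m. (cmod (cinner v (e n)))\<^sup>2)"
    unfolding r_def by (rule norm_residual) (auto intro: e_orthonormal)
qed

lemma split_Pythagoras:
  assumes "\<And>n. n < m \<Longrightarrow> cinner w (f n) = 0"
  shows "(norm (w + (\<Sum>n<m. c n *\<^sub>C f n)))\<^sup>2 \<le> (norm w)\<^sup>2 + (\<Sum>n<m. (cmod (c n))\<^sup>2)"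
proof -
  have "cinner w (\<Sum>n<m. c n *\<^sub>C f n) = 0"
    using assms by (simp add: cinner.sum_right cinner_scaleC_right)
  from norm_add_Pythagoras[OF this] show ?thesis
    using norm_suborthonormal_expansion[OF _ f_suborthonormal, of "{..<m}" c] by simp
qed

text \<open>The part of \<open>A\<close> above the level \<open>s m\<close>: the singular values \<open>s n\<close> are lowered to \<open>s n - s m\<close>, and the terms with
  \<open>n \<ge> m\<close> are dropped. This splitting is optimal for the sum of \<open>\<parallel>Y\<parallel>\<^sub>1\<close> and
  \<open>m \<parallel>A - Y\<parallel>\<^sub>\<infinity>\<close>.\<close>

definition Y :: "nat \<Rightarrow> ('a \<Rightarrow>\<^sub>L 'a)" where
  "Y m = (\<Sum>n<m. (s n - s m) *\<^sub>R rank_one (f n) (e n))"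

lemma Y_apply: "Y m v = (\<Sum>n<m. (of_real (s n - s m) * cinner v (e n)) *\<^sub>C f n)"
  by (simp only: Y_def blinfun_sum_apply blinfun.scaleR_left rank_one_apply scaleR_scaleC scaleC_scaleC)

lemma Y_bounded_ops: "Y m \<in> bounded_ops"
  unfolding Y_def by (intro bounded_ops_sum bounded_ops_scaleR rank_one_bounded_ops)

lemma s_diff_nonneg: "n < m \<Longrightarrow> 0 \<le> s n - s m"
  using antimonoD[OF s_dec, of n m] by simp

lemma norm_A_minus_Y: "norm (A - Y m) \<le> s m"
proof (rule norm_blinfun_bound[OF s_nonneg])
  fix v
  define r where "r = v - (\<Sum>n<m. cinner v (e n) *\<^sub>C e n)"
  note split = A_split[where v = v and m = m, folded r_def]
  have "(A - Y m) v = A r + (\<Sum>n<m. (of_real (s m) * cinner v (e n)) *\<^sub>C f n)"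
    unfolding blinfun.diff_left Y_apply split(1) add_diff_eq[symmetric] sum_subtractf[symmetric]
      complex_vector.scale_left_diff_distrib[symmetric]
    by (intro arg_cong2[of _ _ _ _ "(+)"] sum.cong refl) (simp add: algebra_simps)
  then have "(norm ((A - Y m) v))\<^sup>2
      \<le> (norm (A r))\<^sup>2 + (\<Sum>n<m. (cmod (of_real (s m) * cinner v (e n)))\<^sup>2)"
    by (simp only: split_Pythagoras split(2))
  also have "\<dots> \<le> (s m * norm r)\<^sup>2 + (s m)\<^sup>2 * (\<Sum>n<m. (cmod (cinner v (e n)))\<^sup>2)"
    by (intro add_mono power_mono split(3))
      (simp_all add: norm_mult power_mult_distrib sum_distrib_left s_nonneg)
  also have "\<dots> = (s m * norm v)\<^sup>2" by (simp add: power_mult_distrib split(4) algebra_simps)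
  finally show "norm ((A - Y m) v) \<le> s m * norm v" by (rule power2_le_imp_le) (simp add: s_nonneg)
qed

text \<open>The absolute value of \<open>Y m\<close> is the operator \<open>D\<close> obtained by replacing every \<open>f n\<close> by \<open>e n\<close>. The only indices at
  which the two families behave differently are those with \<open>s n = 0\<close>, and their coefficients vanish.\<close>

lemma trace_norm_Y: "trace_norm (Y m) \<le> ennreal (\<Sum>n<m. s n - s m)"
proof -
  define D where "D = (\<Sum>n<m. (s n - s m) *\<^sub>R rank_one (e n) (e n))"
  have D: "D v = (\<Sum>n<m. (of_real (s n - s m) * cinner v (e n)) *\<^sub>C e n)" for v
    by (simp only: D_def blinfun_sum_apply blinfun.scaleR_left rank_one_apply scaleR_scaleC scaleC_scaleC)
  have Dq: "Re (cinner (D v) v) = (\<Sum>n<m. (s n - s m) * (cmod (cinner v (e n)))\<^sup>2)" for v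
  proof -
    have "cinner (D v) v = (\<Sum>n<m. of_real (s n - s m) * (cinner v (e n) * cnj (cinner v (e n))))"
      unfolding D cinner.sum_left cinner_scaleC_left
      by (intro sum.cong refl) (metis cinner_commute mult.assoc)
    then show ?thesis unfolding complex_norm_square[symmetric] by simp
  qed
  have D_pos: "D \<in> positive_ops"
  proof (rule positiveI)
    show "D \<in> bounded_ops"
      unfolding D_def by (intro bounded_ops_sum bounded_ops_scaleR rank_one_bounded_ops)
    show "0 \<le> Re (cinner (D v) v)" for v
      unfolding Dq by (intro sum_nonneg mult_nonneg_nonneg s_diff_nonneg) auto
    show "cinner (D v) w = cinner v (D w)" for v w
      unfolding D cinner.sum_left cinner.sum_right cinner_scaleC_left cinner_scaleC_right
      by (intro sum.cong refl) (subst cinner_commute[of _ w], simp add: mult_ac)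
  qed
  have "abs_op (Y m) = D"
  proof (rule abs_op_eqI[OF Y_bounded_ops D_pos])
    fix v w
    have "a * cnj b * cinner (e i) (e j) = a * cnj b * cinner (f i) (f j)"
      if "i < m" "a = of_real (s i - s m) * a'" for i j a a' b
      using s_zero_mono[of i m] that by (auto simp: cinner_e cinner_f)
    then show "cinner (D v) (D w) = cinner (Y m v) (Y m w)"
      unfolding D Y_apply cinner_sum_scaleC by (intro sum.cong refl) blast
  qed
  moreover have "op_trace D \<le> ennreal (\<Sum>n<m. s n - s m)"
  proof (rule op_trace_le[OF D_pos])
    fix F :: "'a set" assume F: "finite F" "F \<subseteq> std_basis"
    have sub: "suborthonormal F id"
      using F by (intro orthonormal_imp_suborthonormal orthonormal_basis_orthonormal[OF std_basis])
    have "(\<Sum>b\<in>F. Re (cinner (D b) b)) = (\<Sum>n<m. (s n - s m) * (\<Sum>b\<in>F. (cmod (cinner (e n) b))\<^sup>2))"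
      unfolding Dq sum_distrib_left
      by (subst sum.swap) (intro sum.cong refl, metis cinner_commute complex_mod_cnj)
    also have "\<dots> \<le> (\<Sum>n<m. (s n - s m) * 1)"
      using Bessel_inequality[OF F(1) sub, of "e _"]
      by (intro sum_mono mult_left_mono s_diff_nonneg) (auto simp: norm_e)
    finally show "(\<Sum>b\<in>F. Re (cinner (D b) b)) \<le> (\<Sum>n<m. s n - s m)" by simp
  qed
  ultimately show ?thesis by (simp add: trace_norm_def)
qed

lemma Y_trace_class: "Y m \<in> trace_class"
  using Y_bounded_ops trace_norm_Y[of m] by (simp add: trace_class_def order_le_less_trans)

text \<open>Split \<open>A\<close> at the level \<open>s m\<close>. By Bessel's inequality the terms of \<open>Y m\<close> contribute at most their coefficients
  \<open>s n - s m\<close>, and each of the \<open>m\<close> summands of the rest contributes at most \<open>s m\<close>.\<close>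

lemma Ky_Fan_upper:
  assumes "suborthonormal {..<m} u" "suborthonormal {..<m} v"
  shows "cmod (\<Sum>i<m. cinner (A (u i)) (v i)) \<le> (\<Sum>n<m. s n)"
proof -
  have "(\<Sum>i<m. cinner (Y m (u i)) (v i))
      = (\<Sum>n<m. of_real (s n - s m) * (\<Sum>i<m. cinner (u i) (e n) * cinner (f n) (v i)))"
    unfolding Y_apply cinner.sum_left cinner_scaleC_left sum_distrib_left
    by (subst sum.swap) (simp add: mult.assoc)
  then have "cmod (\<Sum>i<m. cinner (Y m (u i)) (v i))
      \<le> (\<Sum>n<m. cmod (of_real (s n - s m) * (\<Sum>i<m. cinner (u i) (e n) * cinner (f n) (v i))))"
    by (simp only: norm_sum)
  also have "\<dots> \<le> (\<Sum>n<m. s n - s m)"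
  proof (rule sum_mono)
    fix n assume n: "n \<in> {..<m}"
    have "cmod (\<Sum>i<m. cinner (u i) (e n) * cinner (f n) (v i))
        \<le> (\<Sum>i<m. cmod (cinner (u i) (e n)) * cmod (cinner (f n) (v i)))"
      by (rule sum_norm_le) (simp add: norm_mult)
    also have "\<dots> = (\<Sum>i<m. cmod (cinner (e n) (u i)) * cmod (cinner (f n) (v i)))"
      by (intro sum.cong refl) (metis cinner_commute complex_mod_cnj)
    also have "\<dots> \<le> 1"
    proof (rule sum_cmod_product_le)
      show "(\<Sum>i<m. (cmod (cinner (e n) (u i)))\<^sup>2) \<le> 1"
        using Bessel_inequality[OF _ assms(1), of "e n"] by (simp add: norm_e)
      have "(norm (f n))\<^sup>2 \<le> 1" using f_suborthonormal[of UNIV] by (simp add: suborthonormal_def power_le_one)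
      then show "(\<Sum>i<m. (cmod (cinner (f n) (v i)))\<^sup>2) \<le> 1"
        using Bessel_inequality[OF _ assms(2), of "f n"] by simp
    qed
    finally have "(s n - s m) * cmod (\<Sum>i<m. cinner (u i) (e n) * cinner (f n) (v i)) \<le> (s n - s m) * 1"
      using n s_diff_nonneg by (intro mult_left_mono) auto
    then show "cmod (of_real (s n - s m) * (\<Sum>i<m. cinner (u i) (e n) * cinner (f n) (v i))) \<le> s n - s m"
      using n s_diff_nonneg[of n m] by (simp add: norm_mult del: of_real_diff)
  qed
  finally have 1: "cmod (\<Sum>i<m. cinner (Y m (u i)) (v i)) \<le> (\<Sum>n<m. s n - s m)" .
  have 2: "cmod (\<Sum>i<m. cinner ((A - Y m) (u i)) (v i)) \<le> (\<Sum>i<m. s m)"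
    using assms norm_A_minus_Y[of m] by (intro sum_norm_le norm_cinner_blinfun_le) (auto simp: suborthonormal_def)
  have "(\<Sum>i<m. cinner (A (u i)) (v i))
      = (\<Sum>i<m. cinner (Y m (u i)) (v i)) + (\<Sum>i<m. cinner ((A - Y m) (u i)) (v i))"
    by (simp add: blinfun.diff_left cinner.diff_left flip: sum.distrib)
  then have "cmod (\<Sum>i<m. cinner (A (u i)) (v i)) \<le> (\<Sum>n<m. s n - s m) + (\<Sum>i<m. s m)"
    using norm_triangle_mono[OF 1 2] by simp
  also have "\<dots> = (\<Sum>n<m. s n)" by (simp add: sum_subtractf)
  finally show ?thesis .
qed

lemma Ky_Fan_attained: "(\<Sum>i<m. cinner (A (e i)) (f i)) = of_real (\<Sum>n<m. s n)"
  unfolding of_real_sum by (intro sum.cong refl) (simp add: A_e cinner_scaleR_left cinner_f)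

lemma sum_singular_values_le_trace_norm: "ennreal (\<Sum>n<m. s n) \<le> trace_norm A"
  using sum_le_op_trace[OF abs_op_positive[OF Ab] _ orthonormal_imp_suborthonormal[OF e_orthonormal], of "{..<m}"]
  by (simp add: trace_norm_def abs_e cinner_scaleR_left cinner_e)

lemma sum_squares_singular_values_le: "HS_bound A c \<Longrightarrow> (\<Sum>n<m. (s n)\<^sup>2) \<le> c"
  using HS_bound_family[OF Ab _ _ orthonormal_imp_suborthonormal[OF e_orthonormal], of c "{..<m}"]
  by (simp add: norm_A_e)

text \<open>Expanding \<open>A b\<close> after \<open>m\<close> terms for the finitely many \<open>b \<in> F\<close> costs an error of \<open>card F * s m ^ 2\<close>, which
  tends to \<open>0\<close>.\<close>

lemma HS_boundI_singular_values:
  assumes c: "\<And>m. (\<Sum>n<m. (s n)\<^sup>2) \<le> c" shows "HS_bound A c"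
  unfolding HS_bound_def
proof (intro allI impI)
  fix F :: "'a set" assume F: "finite F" "F \<subseteq> std_basis"
  have on: "orthonormal F id" using F orthonormal_basis_orthonormal[OF std_basis] by blast
  have "(\<Sum>b\<in>F. (norm (A b))\<^sup>2) \<le> real (card F) * (s m)\<^sup>2 + c" for m
  proof -
    have "(norm (A b))\<^sup>2 \<le> (s m)\<^sup>2 + (\<Sum>n<m. (s n)\<^sup>2 * (cmod (cinner (e n) b))\<^sup>2)" if "b \<in> F" for b
    proof -
      define r where "r = b - (\<Sum>n<m. cinner b (e n) *\<^sub>C e n)"
      note split = A_split[where v = b and m = m, folded r_def]
      have "norm b = 1" using orthonormal_norm[OF on that] by simp
      then have "(norm r)\<^sup>2 \<le> 1" using split(4) by (simp add: sum_nonneg)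
      then have "norm r \<le> 1" using power2_le_imp_le[of "norm r" 1] by simp
      then have "norm (A r) \<le> s m" using split(3) s_nonneg[of m] by (meson mult_left_le order_trans)
      have "(norm (A b))\<^sup>2 \<le> (norm (A r))\<^sup>2 + (\<Sum>n<m. (cmod (of_real (s n) * cinner b (e n)))\<^sup>2)"
        unfolding split(1) by (rule split_Pythagoras) (rule split(2))
      also have "\<dots> \<le> (s m)\<^sup>2 + (\<Sum>n<m. (s n)\<^sup>2 * (cmod (cinner (e n) b))\<^sup>2)"
      proof (intro add_mono power_mono sum_mono)
        fix n show "(cmod (of_real (s n) * cinner b (e n)))\<^sup>2 \<le> (s n)\<^sup>2 * (cmod (cinner (e n) b))\<^sup>2"
          by (simp add: norm_mult power_mult_distrib) (metis cinner_commute complex_mod_cnj order_refl)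
      qed (use \<open>norm (A r) \<le> s m\<close> in auto)
      finally show ?thesis .
    qed
    then have "(\<Sum>b\<in>F. (norm (A b))\<^sup>2) \<le> (\<Sum>b\<in>F. (s m)\<^sup>2 + (\<Sum>n<m. (s n)\<^sup>2 * (cmod (cinner (e n) b))\<^sup>2))"
      by (intro sum_mono)
    also have "\<dots> = real (card F) * (s m)\<^sup>2 + (\<Sum>n<m. (s n)\<^sup>2 * (\<Sum>b\<in>F. (cmod (cinner (e n) b))\<^sup>2))"
      by (simp add: sum.distrib sum_distrib_left sum.swap[of _ F])
    also have "(\<Sum>n<m. (s n)\<^sup>2 * (\<Sum>b\<in>F. (cmod (cinner (e n) b))\<^sup>2)) \<le> (\<Sum>n<m. (s n)\<^sup>2 * 1)"
      using Bessel_inequality[OF F(1) orthonormal_imp_suborthonormal[OF on], of "e _"]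
      by (intro sum_mono mult_left_mono) (auto simp: norm_e)
    finally show ?thesis using c[of m] by simp
  qed
  moreover have "(\<lambda>m. real (card F) * (s m)\<^sup>2 + c) \<longlonglongrightarrow> real (card F) * 0\<^sup>2 + c"
    by (intro tendsto_intros s_lim)
  ultimately show "(\<Sum>b\<in>F. (norm (A b))\<^sup>2) \<le> c"
    by (metis (no_types, lifting) LIMSEQ_le_const add_0 mult_zero_right zero_power2)
qed

end

lemma compact_operator_exists:
  assumes "infinite_dimensional TYPE('a::complex_hilbert_space)" "(A :: 'a \<Rightarrow>\<^sub>L 'a) \<in> compact_ops"
  obtains e where "compact_operator A e"
  using singular_values_spectral[OF assms] assms unfolding compact_operator_def by blast

section \<open>Compactness of Hilbert-Schmidt and trace class operators\<close>

text \<open>Removing from \<open>A\<close> its action on a large finite part of the basis leaves an operator of small Hilbert-Schmidt norm, hence of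
  small norm.\<close>

lemma HS_bound_compact:
  fixes A :: "'a::complex_hilbert_space \<Rightarrow>\<^sub>L 'a"
  assumes A: "A \<in> bounded_ops" and c: "HS_bound A c"
  shows "A \<in> compact_ops"
proof (rule compact_opsI[OF A])
  fix \<epsilon> :: real assume \<epsilon>: "\<epsilon> > 0"
  define sq where "sq F = (\<Sum>b\<in>F. (norm (A b))\<^sup>2)" for F
  define \<F> where "\<F> = {F. finite F \<and> F \<subseteq> (std_basis :: 'a set)}"
  have bdd: "bdd_above (sq ` \<F>)"
    using c by (intro bdd_aboveI2[of _ _ c]) (simp add: HS_bound_def sq_def \<F>_def)
  have "{} \<in> \<F>" by (simp add: \<F>_def)
  then obtain G where G: "G \<in> \<F>" "(SUP F\<in>\<F>. sq F) - \<epsilon>\<^sup>2 < sq G"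
    using less_cSUP_iff[OF _ bdd, of "(SUP F\<in>\<F>. sq F) - \<epsilon>\<^sup>2"] \<epsilon> by auto
  define R where "R = A - (\<Sum>g\<in>G. rank_one (A g) g)"
  have finG: "finite G" using G by (simp add: \<F>_def)
  have onG: "orthonormal G id"
    using G orthonormal_basis_orthonormal[OF std_basis] by (auto simp: \<F>_def)
  have R: "R v = A v - (\<Sum>g\<in>G. cinner v g *\<^sub>C A g)" for v
    by (simp add: R_def blinfun.diff_left blinfun_sum_apply)
  have "HS_bound R (\<epsilon>\<^sup>2)"
    unfolding HS_bound_def
  proof (intro allI impI)
    fix F :: "'a set" assume F: "finite F" "F \<subseteq> std_basis"
    have on: "orthonormal (F \<union> G) id"
      using F G by (intro orthonormal_basis_orthonormal[OF std_basis]) (auto simp: \<F>_def)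
    have Rb: "R b = (if b \<in> G then 0 else A b)" if "b \<in> F" for b
    proof -
      have "(\<Sum>g\<in>G. cinner b g *\<^sub>C A g) = (\<Sum>g\<in>G. if g = b then A b else 0)"
        using on that by (intro sum.cong) (auto simp: orthonormal_def)
      then show ?thesis using finG by (simp add: R)
    qed
    have "(\<Sum>b\<in>F. (norm (R b))\<^sup>2) = sq (F - G)"
      unfolding sq_def using F(1) by (intro sum.mono_neutral_cong_right) (auto simp: Rb)
    also have "\<dots> = sq (F \<union> G) - sq G"
      using F(1) finG sum.union_disjoint[of "F - G" G "\<lambda>b. (norm (A b))\<^sup>2"]
      by (simp add: sq_def Diff_Int_distrib2 Int_commute)
    also have "sq (F \<union> G) \<le> (SUP F\<in>\<F>. sq F)"
      by (rule cSUP_upper[OF _ bdd]) (use F G in \<open>auto simp: \<F>_def\<close>)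
    finally show "(\<Sum>b\<in>F. (norm (R b))\<^sup>2) \<le> \<epsilon>\<^sup>2" using G(2) by simp
  qed
  moreover have "R \<in> bounded_ops"
    unfolding R_def by (intro bounded_ops_diff A bounded_ops_sum rank_one_bounded_ops)
  ultimately have Rn: "(norm (R v))\<^sup>2 \<le> (\<epsilon> * norm v)\<^sup>2" for v
    using HS_bound_norm_apply[of R "\<epsilon>\<^sup>2" v] by (simp add: power_mult_distrib)
  have "norm (A v) \<le> \<epsilon> * norm v" if "\<forall>g\<in>G. cinner v g = 0" for v
  proof -
    have "R v = A v" using that by (simp add: R)
    then show ?thesis using power2_le_imp_le[OF Rn[of v]] \<epsilon> by simp
  qed
  then show "\<exists>F. finite F \<and> (\<forall>v. (\<forall>f\<in>F. cinner v f = 0) \<longrightarrow> norm (A v) \<le> \<epsilon> * norm v)"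
    using finG by blast
qed

text \<open>\<open>\<parallel>A e\<parallel>\<^sup>2 = \<parallel>|A| e\<parallel>\<^sup>2\<close> is at most the norm of \<open>|A|\<close> times \<open>\<langle>|A| e, e\<rangle>\<close>.\<close>

lemma trace_class_HS_bound:
  fixes A :: "'a::complex_hilbert_space \<Rightarrow>\<^sub>L 'a"
  assumes "A \<in> trace_class" shows "\<exists>c. HS_bound A c"
proof -
  have A: "A \<in> bounded_ops" and "op_trace (abs_op A) < \<infinity>"
    using assms by (auto simp: trace_class_def trace_norm_def)
  then obtain c where c: "op_trace (abs_op A) = ennreal c" "0 \<le> c" by (cases "op_trace (abs_op A)") auto
  note P = abs_op_positive[OF A]
  have "HS_bound A (norm (abs_op A) * c)"
    unfolding HS_bound_def
  proof (intro allI impI)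
    fix F :: "'a set" assume F: "finite F" "F \<subseteq> std_basis"
    have "(\<Sum>b\<in>F. (norm (A b))\<^sup>2) \<le> (\<Sum>b\<in>F. norm (abs_op A) * Re (cinner (abs_op A b) b))"
      by (intro sum_mono) (metis P positive_norm_sq_le_norm norm_abs_op[OF A])
    also have "\<dots> = norm (abs_op A) * (\<Sum>b\<in>F. Re (cinner (abs_op A b) b))" by (simp add: sum_distrib_left)
    also have "\<dots> \<le> norm (abs_op A) * c"
      using finite_sum_le_op_trace[OF P F] c by (intro mult_left_mono) (simp_all add: ennreal_le_iff)
    finally show "(\<Sum>b\<in>F. (norm (A b))\<^sup>2) \<le> norm (abs_op A) * c" .
  qed
  then show ?thesis by blast
qed

lemma trace_class_compact: "A \<in> trace_class \<Longrightarrow> A \<in> compact_ops"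
  using trace_class_HS_bound HS_bound_compact unfolding trace_class_def by blast

section \<open>Dunford-Schwartz operators and singular values\<close>

text \<open>Summation by parts: the partial sums of \<open>c - b\<close> enter with the nonnegative weights
  \<open>a\<^sub>n - a\<^sub>n\<^sub>+\<^sub>1\<close>.\<close>

lemma Abel_partial_sums_mono:
  fixes a b c :: "nat \<Rightarrow> real"
  assumes a: "antimono a" "\<And>n. 0 \<le> a n" and le: "\<And>k. (\<Sum>n<k. b n) \<le> (\<Sum>n<k. c n)"
  shows "(\<Sum>n<k. a n * b n) \<le> (\<Sum>n<k. a n * c n)"
proof (cases k)
  case (Suc m)
  define d where "d n = c n - b n" for n
  have d: "0 \<le> (\<Sum>n<k. d n)" for k using le[of k] by (simp add: d_def sum_subtractf)
  have "a m * (\<Sum>n<Suc m. d n) \<le> (\<Sum>n<Suc m. a n * d n)" for m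
  proof (induction m)
    case (Suc m)
    have "a (Suc m) * (\<Sum>n<Suc (Suc m). d n) = a (Suc m) * (\<Sum>n<Suc m. d n) + a (Suc m) * d (Suc m)"
      by (simp add: distrib_left)
    also have "a (Suc m) * (\<Sum>n<Suc m. d n) \<le> a m * (\<Sum>n<Suc m. d n)"
      by (intro mult_right_mono d) (use a(1) in \<open>simp add: antimonoD\<close>)
    finally show ?case using Suc by simp
  qed simp
  moreover have "0 \<le> a m * (\<Sum>n<Suc m. d n)" by (intro mult_nonneg_nonneg a d)
  ultimately have "0 \<le> (\<Sum>n<k. a n * d n)" using Suc order_trans by blast
  then show ?thesis by (simp add: d_def right_diff_distrib sum_subtractf)
qed simp

lemma scaleC_op_of_real: "scaleC_op (of_real r) A = r *\<^sub>R A"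
  by (rule blinfun_eqI) (simp add: scaleC_op.rep_eq blinfun.scaleR_left scaleR_scaleC)

lemma
  assumes "dunford_schwartz T"
  shows DS_bounded_ops: "A \<in> bounded_ops \<Longrightarrow> T A \<in> bounded_ops"
    and DS_add: "A \<in> bounded_ops \<Longrightarrow> B \<in> bounded_ops \<Longrightarrow> T (A + B) = T A + T B"
    and DS_norm: "A \<in> bounded_ops \<Longrightarrow> norm (T A) \<le> norm A"
    and DS_trace_norm: "A \<in> trace_class \<Longrightarrow> trace_norm (T A) \<le> trace_norm A"
    and DS_scaleC: "A \<in> bounded_ops \<Longrightarrow> T (scaleC_op c A) = scaleC_op c (T A)"
  using assms unfolding dunford_schwartz_def by blast+

lemma DS_scaleR: "dunford_schwartz T \<Longrightarrow> A \<in> bounded_ops \<Longrightarrow> T (r *\<^sub>R A) = r *\<^sub>R T A"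
  using DS_scaleC[of T A "of_real r"] by (simp add: scaleC_op_of_real)

lemma DS_trace_class: "dunford_schwartz T \<Longrightarrow> A \<in> trace_class \<Longrightarrow> T A \<in> trace_class"
  using DS_trace_norm DS_bounded_ops unfolding trace_class_def by (fastforce intro: order_le_less_trans)

lemma DS_funpow: "dunford_schwartz T \<Longrightarrow> dunford_schwartz (T ^^ k)"
proof (induction k)
  case 0 then show ?case by (simp add: dunford_schwartz_def)
next
  case (Suc k)
  note S = Suc.IH[OF Suc.prems]
  note T = Suc.prems
  show ?case
    unfolding dunford_schwartz_def funpow.simps o_apply
    by (auto simp: DS_bounded_ops[OF S] DS_bounded_ops[OF T] DS_add[OF S] DS_add[OF T]
        DS_scaleC[OF S] DS_scaleC[OF T] intro: order_trans[OF DS_norm[OF T] DS_norm[OF S]]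
        order_trans[OF DS_trace_norm[OF T] DS_trace_norm[OF S]] DS_trace_class[OF S])
qed

context
  fixes T :: "('a::complex_hilbert_space \<Rightarrow>\<^sub>L 'a) \<Rightarrow> ('a \<Rightarrow>\<^sub>L 'a)"
  assumes inf: "infinite_dimensional TYPE('a)" and T: "dunford_schwartz T"
begin

text \<open>\<open>T A\<close> is a limit in norm of the trace class operators \<open>T (Y m)\<close>.\<close>

lemma DS_compact_ops:
  assumes A: "A \<in> compact_ops" shows "T A \<in> compact_ops"
proof -
  obtain e where "compact_operator A e" by (rule compact_operator_exists[OF inf A])
  then interpret A: compact_operator A e .
  show ?thesis
  proof (rule compact_ops_approximable)
    show "T A \<in> bounded_ops" by (rule DS_bounded_ops[OF T A.Ab])
    fix \<epsilon> :: real assume "\<epsilon> > 0"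
    then obtain m where m: "A.s m < \<epsilon>"
      using order_tendstoD(2)[OF A.s_lim] by (metis eventually_sequentially order_refl)
    have Z: "A - A.Y m \<in> bounded_ops" by (intro bounded_ops_diff A.Ab A.Y_bounded_ops)
    have "T A = T (A.Y m) + T (A - A.Y m)"
      using DS_add[OF T A.Y_bounded_ops[of m] Z] by simp
    then have "norm (T A - T (A.Y m)) \<le> norm (A - A.Y m)" using DS_norm[OF T Z] by simp
    also have "\<dots> \<le> \<epsilon>" using A.norm_A_minus_Y[of m] m by simp
    finally show "\<exists>C\<in>compact_ops. norm (T A - C) \<le> \<epsilon>"
      using trace_class_compact[OF DS_trace_class[OF T A.Y_trace_class]] by blast
  qed
qed

text \<open>Evaluate the Ky Fan sum of \<open>T A\<close> on vectors that attain it, and split \<open>A = Y + Z\<close> at the level \<open>s\<^sub>m\<close>. The part \<open>T Y\<close>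
  contributes at most \<open>\<parallel>T Y\<parallel>\<^sub>1 \<le> \<parallel>Y\<parallel>\<^sub>1\<close>, and \<open>T Z\<close> at most \<open>m \<parallel>Z\<parallel>\<^sub>\<infinity> \<le> m s\<^sub>m\<close>; together this is
  the sum for \<open>A\<close>.\<close>

lemma DS_singular_values_submajorized:
  assumes A: "A \<in> compact_ops"
  shows "(\<Sum>n<m. singular_values (T A) n) \<le> (\<Sum>n<m. singular_values A n)"
proof -
  obtain e where "compact_operator A e" by (rule compact_operator_exists[OF inf A])
  then interpret A: compact_operator A e .
  obtain e' where "compact_operator (T A) e'"
    by (rule compact_operator_exists[OF inf DS_compact_ops[OF A]])
  then interpret B: compact_operator "T A" e' .
  have TY: "T (A.Y m) \<in> trace_class" by (rule DS_trace_class[OF T A.Y_trace_class])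
  obtain g where "compact_operator (T (A.Y m)) g"
    by (rule compact_operator_exists[OF inf trace_class_compact[OF TY]])
  then interpret Y: compact_operator "T (A.Y m)" g .
  have Z: "A - A.Y m \<in> bounded_ops" by (intro bounded_ops_diff A.Ab A.Y_bounded_ops)
  note e' = orthonormal_imp_suborthonormal[OF B.e_orthonormal]
  have "ennreal (\<Sum>n<m. Y.s n) \<le> trace_norm (A.Y m)"
    using Y.sum_singular_values_le_trace_norm DS_trace_norm[OF T A.Y_trace_class] order_trans by blast
  also have "\<dots> \<le> ennreal (\<Sum>n<m. A.s n - A.s m)" by (rule A.trace_norm_Y)
  finally have Ys: "(\<Sum>n<m. Y.s n) \<le> (\<Sum>n<m. A.s n - A.s m)"
    by (subst (asm) ennreal_le_iff) (auto intro: sum_nonneg A.s_diff_nonneg)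
  have 1: "cmod (\<Sum>i<m. cinner (T (A.Y m) (e' i)) (B.f i)) \<le> (\<Sum>n<m. A.s n - A.s m)"
    by (rule order_trans[OF Y.Ky_Fan_upper[OF e' B.f_suborthonormal] Ys])
  have 2: "cmod (\<Sum>i<m. cinner (T (A - A.Y m) (e' i)) (B.f i)) \<le> (\<Sum>i<m. A.s m)"
    using B.f_suborthonormal order_trans[OF DS_norm[OF T Z] A.norm_A_minus_Y]
    by (intro sum_norm_le norm_cinner_blinfun_le) (auto simp: suborthonormal_def B.norm_e)
  have "T A = T (A.Y m) + T (A - A.Y m)" using DS_add[OF T A.Y_bounded_ops[of m] Z] by simp
  then have "complex_of_real (\<Sum>n<m. B.s n)
      = (\<Sum>i<m. cinner (T (A.Y m) (e' i)) (B.f i)) + (\<Sum>i<m. cinner (T (A - A.Y m) (e' i)) (B.f i))"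
    unfolding B.Ky_Fan_attained[symmetric]
    by (simp add: blinfun.add_left cinner_add_left flip: sum.distrib)
  then have "cmod (complex_of_real (\<Sum>n<m. B.s n)) \<le> (\<Sum>n<m. A.s n - A.s m) + (\<Sum>i<m. A.s m)"
    using norm_triangle_mono[OF 1 2] by metis
  also have "\<dots> = (\<Sum>n<m. A.s n)" by (simp add: sum_subtractf)
  also have "cmod (complex_of_real (\<Sum>n<m. B.s n)) = (\<Sum>n<m. B.s n)"
    by (simp add: sum_nonneg B.s_nonneg del: of_real_sum)
  finally show ?thesis .
qed

text \<open>Two summations by parts give \<open>\<Sum> s\<^sub>n(T A)\<^sup>2 \<le> \<Sum> s\<^sub>n(T A) s\<^sub>n(A) \<le> \<Sum> s\<^sub>n(A)\<^sup>2\<close>.\<close>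

lemma DS_HS_bound:
  assumes "A \<in> bounded_ops" and c: "HS_bound A c" shows "HS_bound (T A) c"
proof -
  have A: "A \<in> compact_ops" using HS_bound_compact assms by blast
  obtain e where "compact_operator A e" by (rule compact_operator_exists[OF inf A])
  then interpret A: compact_operator A e .
  obtain e' where "compact_operator (T A) e'"
    by (rule compact_operator_exists[OF inf DS_compact_ops[OF A]])
  then interpret B: compact_operator "T A" e' .
  show ?thesis
  proof (rule B.HS_boundI_singular_values)
    fix m
    have "(\<Sum>n<m. B.s n * B.s n) \<le> (\<Sum>n<m. B.s n * A.s n)"
      by (rule Abel_partial_sums_mono) (use B.s_dec B.s_nonneg DS_singular_values_submajorized[OF A] in auto)
    also have "\<dots> = (\<Sum>n<m. A.s n * B.s n)" by (simp add: mult.commute)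
    also have "\<dots> \<le> (\<Sum>n<m. A.s n * A.s n)"
      by (rule Abel_partial_sums_mono) (use A.s_dec A.s_nonneg DS_singular_values_submajorized[OF A] in auto)
    also have "\<dots> \<le> c" using A.sum_squares_singular_values_le[OF c] by (simp add: power2_eq_square)
    finally show "(\<Sum>n<m. (B.s n)\<^sup>2) \<le> c" by (simp add: power2_eq_square)
  qed
qed

end

section \<open>The Hilbert-Schmidt norm\<close>

definition HS_ops :: "('a::complex_hilbert_space \<Rightarrow>\<^sub>L 'a) set" where
  "HS_ops = {A \<in> bounded_ops. \<exists>c. HS_bound A c}"

definition HS_norm :: "('a::complex_hilbert_space \<Rightarrow>\<^sub>L 'a) \<Rightarrow> real" where
  "HS_norm A = sqrt (\<Sum>\<^sub>\<infinity>e\<in>std_basis. (norm (A e))\<^sup>2)"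

lemma HS_summable: "A \<in> HS_ops \<Longrightarrow> (\<lambda>e. (norm (A e))\<^sup>2) summable_on std_basis"
  unfolding HS_ops_def
  by (auto intro!: nonneg_bdd_above_summable_on bdd_aboveI2 simp: HS_bound_def)

lemma HS_norm_sq: "(HS_norm A)\<^sup>2 = (\<Sum>\<^sub>\<infinity>e\<in>std_basis. (norm (A e))\<^sup>2)"
  by (simp add: HS_norm_def infsum_nonneg)

lemma HS_norm_nonneg: "0 \<le> HS_norm A"
  by (simp add: HS_norm_def infsum_nonneg)

lemma HS_bound_HS_norm: "A \<in> HS_ops \<Longrightarrow> HS_bound A ((HS_norm A)\<^sup>2)"
  unfolding HS_bound_def HS_norm_sq by (auto intro!: finite_sum_le_infsum HS_summable)

lemma HS_norm_le:
  assumes A: "A \<in> HS_ops" and "HS_bound A (c\<^sup>2)" "0 \<le> c" shows "HS_norm A \<le> c"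
proof (rule power2_le_imp_le)
  show "(HS_norm A)\<^sup>2 \<le> c\<^sup>2"
    unfolding HS_norm_sq
    by (rule infsum_le_finite_sums[OF HS_summable[OF A]]) (use assms in \<open>auto simp: HS_bound_def\<close>)
qed fact

lemma norm_le_HS_norm:
  assumes A: "A \<in> HS_ops" shows "norm A \<le> HS_norm A"
proof (rule norm_blinfun_bound[OF HS_norm_nonneg])
  fix v
  have "A \<in> bounded_ops" using A by (simp add: HS_ops_def)
  then have "(norm (A v))\<^sup>2 \<le> (HS_norm A * norm v)\<^sup>2"
    using HS_bound_norm_apply[OF _ HS_bound_HS_norm[OF A], of v] by (simp add: power_mult_distrib)
  then show "norm (A v) \<le> HS_norm A * norm v" by (rule power2_le_imp_le) (simp add: HS_norm_nonneg)
qed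

lemma HS_bound_add:
  assumes A: "A \<in> HS_ops" and B: "B \<in> HS_ops"
  shows "HS_bound (A + B) ((HS_norm A + HS_norm B)\<^sup>2)"
  unfolding HS_bound_def
proof (intro allI impI)
  fix F :: "'a set" assume F: "finite F" "F \<subseteq> std_basis"
  have le: "L2_set (\<lambda>e. norm (C e)) F \<le> HS_norm C" if "C \<in> HS_ops" for C :: "'a \<Rightarrow>\<^sub>L 'a"
    unfolding L2_set_def
    using HS_bound_HS_norm[OF that] F by (intro real_le_lsqrt sum_nonneg HS_norm_nonneg) (auto simp: HS_bound_def)
  have "L2_set (\<lambda>e. norm ((A + B) e)) F \<le> L2_set (\<lambda>e. norm (A e) + norm (B e)) F"
    by (rule L2_set_mono) (auto simp: blinfun.add_left norm_triangle_ineq)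
  also have "\<dots> \<le> HS_norm A + HS_norm B"
    using L2_set_triangle_ineq[of "\<lambda>e. norm (A e)" "\<lambda>e. norm (B e)" F] le[OF A] le[OF B] by linarith
  finally have "(L2_set (\<lambda>e. norm ((A + B) e)) F)\<^sup>2 \<le> (HS_norm A + HS_norm B)\<^sup>2"
    by (rule power_mono) (rule L2_set_nonneg)
  then show "(\<Sum>e\<in>F. (norm ((A + B) e))\<^sup>2) \<le> (HS_norm A + HS_norm B)\<^sup>2"
    by (simp add: L2_set_def sum_nonneg)
qed

lemma HS_ops_add: "A \<in> HS_ops \<Longrightarrow> B \<in> HS_ops \<Longrightarrow> A + B \<in> HS_ops"
  using HS_bound_add[of A B] by (auto simp: HS_ops_def bounded_ops_add)

lemma HS_norm_triangle: "A \<in> HS_ops \<Longrightarrow> B \<in> HS_ops \<Longrightarrow> HS_norm (A + B) \<le> HS_norm A + HS_norm B"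
  by (intro HS_norm_le HS_ops_add HS_bound_add add_nonneg_nonneg HS_norm_nonneg)

lemma HS_ops_scaleR: "A \<in> HS_ops \<Longrightarrow> r *\<^sub>R A \<in> HS_ops"
proof -
  assume A: "A \<in> HS_ops"
  then obtain c where c: "HS_bound A c" by (auto simp: HS_ops_def)
  have "HS_bound (r *\<^sub>R A) (r\<^sup>2 * c)"
    unfolding HS_bound_def
  proof (intro allI impI)
    fix F :: "'a set" assume "finite F" "F \<subseteq> std_basis"
    then have "r\<^sup>2 * (\<Sum>e\<in>F. (norm (A e))\<^sup>2) \<le> r\<^sup>2 * c"
      using c by (intro mult_left_mono) (auto simp: HS_bound_def)
    then show "(\<Sum>e\<in>F. (norm ((r *\<^sub>R A) e))\<^sup>2) \<le> r\<^sup>2 * c"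
      by (simp add: blinfun.scaleR_left power_mult_distrib sum_distrib_left)
  qed
  then show ?thesis using A by (auto simp: HS_ops_def bounded_ops_scaleR)
qed

lemma HS_norm_scaleR: "A \<in> HS_ops \<Longrightarrow> HS_norm (r *\<^sub>R A) = \<bar>r\<bar> * HS_norm A"
  by (simp add: HS_norm_def blinfun.scaleR_left power_mult_distrib infsum_cmult_right' real_sqrt_mult)

lemma HS_ops_diff: "A \<in> HS_ops \<Longrightarrow> B \<in> HS_ops \<Longrightarrow> A - B \<in> HS_ops"
  using HS_ops_add[of A "(-1) *\<^sub>R B"] HS_ops_scaleR[of B "-1"] by simp

lemma HS_norm_parallelogram:
  assumes A: "A \<in> HS_ops" and B: "B \<in> HS_ops"
  shows "(HS_norm (A + B))\<^sup>2 + (HS_norm (A - B))\<^sup>2 = 2 * (HS_norm A)\<^sup>2 + 2 * (HS_norm B)\<^sup>2"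
proof -
  have "(HS_norm (A + B))\<^sup>2 + (HS_norm (A - B))\<^sup>2
      = (\<Sum>\<^sub>\<infinity>e\<in>std_basis. (norm ((A + B) e))\<^sup>2 + (norm ((A - B) e))\<^sup>2)"
    unfolding HS_norm_sq using HS_summable HS_ops_add[OF A B] HS_ops_diff[OF A B]
    by (intro infsum_add[symmetric]) auto
  also have "\<dots> = (\<Sum>\<^sub>\<infinity>e\<in>std_basis. 2 * (norm (A e))\<^sup>2 + 2 * (norm (B e))\<^sup>2)"
    by (simp add: blinfun.add_left blinfun.diff_left parallelogram)
  also have "\<dots> = 2 * (HS_norm A)\<^sup>2 + 2 * (HS_norm B)\<^sup>2"
    unfolding HS_norm_sq using HS_summable[OF A] HS_summable[OF B]
    by (simp add: infsum_add summable_on_cmult_right infsum_cmult_right')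
  finally show ?thesis .
qed

section \<open>A mean ergodic theorem\<close>

text \<open>A contraction of a space whose seminorm comes from a semi-inner product, expressed by the parallelogram law. It is relativized
  to a subspace \<open>S\<close> of the type because the Hilbert-Schmidt operators are only a subspace of the bounded ones.\<close>

locale seminorm_contraction =
  fixes S :: "'v::real_vector set" and q :: "'v \<Rightarrow> real" and T :: "'v \<Rightarrow> 'v"
  assumes subspace: "subspace S"
    and q_nonneg: "0 \<le> q x"
    and q_triangle: "x \<in> S \<Longrightarrow> y \<in> S \<Longrightarrow> q (x + y) \<le> q x + q y"
    and q_scaleR: "x \<in> S \<Longrightarrow> q (r *\<^sub>R x) = \<bar>r\<bar> * q x"
    and q_parallelogram: "x \<in> S \<Longrightarrow> y \<in> S \<Longrightarrow> (q (x + y))\<^sup>2 + (q (x - y))\<^sup>2 = 2 * (q x)\<^sup>2 + 2 * (q y)\<^sup>2"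
    and T_S: "x \<in> S \<Longrightarrow> T x \<in> S"
    and T_add: "x \<in> S \<Longrightarrow> y \<in> S \<Longrightarrow> T (x + y) = T x + T y"
    and T_scaleR: "x \<in> S \<Longrightarrow> T (r *\<^sub>R x) = r *\<^sub>R T x"
    and q_T: "x \<in> S \<Longrightarrow> q (T x) \<le> q x"
begin

definition avg :: "nat \<Rightarrow> 'v \<Rightarrow> 'v" where
  "avg n x = (1 / (real n + 1)) *\<^sub>R (\<Sum>k=0..n. (T ^^ k) x)"

lemma pow_S: "x \<in> S \<Longrightarrow> (T ^^ k) x \<in> S"
  by (induction k) (simp_all add: T_S)

lemma pow_add: "x \<in> S \<Longrightarrow> y \<in> S \<Longrightarrow> (T ^^ k) (x + y) = (T ^^ k) x + (T ^^ k) y"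
  by (induction k) (simp_all add: T_add pow_S)

lemma pow_scaleR: "x \<in> S \<Longrightarrow> (T ^^ k) (r *\<^sub>R x) = r *\<^sub>R (T ^^ k) x"
  by (induction k) (simp_all add: T_scaleR pow_S)

lemma q_pow: "x \<in> S \<Longrightarrow> q ((T ^^ k) x) \<le> q x"
  by (induction k) (auto intro: order_trans[OF q_T] pow_S)

lemma avg_S: "x \<in> S \<Longrightarrow> avg n x \<in> S"
  unfolding avg_def by (intro subspace_scale[OF subspace] subspace_sum[OF subspace] pow_S)

lemma avg_add: "x \<in> S \<Longrightarrow> y \<in> S \<Longrightarrow> avg n (x + y) = avg n x + avg n y"
  by (simp add: avg_def pow_add sum.distrib scaleR_add_right)

lemma avg_scaleR: "x \<in> S \<Longrightarrow> avg n (r *\<^sub>R x) = r *\<^sub>R avg n x"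
  by (simp add: avg_def pow_scaleR scaleR_sum_right mult.commute)

lemma q_sum: "finite I \<Longrightarrow> (\<And>i. i \<in> I \<Longrightarrow> x i \<in> S) \<Longrightarrow> q (\<Sum>i\<in>I. x i) \<le> (\<Sum>i\<in>I. q (x i))"
proof (induction I rule: finite_induct)
  case empty
  have "q (0 *\<^sub>R 0) = \<bar>0\<bar> * q 0" using subspace_0[OF subspace] by (rule q_scaleR)
  then show ?case by simp
next
  case (insert i I)
  have "q (x i + (\<Sum>i\<in>I. x i)) \<le> q (x i) + q (\<Sum>i\<in>I. x i)"
    using insert.prems by (intro q_triangle subspace_sum[OF subspace]) auto
  then show ?case using insert by fastforce
qed

lemma q_avg: "x \<in> S \<Longrightarrow> q (avg n x) \<le> q x"
proof -
  assume x: "x \<in> S"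
  have "q (avg n x) = (1 / (real n + 1)) * q (\<Sum>k=0..n. (T ^^ k) x)"
    unfolding avg_def using x by (subst q_scaleR) (auto intro: subspace_sum[OF subspace] pow_S)
  also have "\<dots> \<le> (1 / (real n + 1)) * (\<Sum>k=0..n. q x)"
    using x by (intro mult_left_mono order_trans[OF q_sum sum_mono] pow_S q_pow) auto
  also have "\<dots> = q x" by (simp add: field_simps)
  finally show ?thesis .
qed

lemma diff_S: "x \<in> S \<Longrightarrow> y \<in> S \<Longrightarrow> x - y \<in> S"
  by (rule subspace_diff[OF subspace])

lemma q_diff: "x \<in> S \<Longrightarrow> y \<in> S \<Longrightarrow> q (x - y) \<le> q x + q y"
  using q_triangle[of x "(-1) *\<^sub>R y"] q_scaleR[of y "-1"] subspace_scale[OF subspace, of y "-1"] by simp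

lemma avg_diff: "x \<in> S \<Longrightarrow> y \<in> S \<Longrightarrow> avg n (x - y) = avg n x - avg n y"
  using avg_add[of "x - y" y n] diff_S[of x y] by simp

text \<open>The vectors whose averages tend to \<open>0\<close>. In the classical theorem this is the closure of the range of \<open>1 - T\<close>, onto
  whose complement the averages project.\<close>

definition vanishing :: "'v set" where
  "vanishing = {d \<in> S. (\<lambda>n. q (avg n d)) \<longlonglongrightarrow> 0}"

lemma vanishing_add: "d \<in> vanishing \<Longrightarrow> d' \<in> vanishing \<Longrightarrow> d + d' \<in> vanishing"
proof -
  assume d: "d \<in> vanishing" "d' \<in> vanishing"
  then have S: "d \<in> S" "d' \<in> S" by (auto simp: vanishing_def)
  have "(\<lambda>n. q (avg n d) + q (avg n d')) \<longlonglongrightarrow> 0 + 0"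
    using d by (intro tendsto_add) (auto simp: vanishing_def)
  then have "(\<lambda>n. q (avg n d) + q (avg n d')) \<longlonglongrightarrow> 0" by simp
  then have "(\<lambda>n. q (avg n (d + d'))) \<longlonglongrightarrow> 0"
    by (rule tendsto_sandwich[OF always_eventually always_eventually tendsto_const, rotated 2])
      (use S in \<open>auto simp: q_nonneg avg_add intro: q_triangle avg_S\<close>)
  then show ?thesis using subspace_add[OF subspace S] by (simp add: vanishing_def)
qed

lemma vanishing_scaleR: "d \<in> vanishing \<Longrightarrow> r *\<^sub>R d \<in> vanishing"
  using tendsto_mult[OF tendsto_const, of "\<lambda>n. q (avg n d)" 0 sequentially "\<bar>r\<bar>"]
  by (simp add: vanishing_def avg_scaleR q_scaleR avg_S subspace_scale[OF subspace])

lemma vanishing_0: "0 \<in> vanishing"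
proof -
  have S0: "0 \<in> S" by (rule subspace_0[OF subspace])
  have "q (avg n 0) = 0" for n
  proof -
    have "q (avg n (0 *\<^sub>R 0)) = \<bar>0\<bar> * q (avg n 0)" unfolding avg_scaleR[OF S0] by (rule q_scaleR[OF avg_S[OF S0]])
    then show ?thesis by simp
  qed
  then show ?thesis using S0 by (simp add: vanishing_def)
qed

lemma vanishing_sum: "(\<And>i. i \<in> I \<Longrightarrow> d i \<in> vanishing) \<Longrightarrow> (\<Sum>i\<in>I. d i) \<in> vanishing"
  by (induction I rule: infinite_finite_induct) (auto intro: vanishing_add vanishing_0)

lemma vanishing_coboundary: "x \<in> S \<Longrightarrow> x - T x \<in> vanishing"
proof -
  assume x: "x \<in> S"
  have avg: "avg n (x - T x) = (1 / (real n + 1)) *\<^sub>R (x - (T ^^ Suc n) x)" for n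
  proof -
    have "avg n (x - T x) = (1 / (real n + 1)) *\<^sub>R (\<Sum>k=0..n. (T ^^ k) x - (T ^^ Suc k) x)"
      unfolding avg_diff[OF x T_S[OF x]] unfolding avg_def
      by (simp only: scaleR_right_diff_distrib sum_subtractf funpow_Suc_right o_apply)
    also have "(\<Sum>k=0..n. (T ^^ k) x - (T ^^ Suc k) x) = x - (T ^^ Suc n) x"
      using sum_telescope[of "\<lambda>k. (T ^^ k) x" n] by (simp add: atLeast0AtMost)
    finally show ?thesis .
  qed
  have bound: "q (avg n (x - T x)) \<le> (1 / (real n + 1)) * (q x + q x)" for n
  proof -
    have "q (avg n (x - T x)) = (1 / (real n + 1)) * q (x - (T ^^ Suc n) x)"
      unfolding avg by (subst q_scaleR) (auto intro: diff_S x pow_S simp del: funpow.simps)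
    moreover have "q (x - (T ^^ Suc n) x) \<le> q x + q x"
      using q_diff[OF x pow_S[OF x], of "Suc n"] q_pow[OF x, of "Suc n"] by linarith
    ultimately show ?thesis by (simp only:) (rule mult_left_mono, simp_all)
  qed
  have "(\<lambda>n. (1 / (real n + 1)) * (q x + q x)) \<longlonglongrightarrow> 0 * (q x + q x)"
    using LIMSEQ_Suc[OF lim_1_over_n] by (intro tendsto_mult tendsto_const) (simp add: add.commute)
  then have "(\<lambda>n. (1 / (real n + 1)) * (q x + q x)) \<longlonglongrightarrow> 0" by simp
  then have "(\<lambda>n. q (avg n (x - T x))) \<longlonglongrightarrow> 0"
    by (rule tendsto_sandwich[OF always_eventually always_eventually tendsto_const, rotated 2])
      (use q_nonneg bound in auto)
  then show ?thesis using diff_S[OF x T_S[OF x]] by (simp add: vanishing_def)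
qed

lemma vanishing_avg: "x \<in> S \<Longrightarrow> x - avg n x \<in> vanishing"
proof -
  assume x: "x \<in> S"
  have pow: "x - (T ^^ k) x \<in> vanishing" for k
  proof (induction k)
    case (Suc k)
    have "x - (T ^^ Suc k) x = (x - (T ^^ k) x) + ((T ^^ k) x - T ((T ^^ k) x))" by simp
    then show ?case using vanishing_add[OF Suc vanishing_coboundary[OF pow_S[OF x]]] by metis
  qed (simp add: vanishing_0)
  have "x - avg n x = (1 / (real n + 1)) *\<^sub>R (\<Sum>k=0..n. x - (T ^^ k) x)"
    by (simp add: avg_def sum_subtractf scaleR_right_diff_distrib sum_constant_scaleR add.commute)
  then show ?thesis using vanishing_scaleR[OF vanishing_sum[of "{0..n}", OF pow]] by simp
qed

text \<open>Let \<open>m\<close> be the distance of \<open>x\<close> from the vanishing vectors. If \<open>d\<close> is a vanishing vector with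
  \<open>q (x - d) < m + \<delta>\<close>, then eventually \<open>q (avg n x) \<le> q (x - d) + q (avg n d) \<le> m + 2 \<delta>\<close>. On the other hand, \<open>x\<close> minus the
  midpoint of two averages is vanishing, so the midpoint has seminorm at least \<open>m\<close>. By the parallelogram law two
  vectors of seminorm about \<open>m\<close> whose midpoint is no shorter are close to each other.\<close>

theorem mean_ergodic_Cauchy:
  assumes x: "x \<in> S" and "\<epsilon> > 0"
  shows "\<exists>N. \<forall>n\<ge>N. \<forall>k\<ge>N. q (avg n x - avg k x) < \<epsilon>"
proof -
  define m where "m = (INF d\<in>vanishing. q (x - d))"
  have bdd: "bdd_below ((\<lambda>d. q (x - d)) ` vanishing)" by (auto intro!: bdd_belowI[of _ 0] q_nonneg)
  have m_le: "m \<le> q (x - d)" if "d \<in> vanishing" for d unfolding m_def by (rule cINF_lower[OF bdd that])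
  have ne: "vanishing \<noteq> {}" using vanishing_0 by blast
  have m0: "0 \<le> m" unfolding m_def by (rule cINF_greatest[OF ne q_nonneg])
  \<comment> \<open>Small enough for the final bound \<open>4 * (m + 2 * \<delta>)\<^sup>2 - (2 * m)\<^sup>2 = 16 * \<delta> * (m + \<delta>)\<close>.\<close>
  define \<delta> where "\<delta> = min 1 (\<epsilon>\<^sup>2 / (16 * (m + 1) + 1))"
  have \<delta>: "0 < \<delta>" "\<delta> \<le> 1" using \<open>\<epsilon> > 0\<close> m0 by (auto simp: \<delta>_def)
  have "\<delta> * (16 * (m + 1) + 1) \<le> \<epsilon>\<^sup>2"
    using m0 by (simp add: pos_le_divide_eq[symmetric] \<delta>_def)
  then have small: "16 * \<delta> * (m + \<delta>) < \<epsilon>\<^sup>2"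
  proof -
    have "\<delta> * (16 * (m + 1) + 1) = 16 * (\<delta> * m) + 17 * \<delta>" "16 * \<delta> * (m + \<delta>) = 16 * (\<delta> * m) + 16 * (\<delta> * \<delta>)"
      by (simp_all add: algebra_simps)
    moreover have "\<delta> * \<delta> \<le> \<delta>" using \<delta> by (simp add: mult_left_le)
    ultimately show ?thesis using \<open>\<delta> * (16 * (m + 1) + 1) \<le> \<epsilon>\<^sup>2\<close> \<delta>(1) by linarith
  qed
  obtain d where d: "d \<in> vanishing" "q (x - d) < m + \<delta>"
    using cINF_less_iff[OF ne bdd, of "m + \<delta>"] \<delta> by (auto simp flip: m_def)
  then have dS: "d \<in> S" and lim: "(\<lambda>n. q (avg n d)) \<longlonglongrightarrow> 0" by (auto simp: vanishing_def)
  obtain N where N: "\<And>n. n \<ge> N \<Longrightarrow> q (avg n d) < \<delta>"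
    using order_tendstoD(2)[OF lim \<delta>(1)] unfolding eventually_sequentially by blast
  have upper: "q (avg n x) \<le> m + 2 * \<delta>" if "n \<ge> N" for n
  proof -
    have "avg n x = avg n (x - d) + avg n d" using avg_diff[OF x dS] by simp
    then have "q (avg n x) \<le> q (avg n (x - d)) + q (avg n d)"
      using q_triangle[OF avg_S[OF diff_S[OF x dS]] avg_S[OF dS]] by metis
    then show ?thesis using q_avg[OF diff_S[OF x dS], of n] d(2) N[OF that] by linarith
  qed
  have lower: "2 * m \<le> q (avg n x + avg k x)" for n k
  proof -
    have "(1/2) *\<^sub>R ((x - avg n x) + (x - avg k x)) \<in> vanishing"
      by (intro vanishing_scaleR vanishing_add vanishing_avg x)
    from m_le[OF this] have "m \<le> q (x - (1/2) *\<^sub>R ((x - avg n x) + (x - avg k x)))" .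
    also have "x - (1/2) *\<^sub>R ((x - avg n x) + (x - avg k x)) = (1/2) *\<^sub>R (avg n x + avg k x)"
      by (simp add: algebra_simps flip: scaleR_add_left)
    also have "q \<dots> = (1/2) * q (avg n x + avg k x)"
      using subspace_add[OF subspace avg_S[OF x] avg_S[OF x]] by (simp add: q_scaleR)
    finally show ?thesis by simp
  qed
  have "q (avg n x - avg k x) < \<epsilon>" if "n \<ge> N" "k \<ge> N" for n k
  proof -
    have "(q (avg n x - avg k x))\<^sup>2 = 2 * (q (avg n x))\<^sup>2 + 2 * (q (avg k x))\<^sup>2 - (q (avg n x + avg k x))\<^sup>2"
      using q_parallelogram[OF avg_S[OF x] avg_S[OF x], of n k] by simp
    also have "\<dots> \<le> 2 * (m + 2 * \<delta>)\<^sup>2 + 2 * (m + 2 * \<delta>)\<^sup>2 - (2 * m)\<^sup>2"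
      using upper that lower m0
      by (intro diff_mono add_mono mult_left_mono power_mono q_nonneg) auto
    also have "\<dots> = 16 * \<delta> * (m + \<delta>)" by (simp add: power2_eq_square algebra_simps)
    also note small
    finally show ?thesis using \<open>\<epsilon> > 0\<close> by (simp add: power2_less_imp_less)
  qed
  then show ?thesis by blast
qed

end

section \<open>Averages of a compact operator\<close>

context
  fixes T :: "('a::complex_hilbert_space \<Rightarrow>\<^sub>L 'a) \<Rightarrow> ('a \<Rightarrow>\<^sub>L 'a)"
  assumes inf: "infinite_dimensional TYPE('a)" and T: "dunford_schwartz T"
begin

lemma DS_HS_contraction: "seminorm_contraction HS_ops HS_norm T"
proof
  have "HS_bound (0 :: 'a \<Rightarrow>\<^sub>L 'a) 0" by (simp add: HS_bound_def)
  then have "(0 :: 'a \<Rightarrow>\<^sub>L 'a) \<in> HS_ops" unfolding HS_ops_def using bounded_ops_0 by blast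
  then show "subspace (HS_ops :: ('a \<Rightarrow>\<^sub>L 'a) set)"
    unfolding subspace_def by (intro conjI allI ballI HS_ops_add HS_ops_scaleR)
next
  fix A :: "'a \<Rightarrow>\<^sub>L 'a" assume A: "A \<in> HS_ops"
  then have Ab: "A \<in> bounded_ops" and c: "HS_bound A ((HS_norm A)\<^sup>2)"
    by (auto simp: HS_ops_def HS_bound_HS_norm[OF A])
  have TA: "HS_bound (T A) ((HS_norm A)\<^sup>2)" by (rule DS_HS_bound[OF inf T Ab c])
  then show TS: "T A \<in> HS_ops" using DS_bounded_ops[OF T Ab] by (auto simp: HS_ops_def)
  show "HS_norm (T A) \<le> HS_norm A" by (rule HS_norm_le[OF TS TA HS_norm_nonneg])
  show "T (r *\<^sub>R A) = r *\<^sub>R T A" for r by (rule DS_scaleR[OF T Ab])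
next
  fix A B :: "'a \<Rightarrow>\<^sub>L 'a" assume "A \<in> HS_ops" "B \<in> HS_ops"
  then show "T (A + B) = T A + T B" by (intro DS_add[OF T]) (simp_all add: HS_ops_def)
qed (auto intro: HS_norm_nonneg HS_norm_triangle HS_norm_scaleR HS_norm_parallelogram)

lemma ergodic_average_add:
  "A \<in> bounded_ops \<Longrightarrow> B \<in> bounded_ops \<Longrightarrow>
    ergodic_average n T (A + B) = ergodic_average n T A + ergodic_average n T B"
  by (simp add: ergodic_average_def DS_add[OF DS_funpow[OF T]] sum.distrib scaleR_add_right)

lemma norm_ergodic_average_le:
  assumes A: "A \<in> bounded_ops" shows "norm (ergodic_average n T A) \<le> norm A"
proof -
  have "norm (\<Sum>k=0..n. (T ^^ k) A) \<le> (\<Sum>k=0..n. norm A)"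
    by (rule sum_norm_le) (rule DS_norm[OF DS_funpow[OF T] A])
  then show ?thesis by (simp add: ergodic_average_def field_simps)
qed

lemma ergodic_average_compact:
  "A \<in> compact_ops \<Longrightarrow> ergodic_average n T A \<in> compact_ops"
  unfolding ergodic_average_def
  by (intro compact_ops_scaleR compact_ops_sum DS_compact_ops[OF inf DS_funpow[OF T]])

text \<open>\<open>A\<close> is within \<open>\<epsilon> / 3\<close> in norm of a trace class operator, for which the mean ergodic theorem applies, and averaging
  does not increase the norm.\<close>

lemma Cauchy_ergodic_average:
  assumes A: "A \<in> compact_ops" shows "Cauchy (\<lambda>n. ergodic_average n T A)"
proof (rule CauchyI)
  fix \<epsilon> :: real assume \<epsilon>: "\<epsilon> > 0"
  obtain e where "compact_operator A e" by (rule compact_operator_exists[OF inf A])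
  then interpret A: compact_operator A e .
  interpret HS: seminorm_contraction HS_ops HS_norm T by (rule DS_HS_contraction)
  obtain m where m: "A.s m < \<epsilon> / 3"
    using order_tendstoD(2)[OF A.s_lim, of "\<epsilon> / 3"] \<epsilon> by (auto simp: eventually_sequentially)
  define Y Z where "Y = A.Y m" and "Z = A - A.Y m"
  have Yb: "Y \<in> bounded_ops" and Zb: "Z \<in> bounded_ops" and Zn: "norm Z < \<epsilon> / 3" and AYZ: "A = Y + Z"
    using A.norm_A_minus_Y[of m] m
    by (auto simp: Y_def Z_def intro: A.Y_bounded_ops bounded_ops_diff A.Ab)
  have Y: "Y \<in> HS_ops"
    using trace_class_HS_bound[OF A.Y_trace_class] Yb by (simp add: Y_def HS_ops_def)
  obtain N where N: "\<And>n k. n \<ge> N \<Longrightarrow> k \<ge> N \<Longrightarrow> HS_norm (HS.avg n Y - HS.avg k Y) < \<epsilon> / 3"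
    using HS.mean_ergodic_Cauchy[OF Y, of "\<epsilon> / 3"] \<epsilon> by auto
  have avg: "HS.avg n Y = ergodic_average n T Y" for n by (simp add: HS.avg_def ergodic_average_def)
  have "norm (ergodic_average n T A - ergodic_average k T A) < \<epsilon>" if "n \<ge> N" "k \<ge> N" for n k
  proof -
    have "norm (ergodic_average n T Y - ergodic_average k T Y) < \<epsilon> / 3"
      using norm_le_HS_norm[OF HS.diff_S[OF HS.avg_S[OF Y] HS.avg_S[OF Y]], of n k] N[OF that] by (simp add: avg)
    moreover have "norm (ergodic_average n T Z) < \<epsilon> / 3" "norm (ergodic_average k T Z) < \<epsilon> / 3"
      using norm_ergodic_average_le[OF Zb] Zn by (meson order_le_less_trans)+
    moreover have split: "ergodic_average n T A - ergodic_average k T A =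
        (ergodic_average n T Y - ergodic_average k T Y) + (ergodic_average n T Z - ergodic_average k T Z)"
      by (simp add: AYZ ergodic_average_add Yb Zb)
    moreover note norm_triangle_ineq[of "ergodic_average n T Y - ergodic_average k T Y"
        "ergodic_average n T Z - ergodic_average k T Z"]
      norm_triangle_ineq4[of "ergodic_average n T Z" "ergodic_average k T Z"]
    ultimately show ?thesis unfolding split by linarith
  qed
  then show "\<exists>N. \<forall>m\<ge>N. \<forall>n\<ge>N. norm (ergodic_average m T A - ergodic_average n T A) < \<epsilon>" by blast
qed

text \<open>Linear in the operator, the sum on the left can be estimated for each power of \<open>T\<close> separately.\<close>

lemma ergodic_average_Ky_Fan:
  assumes A: "A \<in> compact_ops" and uv: "suborthonormal {..<m} u" "suborthonormal {..<m} v"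
  shows "cmod (\<Sum>i<m. cinner (ergodic_average n T A (u i)) (v i)) \<le> (\<Sum>i<m. singular_values A i)"
proof -
  let ?K = "\<Sum>i<m. singular_values A i"
  have pow: "cmod (\<Sum>i<m. cinner ((T ^^ k) A (u i)) (v i)) \<le> ?K" for k
  proof -
    note Tk = DS_funpow[OF T, of k]
    obtain e where "compact_operator ((T ^^ k) A) e"
      by (rule compact_operator_exists[OF inf DS_compact_ops[OF inf Tk A]])
    then show ?thesis
      using compact_operator.Ky_Fan_upper uv DS_singular_values_submajorized[OF inf Tk A] order_trans by blast
  qed
  have "(\<Sum>i<m. cinner (ergodic_average n T A (u i)) (v i))
      = of_real (1 / (real n + 1)) * (\<Sum>k=0..n. \<Sum>i<m. cinner ((T ^^ k) A (u i)) (v i))"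
    by (subst sum.swap)
      (simp only: ergodic_average_def blinfun.scaleR_left blinfun.sum_left cinner_scaleR_left
        cinner.sum_left sum_distrib_left)
  then have "cmod (\<Sum>i<m. cinner (ergodic_average n T A (u i)) (v i))
      = (1 / (real n + 1)) * cmod (\<Sum>k=0..n. \<Sum>i<m. cinner ((T ^^ k) A (u i)) (v i))"
    by (simp only: norm_mult norm_of_real) simp
  also have "\<dots> \<le> (1 / (real n + 1)) * (\<Sum>k=0..n. ?K)"
    by (intro mult_left_mono sum_norm_le pow) simp
  also have "\<dots> = ?K" by (simp add: field_simps)
  finally show ?thesis .
qed

text \<open>Singular values of the limit are not followed along the sequence. Vectors that attain the Ky Fan sum of the limit
  are fixed instead, and the sums of the averages over these vectors converge to it.\<close>

theorem ergodic_average_converges: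
  assumes A: "A \<in> compact_ops"
  shows "\<exists>B\<in>compact_ops. (\<lambda>n. ergodic_average n T A) \<longlonglongrightarrow> B \<and>
    (\<forall>m. (\<Sum>i<m. singular_values B i) \<le> (\<Sum>i<m. singular_values A i))"
proof -
  obtain B where B: "(\<lambda>n. ergodic_average n T A) \<longlonglongrightarrow> B"
    using Cauchy_ergodic_average[OF A] Cauchy_convergent_iff convergent_def by blast
  have "B \<in> compact_ops"
  proof (rule compact_ops_approximable)
    show "B \<in> bounded_ops"
      by (rule bounded_ops_limit[OF _ B]) (intro compact_bounded_ops ergodic_average_compact A)
    fix \<epsilon> :: real assume "\<epsilon> > 0"
    then obtain n where "norm (ergodic_average n T A - B) < \<epsilon>"
      using LIMSEQ_D[OF B] by blast
    then show "\<exists>C\<in>compact_ops. norm (B - C) \<le> \<epsilon>"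
      using ergodic_average_compact[OF A, of n]
      by (intro bexI[of _ "ergodic_average n T A"]) (simp_all add: norm_minus_commute)
  qed
  moreover have "(\<Sum>i<m. singular_values B i) \<le> (\<Sum>i<m. singular_values A i)" for m
  proof -
    obtain e where "compact_operator B e" by (rule compact_operator_exists[OF inf \<open>B \<in> compact_ops\<close>])
    then interpret B: compact_operator B e .
    have "(\<lambda>n. cmod (\<Sum>i<m. cinner (ergodic_average n T A (e i)) (B.f i)))
        \<longlonglongrightarrow> cmod (\<Sum>i<m. cinner (B (e i)) (B.f i))"
      by (intro tendsto_norm tendsto_sum cinner.tendsto tendsto_const tendsto_blinfun_apply B)
    then have "cmod (\<Sum>i<m. cinner (B (e i)) (B.f i)) \<le> (\<Sum>i<m. singular_values A i)"
      by (rule Lim_bounded)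
        (intro allI impI ergodic_average_Ky_Fan A orthonormal_imp_suborthonormal B.e_orthonormal
          B.f_suborthonormal)
    then show ?thesis
      by (simp only: B.Ky_Fan_attained norm_of_real)
  qed
  ultimately show ?thesis using B by blast
qed

end

text \<open>For a decreasing sequence it is best to remove the first \<open>n\<close> indices. Any set of at most \<open>n\<close> indices leaves one
  of \<open>0, \<dots>, n\<close>, where the value is at least \<open>s n\<close>.\<close>

lemma rearrangement_decreasing:
  fixes s :: "nat \<Rightarrow> real"
  assumes s: "antimono s" "\<And>n. 0 \<le> s n"
  shows "rearrangement (\<lambda>n. complex_of_real (s n)) n = s n"
proof -
  define \<F> where "\<F> = {F :: nat set. finite F \<and> card F < Suc n}"
  have bdd: "bdd_above (s ` X)" for X
    using s(1) by (intro bdd_aboveI2[of _ _ "s 0"]) (simp add: antimonoD)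
  have cm: "cmod (complex_of_real (s m)) = s m" for m using s(2) by simp
  have "(INF F\<in>\<F>. SUP m\<in>-F. s m) = s n"
  proof (rule antisym)
    have "{..<n} \<in> \<F>" by (simp add: \<F>_def)
    moreover have "(SUP m\<in>-{..<n}. s m) \<le> s n"
      using s(1) by (intro cSUP_least) (auto simp: antimonoD)
    moreover have "0 \<le> (SUP m\<in>-F. s m)" if F: "F \<in> \<F>" for F
    proof -
      have "finite F" using F by (simp add: \<F>_def)
      then obtain k where "k \<in> - F" using ex_new_if_finite[OF infinite_UNIV_nat] by blast
      then show ?thesis using cSUP_upper[OF _ bdd] s(2)[of k] order_trans by blast
    qed
    then have "bdd_below ((\<lambda>F. SUP m\<in>-F. s m) ` \<F>)" by (intro bdd_belowI2)
    ultimately show "(INF F\<in>\<F>. SUP m\<in>-F. s m) \<le> s n" by (meson cINF_lower order_trans)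
    show "s n \<le> (INF F\<in>\<F>. SUP m\<in>-F. s m)"
    proof (rule cINF_greatest)
      show "\<F> \<noteq> {}" using \<open>{..<n} \<in> \<F>\<close> by blast
      fix F assume F: "F \<in> \<F>"
      have "\<not> {..n} \<subseteq> F"
        using F card_mono[of F "{..n}"] by (auto simp: \<F>_def)
      then obtain k where k: "k \<le> n" "k \<in> - F" by auto
      then have "s n \<le> s k" using s(1) by (simp add: antimonoD)
      also have "s k \<le> (SUP m\<in>-F. s m)" by (rule cSUP_upper[OF k(2) bdd])
      finally show "s n \<le> (SUP m\<in>-F. s m)" .
    qed
  qed
  then show ?thesis unfolding rearrangement_def cm \<F>_def .
qed

text \<open>Singular values are already decreasing, so submajorization compares their partial sums as they stand.\<close>

lemma symmetric_ideal_submajorized: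
  fixes A B :: "'a::complex_hilbert_space \<Rightarrow>\<^sub>L 'a"
  assumes inf: "infinite_dimensional TYPE('a)" and E: "fully_symmetric_space E N"
    and A: "A \<in> symmetric_ideal E" and B: "B \<in> compact_ops"
    and le: "\<And>m. (\<Sum>i<m. singular_values B i) \<le> (\<Sum>i<m. singular_values A i)"
  shows "B \<in> symmetric_ideal E"
proof -
  have AK: "A \<in> compact_ops" and AE: "(\<lambda>n. complex_of_real (singular_values A n)) \<in> E"
    using A by (auto simp: symmetric_ideal_def)
  have re: "rearrangement (\<lambda>n. complex_of_real (singular_values C n)) = singular_values C"
    if "C \<in> compact_ops" for C :: "'a \<Rightarrow>\<^sub>L 'a"
    using singular_values_spectral[OF inf that] by (intro ext rearrangement_decreasing) auto
  have "(\<lambda>n. complex_of_real (singular_values B n)) \<longlonglongrightarrow> of_real 0"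
    using singular_values_spectral[OF inf B] by (intro tendsto_of_real) blast
  then have "(\<lambda>n. complex_of_real (singular_values B n)) \<in> l_infinity"
    unfolding l_infinity_def by (simp add: convergent_imp_bounded)
  moreover have "(\<lambda>n. complex_of_real (singular_values B n)) \<prec>\<prec> (\<lambda>n. complex_of_real (singular_values A n))"
    unfolding submajorized_def re[OF AK] re[OF B] using le by blast
  ultimately have "(\<lambda>n. complex_of_real (singular_values B n)) \<in> E"
    using E AE unfolding fully_symmetric_space_def by blast
  then show ?thesis using B by (simp add: symmetric_ideal_def)
qed

section \<open>Averages of an operator that is not compact\<close>

lemma noncompact_orthonormal_sequence:
  fixes A :: "'a::complex_hilbert_space \<Rightarrow>\<^sub>L 'a"
  assumes A: "A \<in> bounded_ops" "A \<notin> compact_ops"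
  shows "\<exists>\<delta>>0. \<exists>u. orthonormal (UNIV :: nat set) u \<and> (\<forall>n. \<delta> \<le> norm (A (u n)))"
proof -
  obtain \<delta> where \<delta>: "\<delta> > 0"
    and big: "\<And>F. finite F \<Longrightarrow> \<exists>v. (\<forall>f\<in>F. cinner v f = 0) \<and> \<delta> * norm v < norm (A v)"
    using compact_opsI[OF A(1)] A(2) by (meson not_le_imp_less)
  have "\<exists>e. norm e = 1 \<and> (\<forall>f\<in>F. cinner e f = 0) \<and> True \<and> \<delta> \<le> norm (A e)" if F: "finite F" for F
  proof -
    obtain v where v: "\<forall>f\<in>F. cinner v f = 0" "\<delta> * norm v < norm (A v)" using big[OF F] by blast
    then have "v \<noteq> 0" by auto
    then show ?thesis using v
      by (intro exI[of _ "(1 / norm v) *\<^sub>R v"])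
        (simp add: cinner_scaleR_left blinfun.scaleR_right field_simps)
  qed
  then show ?thesis
    using orthonormal_sequence_greedy[of "\<lambda>_. True" "\<lambda>F e. \<delta> \<le> norm (A e)"] \<delta> by blast
qed

text \<open>Multiplies \<open>u n\<close> by \<open>w n\<close> and fixes the orthogonal complement. Written as a perturbation of the identity, it is
  given by a series that converges absolutely when \<open>\<Sum> |w n - 1|\<close> is finite.\<close>

definition diagonal_unitary :: "(nat \<Rightarrow> 'a::complex_hilbert_space) \<Rightarrow> (nat \<Rightarrow> complex) \<Rightarrow> ('a \<Rightarrow>\<^sub>L 'a)" where
  "diagonal_unitary u w = id_blinfun + (\<Sum>n. rank_one ((w n - 1) *\<^sub>C u n) (u n))"

context
  fixes u :: "nat \<Rightarrow> 'a::complex_hilbert_space" and w :: "nat \<Rightarrow> complex"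
  assumes u: "orthonormal UNIV u" and w: "\<And>n. cmod (w n) = 1" and sm: "summable (\<lambda>n. cmod (w n - 1))"
begin

lemma cinner_u: "cinner (u i) (u j) = (if i = j then 1 else 0)"
  using u by (simp add: orthonormal_def)

lemma summable_rank_one: "summable (\<lambda>n. rank_one ((w n - 1) *\<^sub>C u n) (u n))"
proof (rule summable_comparison_test'[OF sm])
  fix n
  show "norm (rank_one ((w n - 1) *\<^sub>C u n) (u n)) \<le> cmod (w n - 1)"
  proof (rule norm_blinfun_bound)
    fix v
    have "cmod (cinner v (u n)) \<le> norm v"
      using cmod_cinner_le[of v "u n"] orthonormal_norm[OF u] by simp
    then show "norm (rank_one ((w n - 1) *\<^sub>C u n) (u n) v) \<le> cmod (w n - 1) * norm v"
      using orthonormal_norm[OF u] by (simp add: norm_scaleC norm_mult mult.commute mult_right_mono)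
  qed simp
qed

lemma diagonal_unitary_sums:
  "(\<lambda>n. cinner v (u n) *\<^sub>C (w n - 1) *\<^sub>C u n) sums (diagonal_unitary u w v - v)"
  using bounded_linear.sums[OF blinfun.bounded_linear_left summable_sums[OF summable_rank_one], of v]
  by (simp add: diagonal_unitary_def blinfun.add_left)

lemma diagonal_unitary_cinner_sums:
  "(\<lambda>n. (w n - 1) * (cinner v (u n) * cinner (u n) x)) sums (cinner (diagonal_unitary u w v) x - cinner v x)"
  using bounded_linear.sums[OF cinner.bounded_linear_left diagonal_unitary_sums, of v x]
  by (simp add: cinner_scaleC_left cinner.diff_left mult_ac)

lemma diagonal_unitary_cinner_basis: "cinner (diagonal_unitary u w v) (u m) = w m * cinner v (u m)"
proof -
  have "(\<lambda>n. (w n - 1) * (cinner v (u n) * cinner (u n) (u m))) sums ((w m - 1) * cinner v (u m))"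
    using sums_single[of m "\<lambda>n. (w n - 1) * cinner v (u n)"]
    by (rule back_subst[of "\<lambda>g. g sums _"]) (auto simp: cinner_u)
  from sums_unique2[OF this diagonal_unitary_cinner_sums] show ?thesis by (simp add: algebra_simps)
qed

lemma diagonal_unitary_basis: "diagonal_unitary u w (u m) = w m *\<^sub>C u m"
proof -
  have "(\<lambda>n. cinner (u m) (u n) *\<^sub>C (w n - 1) *\<^sub>C u n) sums ((w m - 1) *\<^sub>C u m)"
    using sums_single[of m "\<lambda>n. (w n - 1) *\<^sub>C u n"]
    by (rule back_subst[of "\<lambda>g. g sums _"]) (auto simp: cinner_u scaleC_one)
  from sums_unique2[OF this diagonal_unitary_sums]
  have "diagonal_unitary u w (u m) = u m + (w m - 1) *\<^sub>C u m" by (simp add: algebra_simps)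
  also have "\<dots> = w m *\<^sub>C u m"
    by (simp add: complex_vector.scale_left_diff_distrib scaleC_one)
  finally show ?thesis .
qed

lemma diagonal_unitary_bounded_ops: "diagonal_unitary u w \<in> bounded_ops"
  unfolding diagonal_unitary_def
proof (rule bounded_ops_add[OF bounded_ops_id])
  have "(\<lambda>k. \<Sum>n<k. rank_one ((w n - 1) *\<^sub>C u n) (u n)) \<longlonglongrightarrow> (\<Sum>n. rank_one ((w n - 1) *\<^sub>C u n) (u n))"
    by (rule summable_LIMSEQ[OF summable_rank_one])
  then show "(\<Sum>n. rank_one ((w n - 1) *\<^sub>C u n) (u n)) \<in> bounded_ops"
    by (rule bounded_ops_limit[rotated]) (intro bounded_ops_sum rank_one_bounded_ops)
qed

end

context
  fixes u :: "nat \<Rightarrow> 'a::complex_hilbert_space" and w :: "nat \<Rightarrow> complex"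
  assumes u: "orthonormal UNIV u" and w: "\<And>n. cmod (w n) = 1" and sm: "summable (\<lambda>n. cmod (w n - 1))"
begin

abbreviation (input) D where "D \<equiv> diagonal_unitary u w"
abbreviation (input) D' where "D' \<equiv> diagonal_unitary u (\<lambda>n. cnj (w n))"

lemma cnj_unimodular: "cmod (cnj (w n)) = 1" and summable_cnj: "summable (\<lambda>n. cmod (cnj (w n) - 1))"
  using sm by (simp_all add: w flip: complex_mod_cnj[of "w _ - 1"])

lemma diagonal_unitary_adjoint: "cinner (D v) x = cinner v (D' x)"
proof -
  have "(\<lambda>n. cnj ((cnj (w n) - 1) * (cinner x (u n) * cinner (u n) v))) sums cnj (cinner (D' x) v - cinner x v)"
    by (rule bounded_linear.sums[OF bounded_linear_cnj
          diagonal_unitary_cinner_sums[OF u cnj_unimodular summable_cnj]])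
  also have "(\<lambda>n. cnj ((cnj (w n) - 1) * (cinner x (u n) * cinner (u n) v)))
      = (\<lambda>n. (w n - 1) * (cinner v (u n) * cinner (u n) x))"
    using cinner_commute[of x "u _"] cinner_commute[of "u _" v] by (simp add: mult_ac fun_eq_iff)
  also have "cnj (cinner (D' x) v - cinner x v) = cinner v (D' x) - cinner v x"
    using cinner_commute[of v "D' x"] cinner_commute[of v x] by simp
  finally show ?thesis
    using sums_unique2[OF diagonal_unitary_cinner_sums[OF u w sm, of v x]] by fastforce
qed

text \<open>The series for \<open>D' (D x) - D x\<close> is the negative of the one for \<open>D x - x\<close>, term by term, because
  \<open>w (cnj w - 1) = - (w - 1)\<close> for \<open>|w| = 1\<close>.\<close>

lemma diagonal_unitary_inverse: "D' (D x) = x"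
proof -
  have "cinner (D x) (u n) *\<^sub>C (cnj (w n) - 1) *\<^sub>C u n = - (cinner x (u n) *\<^sub>C (w n - 1) *\<^sub>C u n)" for n
  proof -
    have "w n * cnj (w n) = 1" by (simp add: w flip: complex_norm_square)
    then have "w n * cinner x (u n) * (cnj (w n) - 1) = - (cinner x (u n) * (w n - 1))"
      by (simp add: algebra_simps)
    then show ?thesis
      by (simp only: diagonal_unitary_cinner_basis[OF u w sm] scaleC_scaleC complex_vector.scale_minus_left)
  qed
  then have "(\<lambda>n. - (cinner x (u n) *\<^sub>C (w n - 1) *\<^sub>C u n)) sums (D' (D x) - D x)"
    using diagonal_unitary_sums[OF u cnj_unimodular summable_cnj, of "D x"] by simp
  from sums_unique2[OF this sums_minus[OF diagonal_unitary_sums[OF u w sm]]] show ?thesis by simp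
qed

lemma diagonal_unitary_isometry: "cinner (D v) (D x) = cinner v x"
  by (simp add: diagonal_unitary_adjoint diagonal_unitary_inverse)

end

text \<open>Here \<open>V\<close> is the inverse of the unitary operator \<open>U\<close>. The absolute value of \<open>A U\<close> is \<open>V |A| U\<close>, and its trace is that
  of \<open>|A|\<close> computed along the orthonormal vectors \<open>U e\<close>.\<close>

lemma dunford_schwartz_unitary:
  fixes U V :: "'a::complex_hilbert_space \<Rightarrow>\<^sub>L 'a"
  assumes U: "U \<in> bounded_ops" and V: "V \<in> bounded_ops"
    and adj: "\<And>v w. cinner (U v) w = cinner v (V w)"
    and isoU: "\<And>v w. cinner (U v) (U w) = cinner v w" and isoV: "\<And>v w. cinner (V v) (V w) = cinner v w"
  shows "dunford_schwartz (\<lambda>A. A o\<^sub>L U)"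
  unfolding dunford_schwartz_def
proof (intro conjI ballI allI)
  fix A B :: "'a \<Rightarrow>\<^sub>L 'a" and c
  show "(A + B) o\<^sub>L U = (A o\<^sub>L U) + (B o\<^sub>L U)" by (rule comp.add_left)
  show "scaleC_op c A o\<^sub>L U = scaleC_op c (A o\<^sub>L U)"
    by (rule blinfun_eqI) (simp add: scaleC_op.rep_eq)
  show "norm (A o\<^sub>L U) \<le> norm A"
  proof -
    have "norm (U v) = norm v" for v using isoU[of v v] by (simp add: cinner_self del: of_real_power)
    then have "norm U \<le> 1" by (intro norm_blinfun_bound) auto
    then have "norm A * norm U \<le> norm A" by (simp add: mult_left_le)
    then show ?thesis using norm_blinfun_compose order_trans by blast
  qed
next
  fix A :: "'a \<Rightarrow>\<^sub>L 'a" assume A: "A \<in> bounded_ops"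
  then show "A o\<^sub>L U \<in> bounded_ops" by (rule bounded_ops_compose[OF _ U])
next
  fix A :: "'a \<Rightarrow>\<^sub>L 'a" assume "A \<in> trace_class"
  then have A: "A \<in> bounded_ops" by (simp add: trace_class_def)
  note P = abs_op_positive[OF A]
  have q: "cinner ((V o\<^sub>L (abs_op A o\<^sub>L U)) v) w = cinner (abs_op A (U v)) (U w)" for v w
    by (simp, metis adj cinner_commute)
  have pos: "V o\<^sub>L (abs_op A o\<^sub>L U) \<in> positive_ops"
  proof (rule positiveI)
    show "V o\<^sub>L (abs_op A o\<^sub>L U) \<in> bounded_ops"
      by (intro bounded_ops_compose V U positive_bounded_ops P)
    show "0 \<le> Re (cinner ((V o\<^sub>L (abs_op A o\<^sub>L U)) v) v)" for v
      unfolding q by (rule positive_cinner_ge0[OF P])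
    show "cinner ((V o\<^sub>L (abs_op A o\<^sub>L U)) v) w = cinner v ((V o\<^sub>L (abs_op A o\<^sub>L U)) w)" for v w
      unfolding q by (simp add: positive_hermitian[OF P] adj)
  qed
  have "abs_op (A o\<^sub>L U) = V o\<^sub>L (abs_op A o\<^sub>L U)"
    by (rule abs_op_eqI[OF bounded_ops_compose[OF A U] pos]) (simp add: isoV cinner_abs_op[OF A])
  moreover have "op_trace (V o\<^sub>L (abs_op A o\<^sub>L U)) \<le> op_trace (abs_op A)"
  proof (cases "op_trace (abs_op A)")
    case (real c)
    have "(\<Sum>e\<in>F. Re (cinner ((V o\<^sub>L (abs_op A o\<^sub>L U)) e) e)) \<le> c" if F: "finite F" "F \<subseteq> std_basis" for F
    proof -
      have "suborthonormal F (\<lambda>e. U e)"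
        using orthonormal_basis_orthonormal[OF std_basis F(2)]
        by (intro orthonormal_imp_suborthonormal) (simp add: orthonormal_def isoU)
      from sum_le_op_trace[OF P F(1) this] show ?thesis
        unfolding q real by (simp add: ennreal_le_iff real(1))
    qed
    then show ?thesis unfolding real(2) by (rule op_trace_le[OF pos])
  qed simp
  ultimately show "trace_norm (A o\<^sub>L U) \<le> trace_norm A" by (simp add: trace_norm_def)
qed

lemma power_averages_tendsto_0:
  fixes z :: complex
  assumes "cmod z = 1" "z \<noteq> 1"
  shows "(\<lambda>N. (\<Sum>k=0..N. z ^ k) / of_nat (Suc N)) \<longlonglongrightarrow> 0"
proof (rule tendsto_norm_zero_cancel)
  have bound: "cmod ((\<Sum>k=0..N. z ^ k) / of_nat (Suc N)) \<le> (2 / cmod (1 - z)) * (1 / real (Suc N))" for N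
  proof -
    have "(1 - z) * (\<Sum>k=0..N. z ^ k) = 1 - z ^ Suc N"
      unfolding atLeast0AtMost lessThan_Suc_atMost[symmetric] by (rule one_diff_power_eq[symmetric])
    then have "cmod (1 - z) * cmod (\<Sum>k=0..N. z ^ k) \<le> 2"
      using norm_triangle_ineq4[of 1 "z ^ Suc N"] assms(1)
      by (metis norm_mult norm_one norm_power one_add_one power_one)
    then have "cmod (\<Sum>k=0..N. z ^ k) \<le> 2 / cmod (1 - z)"
      using assms(2) by (simp add: pos_le_divide_eq mult.commute)
    moreover have "cmod ((\<Sum>k=0..N. z ^ k) / of_nat (Suc N)) = cmod (\<Sum>k=0..N. z ^ k) * (1 / real (Suc N))"
      by (simp add: norm_divide del: of_nat_Suc)
    ultimately show ?thesis by (simp only:) (rule mult_right_mono, simp_all)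
  qed
  have "(\<lambda>N. (2 / cmod (1 - z)) * (1 / real (Suc N))) \<longlonglongrightarrow> (2 / cmod (1 - z)) * 0"
    by (intro tendsto_mult tendsto_const LIMSEQ_Suc[OF lim_1_over_n])
  then have upper: "(\<lambda>N. (2 / cmod (1 - z)) * (1 / real (Suc N))) \<longlonglongrightarrow> 0" by simp
  show "(\<lambda>N. cmod ((\<Sum>k=0..N. z ^ k) / of_nat (Suc N))) \<longlonglongrightarrow> 0"
    by (rule tendsto_sandwich[OF always_eventually always_eventually tendsto_const upper])
      (intro allI norm_ge_zero bound)+
qed

text \<open>The Cayley transform \<open>(1 + \<i> t) / (1 - \<i> t)\<close> of a real number \<open>t\<close> lies on the unit circle at distance at most \<open>2 |t|\<close>
  from \<open>1\<close>.\<close>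

lemma unimodular_sequence_exists:
  "\<exists>w :: nat \<Rightarrow> complex. (\<forall>n. cmod (w n) = 1 \<and> w n \<noteq> 1) \<and> summable (\<lambda>n. cmod (w n - 1))"
proof -
  define t :: "nat \<Rightarrow> real" where "t n = (1/2) ^ n" for n
  define w where "w n = Complex 1 (t n) / Complex 1 (- t n)" for n
  have nz: "Complex 1 (- t n) \<noteq> 0" for n by (simp add: complex_eq_iff)
  have d: "w n - 1 = Complex 0 (2 * t n) / Complex 1 (- t n)" for n
  proof -
    have "w n - 1 = (Complex 1 (t n) - Complex 1 (- t n)) / Complex 1 (- t n)"
      using nz[of n] by (simp add: w_def diff_divide_distrib)
    also have "Complex 1 (t n) - Complex 1 (- t n) = Complex 0 (2 * t n)" by (simp add: complex_eq_iff)
    finally show ?thesis .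
  qed
  have "cmod (w n) = 1" for n
  proof -
    have "cmod (Complex 1 (t n)) = cmod (Complex 1 (- t n))" by (simp add: cmod_def)
    moreover have "cmod (Complex 1 (- t n)) \<noteq> 0" using nz by simp
    ultimately show ?thesis by (simp add: w_def norm_divide del: norm_eq_zero)
  qed
  moreover have "w n \<noteq> 1" for n
  proof
    assume "w n = 1"
    then have "Complex 0 (2 * t n) = 0" using d[of n] nz[of n] by simp
    then show False by (simp add: t_def complex_eq_iff)
  qed
  moreover have "summable (\<lambda>n. cmod (w n - 1))"
  proof (rule summable_comparison_test')
    show "summable (\<lambda>n. 2 * t n)" unfolding t_def by (intro summable_mult summable_geometric) simp
    fix n
    have "1 \<le> cmod (Complex 1 (- t n))" using abs_Re_le_cmod[of "Complex 1 (- t n)"] by simp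
    moreover have "cmod (Complex 0 (2 * t n)) = 2 * t n" by (simp add: cmod_eq_Im t_def)
    moreover have "0 \<le> 2 * t n" by (simp add: t_def)
    ultimately show "norm (cmod (w n - 1)) \<le> 2 * t n"
      unfolding d by (simp add: norm_divide divide_le_eq mult_left_le mult_le_cancel_left1)
  qed
  ultimately show ?thesis by blast
qed

theorem noncompact_averages_diverge:
  fixes A :: "'a::complex_hilbert_space \<Rightarrow>\<^sub>L 'a"
  assumes A: "A \<in> bounded_ops" "A \<notin> compact_ops"
  shows "\<exists>T. dunford_schwartz T \<and> (\<forall>y. \<not> (\<lambda>n. norm (ergodic_average n T A - y)) \<longlonglongrightarrow> 0)"
proof -
  obtain \<delta> u where \<delta>: "\<delta> > 0" and u: "orthonormal (UNIV :: nat set) u" and big: "\<And>n. \<delta> \<le> norm (A (u n))"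
    using noncompact_orthonormal_sequence[OF A] by blast
  obtain w :: "nat \<Rightarrow> complex" where w: "\<And>n. cmod (w n) = 1" and w1: "\<And>n. w n \<noteq> 1" and sm: "summable (\<lambda>n. cmod (w n - 1))"
    using unimodular_sequence_exists by blast
  define U where "U = diagonal_unitary u w"
  define T :: "('a \<Rightarrow>\<^sub>L 'a) \<Rightarrow> ('a \<Rightarrow>\<^sub>L 'a)" where "T B = B o\<^sub>L U" for B
  have DS: "dunford_schwartz T"
    unfolding T_def[abs_def] U_def
    by (rule dunford_schwartz_unitary[OF diagonal_unitary_bounded_ops[OF u w sm]
          diagonal_unitary_bounded_ops[OF u cnj_unimodular[OF u w sm] summable_cnj[OF u w sm]]
          diagonal_unitary_adjoint[OF u w sm] diagonal_unitary_isometry[OF u w sm]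
          diagonal_unitary_isometry[OF u cnj_unimodular[OF u w sm] summable_cnj[OF u w sm]]])
  define a where "a N n = (\<Sum>k=0..N. w n ^ k) / of_nat (Suc N)" for N n
  have pow: "(T ^^ k) A (u n) = w n ^ k *\<^sub>C A (u n)" for k n
  proof (induction k)
    case (Suc k)
    have "(T ^^ k) A \<in> bounded_ops" by (rule DS_bounded_ops[OF DS_funpow[OF DS] A(1)])
    then have "(T ^^ Suc k) A (u n) = w n *\<^sub>C (T ^^ k) A (u n)"
      by (simp add: T_def U_def diagonal_unitary_basis[OF u w sm] bounded_ops_scaleC)
    then show ?case by (simp add: Suc scaleC_scaleC)
  qed (simp add: scaleC_one)
  have avg: "ergodic_average N T A (u n) = a N n *\<^sub>C A (u n)" for N n
    by (simp add: ergodic_average_def a_def blinfun.scaleR_left blinfun.sum_left pow scaleR_scaleC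
        scaleC_scaleC complex_vector.scale_sum_left[symmetric] add.commute)
  have "\<not> (\<lambda>N. norm (ergodic_average N T A - y)) \<longlonglongrightarrow> 0" for y
  proof
    assume lim: "(\<lambda>N. norm (ergodic_average N T A - y)) \<longlonglongrightarrow> 0"
    have y0: "y (u n) = 0" for n
    proof -
      have "(\<lambda>N. ergodic_average N T A) \<longlonglongrightarrow> y" using lim by (simp add: LIM_zero_iff tendsto_norm_zero_iff)
      then have "(\<lambda>N. ergodic_average N T A (u n)) \<longlonglongrightarrow> y (u n)" by (rule tendsto_blinfun_apply)
      moreover have "(\<lambda>N. cmod (a N n) * norm (A (u n))) \<longlonglongrightarrow> 0 * norm (A (u n))"
        unfolding a_def by (intro tendsto_mult tendsto_const tendsto_norm_zero power_averages_tendsto_0 w w1)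
      then have "(\<lambda>N. norm (ergodic_average N T A (u n))) \<longlonglongrightarrow> 0" by (simp add: avg norm_scaleC)
      then have "(\<lambda>N. ergodic_average N T A (u n)) \<longlonglongrightarrow> 0" by (rule tendsto_norm_zero_cancel)
      ultimately show ?thesis by (rule LIMSEQ_unique)
    qed
    have "\<delta> \<le> norm (ergodic_average N T A - y)" for N
    proof -
      have le: "cmod (a N n) * \<delta> \<le> norm (ergodic_average N T A - y)" for n
      proof -
        have "cmod (a N n) * \<delta> \<le> cmod (a N n) * norm (A (u n))" by (intro mult_left_mono big) simp
        also have "\<dots> = norm ((ergodic_average N T A - y) (u n))"
          by (simp add: blinfun.diff_left y0 avg norm_scaleC)
        also have "\<dots> \<le> norm (ergodic_average N T A - y) * norm (u n)" by (rule norm_blinfun)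
        finally show ?thesis by (simp add: orthonormal_norm[OF u])
      qed
      have "(\<lambda>n. w n - 1) \<longlonglongrightarrow> 0" by (rule tendsto_norm_zero_cancel[OF summable_LIMSEQ_zero[OF sm]])
      then have "w \<longlonglongrightarrow> 1" by (simp add: LIM_zero_iff)
      then have "(\<lambda>n. a N n) \<longlonglongrightarrow> (\<Sum>k=0..N. 1 ^ k) / of_nat (Suc N)"
        unfolding a_def by (intro tendsto_intros) (simp_all del: of_nat_Suc)
      then have "(\<lambda>n. cmod (a N n) * \<delta>) \<longlonglongrightarrow> cmod ((\<Sum>k=0..N. 1 ^ k) / of_nat (Suc N)) * \<delta>"
        by (intro tendsto_mult tendsto_norm tendsto_const)
      then have "cmod ((\<Sum>k=0..N. 1 ^ k) / of_nat (Suc N)) * \<delta> \<le> norm (ergodic_average N T A - y)"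
        by (rule Lim_bounded) (use le in blast)
      then show ?thesis by (simp del: of_nat_Suc)
    qed
    then have "\<delta> \<le> 0" using LIMSEQ_le_const[OF lim] by blast
    then show False using \<delta> by simp
  qed
  then show ?thesis using DS by blast
qed

section \<open>Averages on the ideals of compact operators\<close>

theorem theorem1p2:
  fixes E :: "(nat \<Rightarrow> complex) set" and N :: "(nat \<Rightarrow> complex) \<Rightarrow> real"
  assumes "infinite_dimensional TYPE('a::complex_hilbert_space)"
    and "fully_symmetric_space E N"
    and "E \<subseteq> c_zero"
  shows "(\<forall>(T :: ('a \<Rightarrow>\<^sub>L 'a) \<Rightarrow> ('a \<Rightarrow>\<^sub>L 'a)) x. dunford_schwartz T \<longrightarrow> x \<in> symmetric_ideal E \<longrightarrow>
            (\<exists>x'\<in>symmetric_ideal E. (\<lambda>n. norm (ergodic_average n T x - x')) \<longlonglongrightarrow> 0)) \<and>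
         (\<forall>x :: 'a \<Rightarrow>\<^sub>L 'a. x \<in> bounded_ops - compact_ops \<longrightarrow>
            (\<exists>T. dunford_schwartz T \<and>
              \<not> (\<exists>y\<in>bounded_ops. (\<lambda>n. norm (ergodic_average n T x - y)) \<longlonglongrightarrow> 0)))"
proof (intro conjI allI impI)
  fix T :: "('a \<Rightarrow>\<^sub>L 'a) \<Rightarrow> ('a \<Rightarrow>\<^sub>L 'a)" and x :: "'a \<Rightarrow>\<^sub>L 'a"
  assume T: "dunford_schwartz T" and x: "x \<in> symmetric_ideal E"
  then have "x \<in> compact_ops" by (simp add: symmetric_ideal_def)
  from ergodic_average_converges[OF assms(1) T this]
  obtain x' where x': "x' \<in> compact_ops" "(\<lambda>n. ergodic_average n T x) \<longlonglongrightarrow> x'"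
    and le: "\<forall>m. (\<Sum>i<m. singular_values x' i) \<le> (\<Sum>i<m. singular_values x i)"
    by (elim bexE conjE)
  have "x' \<in> symmetric_ideal E" by (rule symmetric_ideal_submajorized[OF assms(1,2) x x'(1)]) (rule le[rule_format])
  moreover have "(\<lambda>n. norm (ergodic_average n T x - x')) \<longlonglongrightarrow> 0"
    using x'(2) by (simp add: LIM_zero tendsto_norm_zero)
  ultimately show "\<exists>x'\<in>symmetric_ideal E. (\<lambda>n. norm (ergodic_average n T x - x')) \<longlonglongrightarrow> 0" by blast
next
  fix x :: "'a \<Rightarrow>\<^sub>L 'a" assume "x \<in> bounded_ops - compact_ops"
  then show "\<exists>T. dunford_schwartz T \<and> \<not> (\<exists>y\<in>bounded_ops. (\<lambda>n. norm (ergodic_average n T x - y)) \<longlonglongrightarrow> 0)"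
    using noncompact_averages_diverge[of x] by blast
qed

end
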